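(* Let $E$ be a directed graph (i.e., quiver), $R$ a commutative ring with unit and $L_R(E)$ the Leavitt path algebra of $E$ over $R$. (1) $L_R(E)$ is Noetherian if and only if $R$ is Noetherian, $E$ is finite and no cycle in $E$ has an exit, i.e., $E$ satisfies condition (NE). Moreover, in this case $L_R(E)$ is (up to isomorphism) a finite direct product of matrix algebras over $R$ and $R[x,x^{-1}]$. (2) $L_R(E)$ is Artinian if and only if $R$ is Artinian and $E$ is finite acyclic, in which case it is (up to isomorphism) a finite direct product of matrix algebras over $R$. (3) $L_R(E)$ is semisimple if and only if $R$ is a finite direct product of fields and $E$ is finite acyclic.
   Context: A directed graph $E=(E^{(0)},E^{(1)})$ has vertex set $E^{(0)}$ and edge set $E^{(1)}$ (of arbitrary cardinality; loops and parallel edges allowed), with source map $s$ and range map $r$ from $E^{(1)}$ to $E^{(0)}$. $E$ is finite if both $E^{(0)}$ and $E^{(1)}$ are finite. A vertex $v$ is a sink if $s^{-1}(v)=\emptyset$, and an infinite emitter if $s^{-1}(v)$ is infinite. A cycle is a simple, directed, closed circuit (of positive length, not repeating vertices except that it returns to its start); it has an exit if some vertex on it has out-degree at least two. $E$ satisfies condition (NE) if no cycle in $E$ has an exit. $E$ is acyclic if it has no cycles. The Leavitt path algebra $L_R(E)$ is the associative (not necessarily unital) $R$-algebra generated by a set $\{v\in E^{(0)}\}$ of pairwise orthogonal idempotents and a set of variables $\{e,e^*\mid e\in E^{(1)}\}$ subject to the relations: (i) $s(e)e=e=e\,r(e)$ for all $e\in E^{(1)}$; (ii) $r(e)e^*=e^*=e^*s(e)$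 for all $e\in E^{(1)}$; (iii) $e^*e'=\delta_{e,e'}r(e)$ for all $e,e'\in E^{(1)}$; (iv) $v=\sum_{e\in s^{-1}(v)}ee^*$ whenever $v$ is not a sink and not an infinite emitter. $R[x,x^{-1}]$ is the ring of Laurent polynomials in one variable over $R$. In (1), each factor of the product is a matrix algebra over $R$ or over $R[x,x^{-1}]$. A (not necessarily unital) ring is Noetherian (resp. Artinian) if it satisfies the ascending (resp. descending) chain condition on left ideals; for $L_R(E)$ the left and right conditions are equivalent because it has an involution. A ring is semisimple if it is unital and semisimple as a left module over itself.
   Formalization: The graph E is assumed to have at least one vertex and the ring R to be nonzero; otherwise the Leavitt path algebra is zero, hence Noetherian, Artinian and semisimple whatever R (for empty E) or E (for R = 0) is, and the stated equivalences fail. *)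

theory Defs
  imports
    "HOL-Library.Poly_Mapping"
    "HOL-Algebra.Chinese_Remainder"
    "HOL-Algebra.QuotRing"
    "Jordan_Normal_Form.VS_Connect"
    "Graph_Theory.Arc_Walk"
begin

section \<open>Chain conditions and semisimplicity for rings that need not be unital\<close>

text \<open>
  A ring without unit is represented by the HOL-Algebra record type \<open>ring\<close>; nothing in this
  section refers to the field \<open>one\<close> of the record.
\<close>

definition left_ideal :: "'a set \<Rightarrow> ('a, 'm) ring_scheme \<Rightarrow> bool" where
  "left_ideal I A \<longleftrightarrow>
     additive_subgroup I A \<and> (\<forall>a\<in>carrier A. \<forall>x\<in>I. a \<otimes>\<^bsub>A\<^esub> x \<in> I)"

definition left_noetherian :: "('a, 'm) ring_scheme \<Rightarrow> bool" where
  "left_noetherian A \<longleftrightarrow>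
     (\<forall>I :: nat \<Rightarrow> 'a set. (\<forall>n. left_ideal (I n) A) \<and> (\<forall>n. I n \<subseteq> I (Suc n))
        \<longrightarrow> (\<exists>N. \<forall>n\<ge>N. I n = I N))"

definition left_artinian :: "('a, 'm) ring_scheme \<Rightarrow> bool" where
  "left_artinian A \<longleftrightarrow>
     (\<forall>I :: nat \<Rightarrow> 'a set. (\<forall>n. left_ideal (I n) A) \<and> (\<forall>n. I (Suc n) \<subseteq> I n)
        \<longrightarrow> (\<exists>N. \<forall>n\<ge>N. I n = I N))"

definition has_unit :: "('a, 'm) ring_scheme \<Rightarrow> bool" where
  "has_unit A \<longleftrightarrow>
     (\<exists>u\<in>carrier A. \<forall>x\<in>carrier A. u \<otimes>\<^bsub>A\<^esub> x = x \<and> x \<otimes>\<^bsub>A\<^esub> u = x)"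

definition simple_left_ideal :: "'a set \<Rightarrow> ('a, 'm) ring_scheme \<Rightarrow> bool" where
  "simple_left_ideal S A \<longleftrightarrow>
     left_ideal S A \<and> S \<noteq> {\<zero>\<^bsub>A\<^esub>} \<and>
     (\<forall>J. left_ideal J A \<and> J \<subseteq> S \<longrightarrow> J = {\<zero>\<^bsub>A\<^esub>} \<or> J = S)"

text \<open>
  Internal direct sum of a (possibly infinite) set \<open>\<S>\<close> of left ideals: every element is in
  exactly one way a sum of components, almost all of them zero.
\<close>

definition is_direct_sum :: "('a, 'm) ring_scheme \<Rightarrow> 'a set set \<Rightarrow> bool" where
  "is_direct_sum A \<S> \<longleftrightarrow>
     (\<forall>x\<in>carrier A. \<exists>!f. f \<in> (\<Pi>\<^sub>E S\<in>\<S>. S) \<and> finite {S\<in>\<S>. f S \<noteq> \<zero>\<^bsub>A\<^esub>} \<and>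
        x = (\<Oplus>\<^bsub>A\<^esub>S\<in>{S\<in>\<S>. f S \<noteq> \<zero>\<^bsub>A\<^esub>}. f S))"

definition semisimple_ring :: "('a, 'm) ring_scheme \<Rightarrow> bool" where
  "semisimple_ring A \<longleftrightarrow>
     has_unit A \<and> (\<exists>\<S>. (\<forall>S\<in>\<S>. simple_left_ideal S A) \<and> is_direct_sum A \<S>)"

text \<open>
  Every factor of a product decomposition of \<open>R\<close> is isomorphic to an ideal of \<open>R\<close>, so it is no
  restriction to look for the fields among the structures carried by subsets of the type of \<open>R\<close>.
\<close>

definition finite_product_of_fields :: "('a, 'm) ring_scheme \<Rightarrow> bool" where
  "finite_product_of_fields R \<longleftrightarrow>
     (\<exists>Fs :: 'a ring list. (\<forall>F\<in>set Fs. field F) \<and> R \<simeq> RDirProd_list Fs)"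


section \<open>Algebras over a commutative ring\<close>

text \<open>
  An algebra over the ring of all elements of a type \<open>'r\<close> is represented by the HOL-Algebra
  record type \<open>('r, 'a) module\<close>, as in the locale \<open>algebra\<close>.
\<close>

definition algebra_isomorphic :: "('r, 'a) module \<Rightarrow> ('r, 'b) module \<Rightarrow> bool" where
  "algebra_isomorphic A B \<longleftrightarrow>
     (\<exists>h\<in>ring_iso A B. \<forall>c. \<forall>x\<in>carrier A. h (c \<odot>\<^bsub>A\<^esub> x) = c \<odot>\<^bsub>B\<^esub> h x)"

definition algebra_prod :: "('r, 'a) module \<Rightarrow> ('r, 'b) module \<Rightarrow> ('r, 'a \<times> 'b) module" where
  "algebra_prod A B =
     ring.extend (RDirProd A B) \<lparr>smult = (\<lambda>c (x, y). (c \<odot>\<^bsub>A\<^esub> x, c \<odot>\<^bsub>B\<^esub> y))\<rparr>"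

definition algebra_prod_list :: "('r, 'a) module list \<Rightarrow> ('r, 'a list) module" where
  "algebra_prod_list As =
     ring.extend (RDirProd_list As) \<lparr>smult = (\<lambda>c xs. map2 (\<lambda>A x. c \<odot>\<^bsub>A\<^esub> x) As xs)\<rparr>"

text \<open>
  The Laurent polynomial ring \<open>R[x, x\<^sup>-\<^sup>1]\<close> is the ring of finitely supported functions
  \<open>\<int> \<Rightarrow> R\<close> with convolution; \<open>single k c\<close> stands for \<open>c x\<^sup>k\<close>.
\<close>

type_synonym 'r laurent = "int \<Rightarrow>\<^sub>0 'r"

definition laurent_module_mat :: "nat \<Rightarrow> ('r::comm_ring_1, 'r laurent mat) module" where
  "laurent_module_mat n =
     ring.extend (ring_mat TYPE('r laurent) n ())
       \<lparr>smult = (\<lambda>c M. Poly_Mapping.single 0 c \<cdot>\<^sub>m M)\<rparr>"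

definition matrix_product :: "nat list \<Rightarrow> ('r::comm_ring_1, 'r mat list) module" where
  "matrix_product ms = algebra_prod_list (map (\<lambda>m. module_mat TYPE('r) m m) ms)"

definition laurent_matrix_product ::
  "nat list \<Rightarrow> ('r::comm_ring_1, 'r laurent mat list) module" where
  "laurent_matrix_product ns = algebra_prod_list (map laurent_module_mat ns)"


section \<open>Free algebras\<close>

text \<open>
  The free monoid, written additively so that finitely supported functions on it form, with the
  convolution product, the free unital algebra.
\<close>

datatype 'g free_monoid = FMon (letters: "'g list")

instantiation free_monoid :: (type) monoid_add
begin

definition "0 = FMon []"

definition "u + w = FMon (letters u @ letters w)"

instance
  by standard (auto simp: zero_free_monoid_def plus_free_monoid_def)

end

definition free_algebra :: "'g set \<Rightarrow> ('g free_monoid \<Rightarrow>\<^sub>0 'r::comm_ring_1) ring" where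
  "free_algebra X =
     \<lparr>carrier = {f. \<forall>w\<in>Poly_Mapping.keys f. set (letters w) \<subseteq> X},
      mult = (*), one = 1, zero = 0, add = (+)\<rparr>"

text \<open>The free algebra without unit consists of the elements with vanishing constant term.\<close>

definition nonunital_free_algebra :: "'g set \<Rightarrow> ('g free_monoid \<Rightarrow>\<^sub>0 'r::comm_ring_1) set" where
  "nonunital_free_algebra X =
     {f \<in> carrier (free_algebra X). Poly_Mapping.lookup f 0 = 0}"


section \<open>Leavitt path algebras\<close>

text \<open>The source map of a digraph is \<open>tail\<close>, its range map is \<open>head\<close>.\<close>

datatype ('v, 'e) lpa_gen = Vert 'v | Edge 'e | Ghost 'e

definition lpa_gens :: "('v, 'e) pre_digraph \<Rightarrow> ('v, 'e) lpa_gen set" where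
  "lpa_gens E = Vert ` verts E \<union> Edge ` arcs E \<union> Ghost ` arcs E"

definition gvar :: "'g \<Rightarrow> ('g free_monoid \<Rightarrow>\<^sub>0 'r::comm_ring_1)" where
  "gvar g = Poly_Mapping.single (FMon [g]) 1"

inductive_set lpa_relators ::
  "('v, 'e) pre_digraph \<Rightarrow> (('v, 'e) lpa_gen free_monoid \<Rightarrow>\<^sub>0 'r::comm_ring_1) set"
  for E :: "('v, 'e) pre_digraph" where
  vertex_idem: "v \<in> verts E \<Longrightarrow>
     gvar (Vert v) * gvar (Vert v) - gvar (Vert v) \<in> lpa_relators E"
| vertex_orth: "\<lbrakk>v \<in> verts E; w \<in> verts E; v \<noteq> w\<rbrakk> \<Longrightarrow>
     gvar (Vert v) * gvar (Vert w) \<in> lpa_relators E"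
| source_edge: "e \<in> arcs E \<Longrightarrow>
     gvar (Vert (tail E e)) * gvar (Edge e) - gvar (Edge e) \<in> lpa_relators E"
| edge_range: "e \<in> arcs E \<Longrightarrow>
     gvar (Edge e) * gvar (Vert (head E e)) - gvar (Edge e) \<in> lpa_relators E"
| range_ghost: "e \<in> arcs E \<Longrightarrow>
     gvar (Vert (head E e)) * gvar (Ghost e) - gvar (Ghost e) \<in> lpa_relators E"
| ghost_source: "e \<in> arcs E \<Longrightarrow>
     gvar (Ghost e) * gvar (Vert (tail E e)) - gvar (Ghost e) \<in> lpa_relators E"
| ghost_edge_same: "e \<in> arcs E \<Longrightarrow>
     gvar (Ghost e) * gvar (Edge e) - gvar (Vert (head E e)) \<in> lpa_relators E"
| ghost_edge_diff: "\<lbrakk>e \<in> arcs E; f \<in> arcs E; e \<noteq> f\<rbrakk> \<Longrightarrow>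
     gvar (Ghost e) * gvar (Edge f) \<in> lpa_relators E"
| vertex_sum: "\<lbrakk>v \<in> verts E; out_arcs E v \<noteq> {}; finite (out_arcs E v)\<rbrakk> \<Longrightarrow>
     gvar (Vert v) - (\<Sum>e\<in>out_arcs E v. gvar (Edge e) * gvar (Ghost e)) \<in> lpa_relators E"

definition lpa_ideal ::
  "('v, 'e) pre_digraph \<Rightarrow> (('v, 'e) lpa_gen free_monoid \<Rightarrow>\<^sub>0 'r::comm_ring_1) set" where
  "lpa_ideal E = Idl\<^bsub>free_algebra (lpa_gens E)\<^esub> (lpa_relators E)"

text \<open>
  The relators have no constant term, hence neither do the elements of the ideal \<open>I\<close> which they
  generate in the free unital algebra \<open>F\<^sub>1\<close>.  Since \<open>F\<^sub>1 = R + F\<close> for the free algebra \<open>F\<close> without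
  unit, \<open>I\<close> is also the ideal of the \<open>R\<close>-algebra \<open>F\<close> generated by the relators.  The Leavitt path
  algebra is \<open>F/I\<close>, a subset of \<open>F\<^sub>1/I\<close>.

  The unit of the record is the identity element of \<open>F/I\<close> if there is one, and is meaningless
  otherwise; it is not the coset of \<open>1\<close>.
\<close>

definition leavitt_path_algebra ::
  "('v, 'e) pre_digraph \<Rightarrow>
     ('r::comm_ring_1, (('v, 'e) lpa_gen free_monoid \<Rightarrow>\<^sub>0 'r) set) module" where
  "leavitt_path_algebra E =
     (let F1 = free_algebra (lpa_gens E);
          I = lpa_ideal E;
          Q = F1 Quot I;
          L = (\<lambda>f. I +>\<^bsub>F1\<^esub> f) ` nonunital_free_algebra (lpa_gens E)
      in \<lparr>carrier = L,
          mult = mult Q,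
          one = (THE u. u \<in> L \<and> (\<forall>x\<in>L. u \<otimes>\<^bsub>Q\<^esub> x = x \<and> x \<otimes>\<^bsub>Q\<^esub> u = x)),
          zero = zero Q,
          add = add Q,
          smult = (\<lambda>c x. (I +>\<^bsub>F1\<^esub> Poly_Mapping.single 0 c) \<otimes>\<^bsub>Q\<^esub> x)\<rparr>)"


section \<open>Conditions on graphs\<close>

text \<open>
  The vertices on a nonempty closed walk are the tails of its arcs.  \<open>out_degree\<close> is \<open>0\<close> at
  infinite emitters, so it cannot be used to express that the out-degree is at least two.
\<close>

definition has_exit :: "('v, 'e) pre_digraph \<Rightarrow> 'e awalk \<Rightarrow> bool" where
  "has_exit E p \<longleftrightarrow>
     (\<exists>v\<in>tail E ` set p. \<exists>e\<in>out_arcs E v. \<exists>f\<in>out_arcs E v. e \<noteq> f)"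

definition condition_NE :: "('v, 'e) pre_digraph \<Rightarrow> bool" where
  "condition_NE E \<longleftrightarrow> (\<forall>p. pre_digraph.cycle E p \<longrightarrow> \<not> has_exit E p)"

definition acyclic_digraph :: "('v, 'e) pre_digraph \<Rightarrow> bool" where
  "acyclic_digraph E \<longleftrightarrow> (\<nexists>p. pre_digraph.cycle E p)"

end

theory Submission
  imports Defs "HOL-Library.Function_Algebras"
begin

text \<open>
  The algebra acts on functions on the set of boundary paths (infinite paths and paths ending in a
  sink or an infinite emitter) with values in the Laurent polynomials, where arcs leaving a chosen
  vertex set \<open>W\<close> act with an additional factor \<open>t\<close>.  Infinitely many vertices or arcs, or an exit
  of a cycle, yield infinitely many orthogonal idempotents, which act as nonzero operators and so
  contradict both chain conditions.  Ideals of the coefficient ring yield left ideals: ideals of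
  \<open>R\<close> transfer the chain conditions to \<open>R\<close>, and the powers of \<open>1 - t\<close> show that a cycle is
  incompatible with the descending chain condition and with semisimplicity.

  Conversely, let \<open>E\<close> be finite without exits and let \<open>W\<close> contain one vertex of each cycle.  With
  \<open>c\<^sub>u\<close> the cycle at \<open>u \<in> W\<close>, the elements \<open>p c\<^sub>u\<^sup>k q\<^sup>*\<close>, where \<open>p\<close> and \<open>q\<close> are paths to the same
  sink or vertex \<open>u \<in> W\<close> with no arc leaving \<open>W\<close> (and \<open>k = 0\<close> for sinks), span the algebra and act
  as \<open>t\<^sup>k\<close> times matrix units, so the representation identifies the algebra with a ring of block
  matrices over \<open>R\<close> and over \<open>R[t, t\<^sup>-\<^sup>1]\<close>.
\<close>

section \<open>The free algebra and its quotient\<close>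

text \<open>The words \<open>p c_u^k q^*\<close> are only shown to span; their independence is read
  off from their matrices, so no normal forms for the relations are computed. Boundary paths let all
  relations hold without any vertex acting as zero: where finitely many arcs, but at least one,
  leave a vertex, a boundary path has to continue, as the vertex sum demands; elsewhere it may stop.
  The factor t is there because a cycle c fixes the point c^\<infinity>: without t all powers of c
  would act alike on it. Exits matter through e e^*, which equals the source of e only if e is the
  sole arc leaving it; on a cycle without exits this makes the ghost path a two-sided inverse.
  Semisimplicity is handled by idempotents in both directions: it is used only through its
  consequences Noetherian and von Neumann regular, and established only by a complete family of
  orthogonal idempotents that generate simple left ideals.\<close>

lemma zero_free_monoid_letters [simp]: "letters (0 :: 'g free_monoid) = []"
  by (simp add: zero_free_monoid_def)

lemma plus_free_monoid_letters [simp]: "letters (u + w) = letters u @ letters w"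
  by (simp add: plus_free_monoid_def)

lemma FMon_plus [simp]: "FMon u + FMon w = FMon (u @ w)"
  by (simp add: plus_free_monoid_def)

lemma FMon_Nil: "FMon [] = 0"
  by (simp add: zero_free_monoid_def)

lemma FMon_eq_0_iff: "FMon ws = 0 \<longleftrightarrow> ws = []"
  by (simp add: zero_free_monoid_def)

lemma carrier_free_algebra:
  "carrier (free_algebra X) = {f. \<forall>w\<in>Poly_Mapping.keys f. set (letters w) \<subseteq> X}"
  by (simp add: free_algebra_def)

lemma free_algebra_sel [simp]:
  "mult (free_algebra X) = (*)" "one (free_algebra X) = 1" "zero (free_algebra X) = 0"
  "add (free_algebra X) = (+)"
  by (simp_all add: free_algebra_def)

lemma free_algebra_add_closed [simp]:
  "f \<in> carrier (free_algebra X) \<Longrightarrow> g \<in> carrier (free_algebra X) \<Longrightarrow> f + g \<in> carrier (free_algebra X)"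
  using keys_add[of f g] by (auto simp: carrier_free_algebra)

lemma free_algebra_uminus_closed [simp]:
  "f \<in> carrier (free_algebra X) \<Longrightarrow> - f \<in> carrier (free_algebra X)"
  by (auto simp: carrier_free_algebra in_keys_iff)

lemma free_algebra_diff_closed [simp]:
  "f \<in> carrier (free_algebra X) \<Longrightarrow> g \<in> carrier (free_algebra X) \<Longrightarrow> f - g \<in> carrier (free_algebra X)"
  using free_algebra_add_closed[of f X "- g"] by simp

lemma free_algebra_mult_closed [simp]:
  assumes "f \<in> carrier (free_algebra X)" "g \<in> carrier (free_algebra X)"
  shows "f * g \<in> carrier (free_algebra X)"
  using assms keys_mult[of f g] by (fastforce simp: carrier_free_algebra)

lemma free_algebra_zero_closed [simp]: "0 \<in> carrier (free_algebra X)"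
  by (simp add: carrier_free_algebra)

lemma free_algebra_one_closed [simp]: "1 \<in> carrier (free_algebra X)"
  by (simp add: carrier_free_algebra)

lemma free_algebra_single_closed [simp]:
  "set (letters w) \<subseteq> X \<Longrightarrow> Poly_Mapping.single w c \<in> carrier (free_algebra X)"
  by (simp add: carrier_free_algebra)

lemma free_algebra_gvar_closed [simp]: "g \<in> X \<Longrightarrow> gvar g \<in> carrier (free_algebra X)"
  by (simp add: gvar_def)

lemma free_algebra_sum_closed [simp]:
  "(\<And>i. i \<in> A \<Longrightarrow> f i \<in> carrier (free_algebra X)) \<Longrightarrow> sum f A \<in> carrier (free_algebra X)"
  by (induction A rule: infinite_finite_induct) auto

lemma ring_free_algebra: "ring (free_algebra X :: ('g free_monoid \<Rightarrow>\<^sub>0 'r::comm_ring_1) ring)"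
  (is "ring ?R")
proof (rule ringI)
  show "abelian_group ?R"
  proof (rule abelian_groupI)
    fix f :: "'g free_monoid \<Rightarrow>\<^sub>0 'r" assume "f \<in> carrier ?R"
    then show "\<exists>g\<in>carrier ?R. g \<oplus>\<^bsub>?R\<^esub> f = \<zero>\<^bsub>?R\<^esub>"
      by (intro bexI[of _ "- f"]) auto
  qed (auto simp: algebra_simps)
  show "monoid ?R"
    by (rule monoidI) (auto simp: algebra_simps)
qed (auto simp: algebra_simps)

lemma free_monoid_plus_eq_0_iff [simp]: "u + w = (0 :: 'g free_monoid) \<longleftrightarrow> u = 0 \<and> w = 0"
  by (metis append_is_Nil_conv free_monoid.collapse plus_free_monoid_letters zero_free_monoid_def free_monoid.inject)

text \<open>A concatenation is empty only if both words are, so a constant term of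
  \<open>f * g\<close> needs one in both factors. Hence the elements without constant term form an
  ideal of the unital free algebra.\<close>

lemma lookup_mult_free_0:
  fixes f g :: "'g free_monoid \<Rightarrow>\<^sub>0 'r::comm_ring_1"
  assumes "Poly_Mapping.lookup f 0 = 0 \<or> Poly_Mapping.lookup g 0 = 0"
  shows "Poly_Mapping.lookup (f * g) 0 = 0"
proof (rule ccontr)
  assume "Poly_Mapping.lookup (f * g) 0 \<noteq> 0"
  then have "0 \<in> Poly_Mapping.keys (f * g)" by (simp add: in_keys_iff)
  then obtain u w where "u \<in> Poly_Mapping.keys f" "w \<in> Poly_Mapping.keys g" "u + w = 0"
    using keys_mult[of f g] by force
  with assms show False by (auto simp: in_keys_iff)
qed

lemma poly_mapping_sum_single:
  "f = (\<Sum>w\<in>Poly_Mapping.keys f. Poly_Mapping.single w (Poly_Mapping.lookup f w))"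
  by (rule poly_mapping_eqI)
     (auto simp: lookup_sum lookup_single when_def in_keys_iff)

lemma free_algebra_induct [consumes 1, case_names single add]:
  assumes "f \<in> carrier (free_algebra X)"
    and "\<And>w c. set (letters w) \<subseteq> X \<Longrightarrow> P (Poly_Mapping.single w c)"
    and "\<And>f g. f \<in> carrier (free_algebra X) \<Longrightarrow> g \<in> carrier (free_algebra X) \<Longrightarrow> P f \<Longrightarrow> P g \<Longrightarrow> P (f + g)"
  shows "P f"
proof -
  have *: "P (sum h A) \<and> sum h A \<in> carrier (free_algebra X)"
    if "finite A" "\<And>w. w \<in> A \<Longrightarrow> P (h w) \<and> h w \<in> carrier (free_algebra X)" for A and h :: "'a free_monoid \<Rightarrow> _"
    using that
  proof (induction A)
    case empty
    then show ?case using assms(2)[of 0 0] by simp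
  next
    case (insert w A)
    then show ?case using assms(3) by simp
  qed
  show ?thesis
    by (subst poly_mapping_sum_single)
       (rule *[THEN conjunct1], use assms in \<open>auto simp: carrier_free_algebra\<close>)
qed

section \<open>The Leavitt path algebra inside a quotient of the unital free algebra\<close>

locale lpa_graph = wf_digraph E for E :: "('v, 'e) pre_digraph"
begin

abbreviation gens where "gens \<equiv> lpa_gens E"

lemma gens_simps [simp]:
  "Vert v \<in> gens \<longleftrightarrow> v \<in> verts E" "Edge e \<in> gens \<longleftrightarrow> e \<in> arcs E" "Ghost e \<in> gens \<longleftrightarrow> e \<in> arcs E"
  by (auto simp: lpa_gens_def)

definition F1 :: "(('v, 'e) lpa_gen free_monoid \<Rightarrow>\<^sub>0 'r::comm_ring_1) set" where
  "F1 = carrier (free_algebra gens)"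

definition F :: "(('v, 'e) lpa_gen free_monoid \<Rightarrow>\<^sub>0 'r::comm_ring_1) set" where
  "F = nonunital_free_algebra gens"

definition I :: "(('v, 'e) lpa_gen free_monoid \<Rightarrow>\<^sub>0 'r::comm_ring_1) set" where
  "I = lpa_ideal E"

definition proj :: "(('v, 'e) lpa_gen free_monoid \<Rightarrow>\<^sub>0 'r::comm_ring_1) \<Rightarrow> _ set" where
  "proj f = I +>\<^bsub>free_algebra gens\<^esub> f"

lemma F1_simps [simp]:
  "f \<in> F1 \<Longrightarrow> g \<in> F1 \<Longrightarrow> f + g \<in> F1" "f \<in> F1 \<Longrightarrow> g \<in> F1 \<Longrightarrow> f - g \<in> F1"
  "f \<in> F1 \<Longrightarrow> g \<in> F1 \<Longrightarrow> f * g \<in> F1" "f \<in> F1 \<Longrightarrow> - f \<in> F1" "0 \<in> F1" "1 \<in> F1"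
  "set ws \<subseteq> gens \<Longrightarrow> Poly_Mapping.single (FMon ws) c \<in> F1"
  "g' \<in> gens \<Longrightarrow> gvar g' \<in> F1"
  "Poly_Mapping.single 0 c \<in> F1"
  by (simp_all add: F1_def)

lemma F1_sum [simp]: "(\<And>i. i \<in> A \<Longrightarrow> f i \<in> F1) \<Longrightarrow> sum f A \<in> F1"
  by (simp add: F1_def)

lemma F_iff: "f \<in> F \<longleftrightarrow> f \<in> F1 \<and> Poly_Mapping.lookup f 0 = 0"
  by (simp add: F_def F1_def nonunital_free_algebra_def)

lemma F_F1 [simp]: "f \<in> F \<Longrightarrow> f \<in> F1"
  by (simp add: F_iff)

lemma F_simps [simp]:
  "f \<in> F \<Longrightarrow> g \<in> F \<Longrightarrow> f + g \<in> F" "f \<in> F \<Longrightarrow> g \<in> F \<Longrightarrow> f - g \<in> F"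
  "f \<in> F \<Longrightarrow> g \<in> F1 \<Longrightarrow> f * g \<in> F" "f \<in> F1 \<Longrightarrow> g \<in> F \<Longrightarrow> f * g \<in> F" "f \<in> F \<Longrightarrow> - f \<in> F" "0 \<in> F"
  "set ws \<subseteq> gens \<Longrightarrow> ws \<noteq> [] \<Longrightarrow> Poly_Mapping.single (FMon ws) c \<in> F"
  "g' \<in> gens \<Longrightarrow> gvar g' \<in> F"
  by (auto simp: F_iff lookup_add lookup_minus lookup_mult_free_0 gvar_def lookup_single when_def
      FMon_eq_0_iff)

lemma F_sum [simp]: "(\<And>i. i \<in> A \<Longrightarrow> f i \<in> F) \<Longrightarrow> sum f A \<in> F"
  by (induction A rule: infinite_finite_induct) auto

lemma relators_F: "lpa_relators E \<subseteq> F"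
proof
  fix f :: "('v, 'e) lpa_gen free_monoid \<Rightarrow>\<^sub>0 'r::comm_ring_1"
  assume "f \<in> lpa_relators E"
  then show "f \<in> F"
    by (induction rule: lpa_relators.induct) (auto intro!: F_simps F_sum)
qed

lemma ideal_I: "ideal (I :: (_ \<Rightarrow>\<^sub>0 'r::comm_ring_1) set) (free_algebra gens)"
  unfolding I_def lpa_ideal_def
  by (rule ring.genideal_ideal[OF ring_free_algebra])
     (use relators_F in \<open>auto simp flip: F1_def\<close>)

lemma relators_I: "lpa_relators E \<subseteq> I"
  unfolding I_def lpa_ideal_def
  by (rule ring.genideal_self[OF ring_free_algebra])
     (use relators_F in \<open>auto simp flip: F1_def\<close>)

lemma I_minimal:
  assumes "ideal J (free_algebra gens)" "lpa_relators E \<subseteq> J"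
  shows "I \<subseteq> J"
  unfolding I_def lpa_ideal_def
  by (rule ring.genideal_minimal[OF ring_free_algebra assms])

lemma I_F1 [simp]: "f \<in> I \<Longrightarrow> f \<in> F1"
  using ideal.Icarr[OF ideal_I] by (simp add: F1_def)

lemma I_zero [simp]: "0 \<in> I"
  using additive_subgroup.zero_closed[OF ideal.axioms(1)[OF ideal_I]] by simp

lemma I_add [simp]: "f \<in> I \<Longrightarrow> g \<in> I \<Longrightarrow> f + g \<in> I"
  using additive_subgroup.a_closed[OF ideal.axioms(1)[OF ideal_I]] by simp

lemma I_mult_l [simp]: "f \<in> I \<Longrightarrow> a \<in> F1 \<Longrightarrow> a * f \<in> I"
  using ideal.I_l_closed[OF ideal_I, of f a] by (simp add: F1_def)

lemma I_mult_r [simp]: "f \<in> I \<Longrightarrow> a \<in> F1 \<Longrightarrow> f * a \<in> I"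
  using ideal.I_r_closed[OF ideal_I, of f a] by (simp add: F1_def)

lemma I_uminus [simp]: "f \<in> I \<Longrightarrow> - f \<in> I"
  using I_mult_l[of f "- 1"] by simp

lemma I_diff [simp]: "f \<in> I \<Longrightarrow> g \<in> I \<Longrightarrow> f - g \<in> I"
  using I_add[of f "- g"] by simp

lemma I_sum [simp]: "(\<And>i. i \<in> A \<Longrightarrow> f i \<in> I) \<Longrightarrow> sum f A \<in> I"
  by (induction A rule: infinite_finite_induct) auto

lemma proj_eq_iff:
  assumes "f \<in> F1" "g \<in> F1"
  shows "proj f = proj g \<longleftrightarrow> f - g \<in> I"
proof -
  interpret ring "free_algebra gens :: (_ \<Rightarrow>\<^sub>0 'a) ring" by (rule ring_free_algebra)
  have inv: "\<ominus>\<^bsub>free_algebra gens\<^esub> g = - g"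
    using assms by (intro minus_equality) (auto simp: F1_def)
  show ?thesis
    using quotient_eq_iff_same_a_r_cos[OF ideal_I, of f g] assms inv
    by (simp add: proj_def F1_def a_minus_def)
qed

lemma proj_mult:
  assumes "f \<in> F1" "g \<in> F1"
  shows "mult (free_algebra gens Quot I) (proj f) (proj g) = proj (f * g)"
  using ideal.rcoset_mult_add[OF ideal_I, of f g] assms by (simp add: proj_def FactRing_def F1_def)

lemma proj_add:
  assumes "f \<in> F1" "g \<in> F1"
  shows "add (free_algebra gens Quot I) (proj f) (proj g) = proj (f + g)"
proof -
  interpret ideal "I :: (_ \<Rightarrow>\<^sub>0 'a) set" "free_algebra gens" by (rule ideal_I)
  show ?thesis using a_rcos_sum[of f g] assms by (simp add: proj_def FactRing_def F1_def)
qed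

lemma proj_zero: "zero (free_algebra gens Quot I) = proj 0"
proof -
  interpret ideal "I :: (_ \<Rightarrow>\<^sub>0 'a) set" "free_algebra gens" by (rule ideal_I)
  show ?thesis
    by (auto simp: proj_def FactRing_def a_r_coset_def' )
qed

abbreviation L :: "('r::comm_ring_1, (('v, 'e) lpa_gen free_monoid \<Rightarrow>\<^sub>0 'r) set) module" where
  "L \<equiv> leavitt_path_algebra E"

lemma L_sel:
  "carrier L = proj ` F" "mult L = mult (free_algebra gens Quot I)"
  "add L = add (free_algebra gens Quot I)" "zero L = proj 0"
  "smult L = (\<lambda>c x. mult (free_algebra gens Quot I) (proj (Poly_Mapping.single 0 c)) x)"
  by (simp_all add: leavitt_path_algebra_def Let_def proj_zero[symmetric] I_def F_def)
     (simp_all add: proj_def I_def)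

lemma L_one:
  "one L = (THE u. u \<in> carrier L \<and> (\<forall>x\<in>carrier L. u \<otimes>\<^bsub>L\<^esub> x = x \<and> x \<otimes>\<^bsub>L\<^esub> u = x))"
  by (simp add: leavitt_path_algebra_def Let_def)

lemma L_simps [simp]:
  "f \<in> F1 \<Longrightarrow> g \<in> F1 \<Longrightarrow> proj f \<otimes>\<^bsub>L\<^esub> proj g = proj (f * g)"
  "f \<in> F1 \<Longrightarrow> g \<in> F1 \<Longrightarrow> proj f \<oplus>\<^bsub>L\<^esub> proj g = proj (f + g)"
  "f \<in> F1 \<Longrightarrow> c \<odot>\<^bsub>L\<^esub> proj f = proj (Poly_Mapping.single 0 c * f)"
  "\<zero>\<^bsub>L\<^esub> = proj 0"
  by (simp_all add: L_sel proj_mult proj_add)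

end

text \<open>The algebra has no identity when \<open>verts E\<close> is infinite, so ideals and chain
  conditions are developed without one; semisimplicity brings its own.\<close>

locale nonunital_ring = abelian_group A for A (structure) +
  assumes m_closed [simp]: "x \<in> carrier A \<Longrightarrow> y \<in> carrier A \<Longrightarrow> x \<otimes> y \<in> carrier A"
    and m_assoc: "x \<in> carrier A \<Longrightarrow> y \<in> carrier A \<Longrightarrow> z \<in> carrier A \<Longrightarrow> (x \<otimes> y) \<otimes> z = x \<otimes> (y \<otimes> z)"
    and l_distr: "x \<in> carrier A \<Longrightarrow> y \<in> carrier A \<Longrightarrow> z \<in> carrier A \<Longrightarrow> (x \<oplus> y) \<otimes> z = x \<otimes> z \<oplus> y \<otimes> z"
    and r_distr: "x \<in> carrier A \<Longrightarrow> y \<in> carrier A \<Longrightarrow> z \<in> carrier A \<Longrightarrow> z \<otimes> (x \<oplus> y) = z \<otimes> x \<oplus> z \<otimes> y"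

lemma (in lpa_graph) nonunital_ring_L: "nonunital_ring (L :: ('r::comm_ring_1, _) module)" (is "nonunital_ring ?L")
proof -
  have "abelian_group ?L"
  proof (rule abelian_groupI)
    fix x assume "x \<in> carrier ?L"
    then obtain f where "x = proj f" "f \<in> F" by (auto simp: L_sel(1))
    then show "\<exists>y\<in>carrier ?L. y \<oplus>\<^bsub>?L\<^esub> x = \<zero>\<^bsub>?L\<^esub>"
      by (intro bexI[of _ "proj (- f)"]) (auto simp: L_sel(1))
  qed (auto simp: L_sel(1) algebra_simps)
  then show ?thesis
    by (rule nonunital_ring.intro) (unfold_locales, auto simp: L_sel(1) algebra_simps)
qed

section \<open>Left ideals and chain conditions\<close>

lemma left_ideal_subset: "left_ideal J A \<Longrightarrow> J \<subseteq> carrier A"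
  by (auto simp: left_ideal_def dest: additive_subgroup.a_subset)

lemma left_ideal_l_closed: "left_ideal J A \<Longrightarrow> a \<in> carrier A \<Longrightarrow> x \<in> J \<Longrightarrow> a \<otimes>\<^bsub>A\<^esub> x \<in> J"
  by (auto simp: left_ideal_def)

lemma left_ideal_zero: "left_ideal J A \<Longrightarrow> \<zero>\<^bsub>A\<^esub> \<in> J"
  by (auto simp: left_ideal_def intro: additive_subgroup.zero_closed)

lemma left_ideal_add: "left_ideal J A \<Longrightarrow> x \<in> J \<Longrightarrow> y \<in> J \<Longrightarrow> x \<oplus>\<^bsub>A\<^esub> y \<in> J"
  by (auto simp: left_ideal_def intro: additive_subgroup.a_closed)

lemma left_noetherianD:
  assumes "left_noetherian A" "\<And>n. left_ideal (I n) A" "\<And>n. I n \<subseteq> I (Suc n)"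
  obtains N where "\<And>n. n \<ge> N \<Longrightarrow> I n = I N"
  using assms unfolding left_noetherian_def by blast

lemma left_artinianD:
  assumes "left_artinian A" "\<And>n. left_ideal (I n) A" "\<And>n. I (Suc n) \<subseteq> I n"
  obtains N where "\<And>n. n \<ge> N \<Longrightarrow> I n = I N"
  using assms unfolding left_artinian_def by blast

context nonunital_ring
begin

lemma l_null [simp]: "x \<in> carrier A \<Longrightarrow> \<zero> \<otimes> x = \<zero>"
  by (metis l_distr m_closed r_zero zero_closed add.r_cancel_one')

lemma r_null [simp]: "x \<in> carrier A \<Longrightarrow> x \<otimes> \<zero> = \<zero>"
  by (metis r_distr m_closed r_zero zero_closed add.r_cancel_one')

lemma l_minus: "x \<in> carrier A \<Longrightarrow> y \<in> carrier A \<Longrightarrow> (\<ominus> x) \<otimes> y = \<ominus> (x \<otimes> y)"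
  by (metis a_inv_closed l_distr l_neg l_null m_closed minus_equality)

lemma left_idealI:
  assumes "J \<subseteq> carrier A" "\<zero> \<in> J" "\<And>x y. x \<in> J \<Longrightarrow> y \<in> J \<Longrightarrow> x \<oplus> y \<in> J"
    "\<And>x. x \<in> J \<Longrightarrow> \<ominus> x \<in> J" "\<And>a x. a \<in> carrier A \<Longrightarrow> x \<in> J \<Longrightarrow> a \<otimes> x \<in> J"
  shows "left_ideal J A"
proof -
  have "subgroup J (add_monoid A)"
    by (rule add.subgroupI) (use assms in \<open>auto simp flip: a_inv_def\<close>)
  then show ?thesis
    using assms(5) by (auto simp: left_ideal_def intro: additive_subgroup.intro)
qed

lemma left_ideal_uminus:
  assumes "left_ideal J A" "x \<in> J"
  shows "\<ominus> x \<in> J"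
  using assms abelian_group.a_inv_closed additive_subgroup.a_subgroup subgroup.m_inv_closed
  unfolding left_ideal_def a_inv_def by fastforce

lemma left_ideal_0: "left_ideal {\<zero>} A"
  by (rule left_idealI) auto

lemma left_ideal_annihilator:
  assumes "\<And>i. i \<in> T \<Longrightarrow> a i \<in> carrier A"
  shows "left_ideal {x \<in> carrier A. \<forall>i\<in>T. x \<otimes> a i = \<zero>} A"
  by (rule left_idealI) (use assms in \<open>auto simp: l_distr l_minus m_assoc\<close>)

lemma left_ideal_principal:
  assumes "a \<in> carrier A"
  shows "left_ideal ((\<lambda>x. x \<otimes> a) ` carrier A) A"
proof (rule left_idealI)
  show "\<zero> \<in> (\<lambda>x. x \<otimes> a) ` carrier A"
    using assms by (auto intro!: image_eqI[of _ _ \<zero>])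
next
  fix x y assume "x \<in> (\<lambda>x. x \<otimes> a) ` carrier A" "y \<in> (\<lambda>x. x \<otimes> a) ` carrier A"
  then show "x \<oplus> y \<in> (\<lambda>x. x \<otimes> a) ` carrier A"
    using assms by (auto simp: l_distr[symmetric])
next
  fix x assume "x \<in> (\<lambda>x. x \<otimes> a) ` carrier A"
  then show "\<ominus> x \<in> (\<lambda>x. x \<otimes> a) ` carrier A"
    using assms by (auto simp: l_minus[symmetric])
next
  fix b x assume "b \<in> carrier A" "x \<in> (\<lambda>x. x \<otimes> a) ` carrier A"
  then show "b \<otimes> x \<in> (\<lambda>x. x \<otimes> a) ` carrier A"
    using assms by (auto simp: m_assoc[symmetric])
qed (use assms in auto)

lemma left_ideal_Int:
  "left_ideal J A \<Longrightarrow> left_ideal K A \<Longrightarrow> left_ideal (J \<inter> K) A"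
  by (rule left_idealI)
     (auto simp: left_ideal_zero left_ideal_add left_ideal_uminus left_ideal_l_closed
       dest: left_ideal_subset)

definition ideal_sum :: "'a set \<Rightarrow> 'a set \<Rightarrow> 'a set" where
  "ideal_sum J K = {x \<oplus> y | x y. x \<in> J \<and> y \<in> K}"

lemma left_ideal_sum:
  assumes J: "left_ideal J A" and K: "left_ideal K A"
  shows "left_ideal (ideal_sum J K) A"
proof -
  note sub = left_ideal_subset[OF J, THEN subsetD] left_ideal_subset[OF K, THEN subsetD]
  show ?thesis
  proof (rule left_idealI)
    show "ideal_sum J K \<subseteq> carrier A"
      by (auto simp: ideal_sum_def sub)
    show "\<zero> \<in> ideal_sum J K"
      using left_ideal_zero[OF J] left_ideal_zero[OF K] by (force simp: ideal_sum_def)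
  next
    fix x y assume "x \<in> ideal_sum J K" "y \<in> ideal_sum J K"
    then obtain a b c d where *: "x = a \<oplus> b" "y = c \<oplus> d" "a \<in> J" "b \<in> K" "c \<in> J" "d \<in> K"
      by (auto simp: ideal_sum_def)
    then have "x \<oplus> y = (a \<oplus> c) \<oplus> (b \<oplus> d)"
      by (simp add: sub a_ac)
    moreover have "a \<oplus> c \<in> J" "b \<oplus> d \<in> K"
      using * left_ideal_add[OF J] left_ideal_add[OF K] by auto
    ultimately show "x \<oplus> y \<in> ideal_sum J K"
      unfolding ideal_sum_def by blast
  next
    fix x assume "x \<in> ideal_sum J K"
    then obtain a b where *: "x = a \<oplus> b" "a \<in> J" "b \<in> K"
      by (auto simp: ideal_sum_def)
    then have "\<ominus> x = \<ominus> a \<oplus> \<ominus> b"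
      by (simp add: sub minus_add)
    then show "\<ominus> x \<in> ideal_sum J K"
      using * left_ideal_uminus[OF J] left_ideal_uminus[OF K] by (auto simp: ideal_sum_def)
  next
    fix r x assume r: "r \<in> carrier A" and "x \<in> ideal_sum J K"
    then obtain a b where *: "x = a \<oplus> b" "a \<in> J" "b \<in> K"
      by (auto simp: ideal_sum_def)
    then have "r \<otimes> x = r \<otimes> a \<oplus> r \<otimes> b"
      by (simp add: sub r_distr r)
    moreover have "r \<otimes> a \<in> J" "r \<otimes> b \<in> K"
      using * r left_ideal_l_closed[OF J] left_ideal_l_closed[OF K] by auto
    ultimately show "r \<otimes> x \<in> ideal_sum J K"
      unfolding ideal_sum_def by blast
  qed
qed

lemma subset_ideal_sum:
  assumes "left_ideal J A" "left_ideal K A"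
  shows "J \<subseteq> ideal_sum J K" "K \<subseteq> ideal_sum J K"
proof -
  show "J \<subseteq> ideal_sum J K"
  proof
    fix x assume x: "x \<in> J"
    then have "x = x \<oplus> \<zero>" using left_ideal_subset[OF assms(1)] by auto
    then show "x \<in> ideal_sum J K"
      using x left_ideal_zero[OF assms(2)] unfolding ideal_sum_def by blast
  qed
  show "K \<subseteq> ideal_sum J K"
  proof
    fix x assume x: "x \<in> K"
    then have "x = \<zero> \<oplus> x" using left_ideal_subset[OF assms(2)] by auto
    then show "x \<in> ideal_sum J K"
      using x left_ideal_zero[OF assms(1)] unfolding ideal_sum_def by blast
  qed
qed

lemma finsum_left_ideal:
  assumes "left_ideal J A" "\<And>i. i \<in> T \<Longrightarrow> f i \<in> J"
  shows "finsum A f T \<in> J"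
  using assms(2)
proof (induction T rule: infinite_finite_induct)
  case (insert i T)
  then have "finsum A f (insert i T) = f i \<oplus> finsum A f T"
    using left_ideal_subset[OF assms(1)] by (intro finsum_insert) auto
  then show ?case
    using insert left_ideal_add[OF assms(1)] by simp
qed (use left_ideal_zero[OF assms(1)] in auto)

lemma finsum_mult_right:
  assumes "\<And>i. i \<in> T \<Longrightarrow> f i \<in> carrier A" "a \<in> carrier A"
  shows "finsum A f T \<otimes> a = finsum A (\<lambda>i. f i \<otimes> a) T"
  using assms
proof (induction T rule: infinite_finite_induct)
  case (insert i T)
  then have *: "f \<in> T \<rightarrow> carrier A" "(\<lambda>i. f i \<otimes> a) \<in> T \<rightarrow> carrier A" by auto
  then show ?case
    using insert by (simp add: l_distr)
qed auto

lemma finsum_mult_left: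
  assumes "\<And>i. i \<in> T \<Longrightarrow> f i \<in> carrier A" "a \<in> carrier A"
  shows "a \<otimes> finsum A f T = finsum A (\<lambda>i. a \<otimes> f i) T"
  using assms
proof (induction T rule: infinite_finite_induct)
  case (insert i T)
  then have *: "f \<in> T \<rightarrow> carrier A" "(\<lambda>i. a \<otimes> f i) \<in> T \<rightarrow> carrier A" by auto
  then show ?case
    using insert by (simp add: r_distr)
qed auto

text \<open>The chains are formed by the left annihilators of the tails and of the initial segments of the sequence.\<close>

lemma orthogonal_idempotents_imp_no_chain_condition:
  fixes a :: "nat \<Rightarrow> 'a"
  assumes a: "\<And>n. a n \<in> carrier A" "\<And>n. a n \<otimes> a n = a n" "\<And>n. a n \<noteq> \<zero>"
    and orth: "\<And>m n. m \<noteq> n \<Longrightarrow> a m \<otimes> a n = \<zero>"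
  shows "\<not> left_noetherian A" "\<not> left_artinian A"
proof -
  show "\<not> left_noetherian A"
  proof
    assume "left_noetherian A"
    then obtain N where N: "\<And>n. n \<ge> N \<Longrightarrow> {x\<in>carrier A. \<forall>i\<in>{n..}. x \<otimes> a i = \<zero>} = {x\<in>carrier A. \<forall>i\<in>{N..}. x \<otimes> a i = \<zero>}"
      by (rule left_noetherianD[where I = "\<lambda>n. {x\<in>carrier A. \<forall>i\<in>{n..}. x \<otimes> a i = \<zero>}"])
         (use a(1) in \<open>auto intro!: left_ideal_annihilator\<close>)
    have "a N \<in> {x\<in>carrier A. \<forall>i\<in>{Suc N..}. x \<otimes> a i = \<zero>}"
      using a(1) orth by auto
    then show False
      using N[of "Suc N"] a(2,3)[of N] by auto
  qed
  show "\<not> left_artinian A"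
  proof
    assume "left_artinian A"
    then obtain N where N: "\<And>n. n \<ge> N \<Longrightarrow> {x\<in>carrier A. \<forall>i\<in>{..<n}. x \<otimes> a i = \<zero>} = {x\<in>carrier A. \<forall>i\<in>{..<N}. x \<otimes> a i = \<zero>}"
      by (rule left_artinianD[where I = "\<lambda>n. {x\<in>carrier A. \<forall>i\<in>{..<n}. x \<otimes> a i = \<zero>}"])
         (use a(1) in \<open>auto intro!: left_ideal_annihilator\<close>)
    have "a N \<in> {x\<in>carrier A. \<forall>i\<in>{..<N}. x \<otimes> a i = \<zero>}"
      using a(1) orth by auto
    then show False
      unfolding N[of "Suc N", OF le_SucI[OF order_refl], symmetric] using a(2,3)[of N] by auto
  qed
qed

subsection \<open>Semisimple rings\<close>

text \<open>The complement grows greedily: a simple S either lies in J + K already, or meets it in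
  0, and then S can be added to K without creating an intersection with J. Finite families suffice
  later, because the identity has finitely many components.\<close>

lemma simple_family_complement:
  assumes "finite T" "\<And>S. S \<in> T \<Longrightarrow> simple_left_ideal S A" "left_ideal J A"
  shows "\<exists>K. left_ideal K A \<and> J \<inter> K = {\<zero>} \<and> (\<forall>S\<in>T. S \<subseteq> ideal_sum J K)"
  using assms(1,2)
proof (induction T)
  case empty
  show ?case
    using left_ideal_0 left_ideal_zero[OF assms(3)] by (intro exI[of _ "{\<zero>}"]) auto
next
  case (insert S T)
  then obtain K where K: "left_ideal K A" "J \<inter> K = {\<zero>}" "\<forall>S\<in>T. S \<subseteq> ideal_sum J K"
    by auto
  have S: "left_ideal S A" and simple: "left_ideal J' A \<Longrightarrow> J' \<subseteq> S \<Longrightarrow> J' = {\<zero>} \<or> J' = S" for J'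
    using insert(4)[of S] by (auto simp: simple_left_ideal_def)
  note JK = left_ideal_sum[OF assms(3) K(1)]
  note sub = assms(3)[THEN left_ideal_subset, THEN subsetD] K(1)[THEN left_ideal_subset, THEN subsetD]
    S[THEN left_ideal_subset, THEN subsetD]
  consider "S \<inter> ideal_sum J K = S" | "S \<inter> ideal_sum J K = {\<zero>}"
    using simple[OF left_ideal_Int[OF S JK]] by auto
  then show ?case
  proof cases
    case 1
    then show ?thesis using K by (intro exI[of _ K]) auto
  next
    case 2
    have KS: "left_ideal (ideal_sum K S) A"
      by (rule left_ideal_sum[OF K(1) S])
    have "J \<inter> ideal_sum K S = {\<zero>}"
    proof (rule antisym; rule subsetI)
      fix j assume j: "j \<in> J \<inter> ideal_sum K S"
      then obtain k s where ks: "j = k \<oplus> s" "k \<in> K" "s \<in> S" by (auto simp: ideal_sum_def)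
      \<comment> \<open>Here s = j - k lies in S and in J + K, which meet in 0; so j = k lies in
        both J and K.\<close>
      then have "s = \<ominus> k \<oplus> j"
        using j sub by (simp add: r_neg1)
      then have "s = j \<oplus> \<ominus> k"
        using j ks sub by (simp add: a_comm)
      moreover have "j \<oplus> \<ominus> k \<in> ideal_sum J K"
        using j ks left_ideal_uminus[OF K(1)] by (auto simp: ideal_sum_def)
      ultimately have "s = \<zero>" using ks 2 by auto
      then have "j \<in> J \<inter> K" using ks j sub by auto
      then show "j \<in> {\<zero>}" using K by auto
    qed (use left_ideal_zero[OF assms(3)] left_ideal_zero[OF KS] in auto)
    moreover have "ideal_sum J K \<subseteq> ideal_sum J (ideal_sum K S)"
      using subset_ideal_sum[OF K(1) S] unfolding ideal_sum_def[of J] by blast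
    moreover have "S \<subseteq> ideal_sum J (ideal_sum K S)"
      using subset_ideal_sum(2)[OF K(1) S] subset_ideal_sum(2)[OF assms(3) KS] by blast
    ultimately show ?thesis
      using K KS by (intro exI[of _ "ideal_sum K S"]) (simp, blast)
  qed
qed

text \<open>The identity lies in a finite sum of simple left ideals, hence in J + K for a complement
  K, and e is its component in J. For x in J the element x k = x - x e lies in J and in K, so it
  vanishes.\<close>

lemma semisimple_left_ideal_idempotent:
  assumes "semisimple_ring A" "left_ideal J A"
  obtains e where "e \<in> J" "\<And>x. x \<in> J \<Longrightarrow> x \<otimes> e = x"
proof -
  obtain u \<S> where u: "u \<in> carrier A" "\<And>x. x \<in> carrier A \<Longrightarrow> u \<otimes> x = x \<and> x \<otimes> u = x"
    and \<S>: "\<And>S. S \<in> \<S> \<Longrightarrow> simple_left_ideal S A" "is_direct_sum A \<S>"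
    using assms(1) unfolding semisimple_ring_def has_unit_def by blast
  obtain f where f: "f \<in> (\<Pi>\<^sub>E S\<in>\<S>. S)" "finite {S\<in>\<S>. f S \<noteq> \<zero>}" "u = (\<Oplus>S\<in>{S\<in>\<S>. f S \<noteq> \<zero>}. f S)"
    using \<S>(2) u(1) unfolding is_direct_sum_def by blast
  obtain K where K: "left_ideal K A" "J \<inter> K = {\<zero>}" "\<forall>S\<in>{S\<in>\<S>. f S \<noteq> \<zero>}. S \<subseteq> ideal_sum J K"
    using simple_family_complement[OF f(2) _ assms(2)] \<S>(1) by blast
  have "u \<in> ideal_sum J K"
    unfolding f(3) by (rule finsum_left_ideal[OF left_ideal_sum[OF assms(2) K(1)]]) (use K f in auto)
  then obtain e k where e: "u = e \<oplus> k" "e \<in> J" "k \<in> K" by (auto simp: ideal_sum_def)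
  note sub = assms(2)[THEN left_ideal_subset, THEN subsetD] K(1)[THEN left_ideal_subset, THEN subsetD]
  have "x \<otimes> e = x" if x: "x \<in> J" for x
  proof -
    have eq: "x = x \<otimes> e \<oplus> x \<otimes> k"
      using u(2)[of x] e x sub by (simp add: r_distr)
    then have "x \<otimes> k = x \<oplus> \<ominus> (x \<otimes> e)"
      using e x sub by (metis a_comm a_inv_closed m_closed r_neg1)
    also have "\<dots> \<in> J"
      using e x sub by (intro left_ideal_add[OF assms(2)] left_ideal_uminus[OF assms(2)]
        left_ideal_l_closed[OF assms(2)]) auto
    finally have "x \<otimes> k \<in> J \<inter> K"
      using left_ideal_l_closed[OF K(1)] e x sub by auto
    then show ?thesis using eq K e x sub by auto
  qed
  then show ?thesis using that e by blast
qed

text \<open>The union of the chain has a right identity; the member of the chain that contains it is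
  already the whole union.\<close>

lemma semisimple_imp_left_noetherian:
  assumes "semisimple_ring A"
  shows "left_noetherian A"
  unfolding left_noetherian_def
proof (intro allI impI, elim conjE)
  fix I :: "nat \<Rightarrow> 'a set"
  assume I: "\<forall>n. left_ideal (I n) A" "\<forall>n. I n \<subseteq> I (Suc n)"
  have mono: "I m \<subseteq> I n" if "m \<le> n" for m n
    using I(2) that by (simp add: lift_Suc_mono_le)
  have "left_ideal (\<Union>n. I n) A"
  proof (rule left_idealI)
    fix x y assume "x \<in> (\<Union>n. I n)" "y \<in> (\<Union>n. I n)"
    then obtain m n where "x \<in> I m" "y \<in> I n" by auto
    then have "x \<in> I (max m n)" "y \<in> I (max m n)"
      using mono[of m "max m n"] mono[of n "max m n"] by auto
    then show "x \<oplus> y \<in> (\<Union>n. I n)"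
      using I(1) by (auto intro!: exI[of _ "max m n"] left_ideal_add)
  next
    show "(\<Union>n. I n) \<subseteq> carrier A"
      using I(1) left_ideal_subset by auto
    show "\<zero> \<in> (\<Union>n. I n)"
      using I(1) left_ideal_zero by auto
  next
    fix x assume "x \<in> (\<Union>n. I n)"
    then show "\<ominus> x \<in> (\<Union>n. I n)"
      using I(1) left_ideal_uminus by auto
  next
    fix a x assume "a \<in> carrier A" "x \<in> (\<Union>n. I n)"
    then obtain n where "x \<in> I n" by auto
    then have "a \<otimes> x \<in> I n"
      using I(1) \<open>a \<in> carrier A\<close> by (simp add: left_ideal_l_closed)
    then show "a \<otimes> x \<in> (\<Union>n. I n)" by auto
  qed
  from semisimple_left_ideal_idempotent[OF assms this]
  obtain e where e: "e \<in> (\<Union>n. I n)" "\<And>x. x \<in> (\<Union>n. I n) \<Longrightarrow> x \<otimes> e = x"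
    by metis
  then obtain N where N: "e \<in> I N" by auto
  have "(\<Union>n. I n) \<subseteq> I N"
  proof
    fix x assume x: "x \<in> (\<Union>n. I n)"
    then have "x \<in> carrier A" using I(1) left_ideal_subset by auto
    then have "x \<otimes> e \<in> I N" using I(1) N by (simp add: left_ideal_l_closed)
    then show "x \<in> I N" using e x by simp
  qed
  then show "\<exists>N. \<forall>n\<ge>N. I n = I N"
    using mono by (intro exI[of _ N] allI impI antisym) auto
qed

text \<open>The right identity of the principal left ideal of a has the form b a, and a belongs to
  this ideal because there is an identity.\<close>

lemma semisimple_imp_von_Neumann_regular:
  assumes "semisimple_ring A" "a \<in> carrier A"
  obtains b where "b \<in> carrier A" "a \<otimes> (b \<otimes> a) = a"
proof -
  obtain u where u: "u \<in> carrier A" "\<And>x. x \<in> carrier A \<Longrightarrow> u \<otimes> x = x"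
    using assms(1) unfolding semisimple_ring_def has_unit_def by blast
  obtain e where e: "e \<in> (\<lambda>x. x \<otimes> a) ` carrier A" "\<And>x. x \<in> (\<lambda>x. x \<otimes> a) ` carrier A \<Longrightarrow> x \<otimes> e = x"
    using semisimple_left_ideal_idempotent[OF assms(1) left_ideal_principal[OF assms(2)]] by blast
  have "a \<in> (\<lambda>x. x \<otimes> a) ` carrier A"
    using u assms(2) by (intro image_eqI[of _ _ u]) auto
  then show ?thesis using e that by blast
qed

text \<open>The ring is the direct sum of the left ideals generated by the \<open>e i\<close>. The
  hypothesis \<open>simple\<close> says that every nonzero element of such an ideal generates its
  idempotent again, which is simplicity.\<close>

lemma semisimple_ringI:
  assumes T: "finite T" "\<And>i. i \<in> T \<Longrightarrow> e i \<in> carrier A" "\<And>i. i \<in> T \<Longrightarrow> e i \<noteq> \<zero>"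
    and idem: "\<And>i. i \<in> T \<Longrightarrow> e i \<otimes> e i = e i"
    and orth: "\<And>i j. i \<in> T \<Longrightarrow> j \<in> T \<Longrightarrow> i \<noteq> j \<Longrightarrow> e i \<otimes> e j = \<zero>"
    and unit: "\<And>x. x \<in> carrier A \<Longrightarrow> finsum A e T \<otimes> x = x \<and> x \<otimes> finsum A e T = x"
    and simple: "\<And>i x. i \<in> T \<Longrightarrow> x \<in> carrier A \<Longrightarrow> x \<otimes> e i \<noteq> \<zero> \<Longrightarrow> \<exists>y\<in>carrier A. y \<otimes> (x \<otimes> e i) = e i"
  shows "semisimple_ring A"
proof -
  define P where "P i = (\<lambda>x. x \<otimes> e i) ` carrier A" for i
  have P: "left_ideal (P i) A" if "i \<in> T" for i
    unfolding P_def using T that by (intro left_ideal_principal)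
  have P_mult: "x \<otimes> e j = (if i = j then x else \<zero>)" if "x \<in> P i" "i \<in> T" "j \<in> T" for i j x
    using that T idem orth by (auto simp: P_def m_assoc)
  have P_carrier: "x \<in> carrier A" if "x \<in> P i" "i \<in> T" for x i
    using that T by (auto simp: P_def)
  have eP: "e i \<in> P i" if "i \<in> T" for i
    using that T idem unfolding P_def by (intro image_eqI[of _ _ "e i"]) auto
  have inj: "inj_on P T"
    using P_mult eP T by (metis inj_onI)
  have "simple_left_ideal (P i) A" if i: "i \<in> T" for i
    unfolding simple_left_ideal_def
  proof (intro conjI allI impI)
    fix J assume J: "left_ideal J A \<and> J \<subseteq> P i"
    show "J = {\<zero>} \<or> J = P i"
    proof (rule disjCI)
      assume "J \<noteq> P i"
      show "J = {\<zero>}"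
      proof (rule ccontr)
        assume "J \<noteq> {\<zero>}"
        then obtain x where x: "x \<in> J" "x \<noteq> \<zero>" using J left_ideal_zero by blast
        then have "x \<otimes> e i = x" "x \<in> carrier A" using J P_mult[of x i i] i P_carrier by auto
        then obtain y where "y \<in> carrier A" "y \<otimes> x = e i" using simple[OF i, of x] x by auto
        then have "e i \<in> J" using J x left_ideal_l_closed by metis
        then have "P i \<subseteq> J"
          unfolding P_def using J by (auto intro!: left_ideal_l_closed)
        then show False using J \<open>J \<noteq> P i\<close> by auto
      qed
    qed
  next
    show "left_ideal (P i) A" using P i by simp
    show "P i \<noteq> {\<zero>}" using eP[OF i] T(3)[OF i] by auto
  qed
  moreover have "is_direct_sum A (P ` T)"
    unfolding is_direct_sum_def
  proof (intro ballI ex_ex1I)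
    fix x assume x: "x \<in> carrier A"
    define f where "f = (\<lambda>S\<in>P ` T. x \<otimes> e (inv_into T P S))"
    have fP: "f (P i) = x \<otimes> e i" if "i \<in> T" for i
      using that inj by (simp add: f_def)
    have "(\<Oplus>S\<in>{S\<in>P ` T. f S \<noteq> \<zero>}. f S) = (\<Oplus>S\<in>P ` T. f S)"
      by (rule add.finprod_mono_neutral_cong_left) (use T x fP in auto)
    also have "\<dots> = (\<Oplus>i\<in>T. f (P i))"
      using T x inj fP by (subst finsum_reindex) auto
    also have "\<dots> = (\<Oplus>i\<in>T. x \<otimes> e i)"
      using T x fP by (intro finsum_cong') auto
    also have "\<dots> = x \<otimes> finsum A e T"
      using finsum_mult_left[of T e x] T x by simp
    also have "\<dots> = x" using unit x by simp
    finally have "x = (\<Oplus>S\<in>{S\<in>P ` T. f S \<noteq> \<zero>}. f S)" by simp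
    moreover have "f \<in> (\<Pi>\<^sub>E S\<in>P ` T. S)"
    proof (rule PiE_I)
      fix S assume "S \<in> P ` T"
      then obtain i where "i \<in> T" "S = P i" by auto
      then show "f S \<in> S" using fP x by (auto simp: P_def)
    qed (simp add: f_def)
    ultimately show "\<exists>f. f \<in> (\<Pi>\<^sub>E S\<in>P ` T. S) \<and> finite {S\<in>P ` T. f S \<noteq> \<zero>} \<and>
        x = (\<Oplus>S\<in>{S\<in>P ` T. f S \<noteq> \<zero>}. f S)"
      using T by (intro exI[of _ f]) auto
  next
    fix x f g
    assume x: "x \<in> carrier A"
    \<comment> \<open>Right multiplication by \<open>e j\<close> keeps the component in
      \<open>P j\<close> and kills the others, so x determines its components.\<close>
    have *: "h (P j) = x \<otimes> e j"
      if h: "h \<in> (\<Pi>\<^sub>E S\<in>P ` T. S)" "x = (\<Oplus>S\<in>{S\<in>P ` T. h S \<noteq> \<zero>}. h S)" and j: "j \<in> T" for h j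
    proof -
      have hP: "h (P i) \<in> P i" if "i \<in> T" for i using h(1) that by auto
      then have hc: "h (P i) \<in> carrier A" if "i \<in> T" for i using that P_carrier by auto
      have "x = (\<Oplus>S\<in>P ` T. h S)"
        unfolding h(2) by (rule add.finprod_mono_neutral_cong_left) (use T hc in auto)
      also have "\<dots> = (\<Oplus>i\<in>T. h (P i))"
        using T inj hc by (subst finsum_reindex) auto
      finally have "x \<otimes> e j = (\<Oplus>i\<in>T. h (P i) \<otimes> e j)"
        using finsum_mult_right[of T "\<lambda>i. h (P i)" "e j"] hc T j by simp
      also have "\<dots> = (\<Oplus>i\<in>T. if j = i then h (P i) else \<zero>)"
        using P_mult[OF hP _ j] hc by (intro finsum_cong') auto
      also have "\<dots> = h (P j)"
        using add.finprod_singleton[of j T "\<lambda>i. h (P i)"] T j hc by auto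
      finally show ?thesis by simp
    qed
    assume "f \<in> (\<Pi>\<^sub>E S\<in>P ` T. S) \<and> finite {S\<in>P ` T. f S \<noteq> \<zero>} \<and> x = (\<Oplus>S\<in>{S\<in>P ` T. f S \<noteq> \<zero>}. f S)"
      "g \<in> (\<Pi>\<^sub>E S\<in>P ` T. S) \<and> finite {S\<in>P ` T. g S \<noteq> \<zero>} \<and> x = (\<Oplus>S\<in>{S\<in>P ` T. g S \<noteq> \<zero>}. g S)"
    then show "f = g"
      using *[of f] *[of g] by (intro PiE_ext[of f "P ` T" "\<lambda>S. S" g]) auto
  qed
  moreover have "has_unit A"
    unfolding has_unit_def using unit T by (intro bexI[of _ "finsum A e T"]) auto
  ultimately show ?thesis
    unfolding semisimple_ring_def by blast
qed

end

subsection \<open>Transfer along homomorphisms\<close>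

lemma left_ideal_vimage:
  assumes "nonunital_ring A" "nonunital_ring B" "h ` carrier A \<subseteq> carrier B"
    and add: "\<And>x y. x \<in> carrier A \<Longrightarrow> y \<in> carrier A \<Longrightarrow> h (x \<oplus>\<^bsub>A\<^esub> y) = h x \<oplus>\<^bsub>B\<^esub> h y"
    and mult: "\<And>x y. x \<in> carrier A \<Longrightarrow> y \<in> carrier A \<Longrightarrow> h (x \<otimes>\<^bsub>A\<^esub> y) = h x \<otimes>\<^bsub>B\<^esub> h y"
    and J: "left_ideal J B"
  shows "left_ideal {x \<in> carrier A. h x \<in> J} A"
proof -
  interpret A: nonunital_ring A by fact
  interpret B: nonunital_ring B by fact
  have h: "h x \<in> carrier B" if "x \<in> carrier A" for x using that assms(3) by auto
  have zero: "h \<zero>\<^bsub>A\<^esub> = \<zero>\<^bsub>B\<^esub>"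
    using add[of "\<zero>\<^bsub>A\<^esub>" "\<zero>\<^bsub>A\<^esub>"] h by (metis A.r_zero A.zero_closed B.add.r_cancel_one')
  have uminus: "h (\<ominus>\<^bsub>A\<^esub> x) = \<ominus>\<^bsub>B\<^esub> h x" if "x \<in> carrier A" for x
    using add[of "\<ominus>\<^bsub>A\<^esub> x" x] that h zero by (metis A.a_inv_closed A.l_neg B.minus_equality)
  show ?thesis
    by (rule A.left_idealI)
       (use J h in \<open>auto simp: zero uminus add mult B.left_ideal_uminus left_ideal_zero left_ideal_add
          left_ideal_l_closed\<close>)
qed

text \<open>Preimages of left ideals form a chain of the same kind, and as h is onto, a left ideal
  is the image of its preimage, so stability passes back.\<close>

lemma chain_conditions_image:
  assumes "nonunital_ring A" "nonunital_ring B" "h ` carrier A = carrier B"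
    and "\<And>x y. x \<in> carrier A \<Longrightarrow> y \<in> carrier A \<Longrightarrow> h (x \<oplus>\<^bsub>A\<^esub> y) = h x \<oplus>\<^bsub>B\<^esub> h y"
    and "\<And>x y. x \<in> carrier A \<Longrightarrow> y \<in> carrier A \<Longrightarrow> h (x \<otimes>\<^bsub>A\<^esub> y) = h x \<otimes>\<^bsub>B\<^esub> h y"
  shows "left_noetherian A \<Longrightarrow> left_noetherian B" "left_artinian A \<Longrightarrow> left_artinian B"
proof -
  have vim: "left_ideal {x \<in> carrier A. h x \<in> J} A" if "left_ideal J B" for J
    using left_ideal_vimage[OF assms(1,2) _ assms(4,5) that] assms(3) by auto
  have eq: "J = J'" if "left_ideal J B" "left_ideal J' B"
    "{x \<in> carrier A. h x \<in> J} = {x \<in> carrier A. h x \<in> J'}" for J J'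
  proof -
    have "J = h ` {x \<in> carrier A. h x \<in> J}" "J' = h ` {x \<in> carrier A. h x \<in> J'}"
      using that(1,2)[THEN left_ideal_subset] unfolding assms(3)[symmetric] by auto
    then show ?thesis using that(3) by simp
  qed
  show "left_noetherian B" if N: "left_noetherian A"
    unfolding left_noetherian_def
  proof (intro allI impI, elim conjE)
    fix I assume I: "\<forall>n. left_ideal (I n) B" "\<forall>n::nat. I n \<subseteq> I (Suc n)"
    obtain N where N: "\<And>n. n \<ge> N \<Longrightarrow> {x \<in> carrier A. h x \<in> I n} = {x \<in> carrier A. h x \<in> I N}"
    proof (rule left_noetherianD[OF N])
      show "left_ideal {x \<in> carrier A. h x \<in> I n} A" for n
        using vim I(1) by simp
      show "{x \<in> carrier A. h x \<in> I n} \<subseteq> {x \<in> carrier A. h x \<in> I (Suc n)}" for n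
        using I(2) by auto
    qed (rule that)
    show "\<exists>N. \<forall>n\<ge>N. I n = I N"
      using eq[OF I(1)[rule_format] I(1)[rule_format] N] by blast
  qed
  show "left_artinian B" if N: "left_artinian A"
    unfolding left_artinian_def
  proof (intro allI impI, elim conjE)
    fix I assume I: "\<forall>n. left_ideal (I n) B" "\<forall>n::nat. I (Suc n) \<subseteq> I n"
    obtain N where N: "\<And>n. n \<ge> N \<Longrightarrow> {x \<in> carrier A. h x \<in> I n} = {x \<in> carrier A. h x \<in> I N}"
    proof (rule left_artinianD[OF N])
      show "left_ideal {x \<in> carrier A. h x \<in> I n} A" for n
        using vim I(1) by simp
      show "{x \<in> carrier A. h x \<in> I (Suc n)} \<subseteq> {x \<in> carrier A. h x \<in> I n}" for n
        using I(2) by auto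
    qed (rule that)
    show "\<exists>N. \<forall>n\<ge>N. I n = I N"
      using eq[OF I(1)[rule_format] I(1)[rule_format] N] by blast
  qed
qed

section \<open>Evaluation of noncommutative polynomials\<close>

locale central_hom =
  fixes \<iota> :: "'r::comm_ring_1 \<Rightarrow> 'k::ring_1"
  assumes add: "\<iota> (a + b) = \<iota> a + \<iota> b" and mult: "\<iota> (a * b) = \<iota> a * \<iota> b" and one: "\<iota> 1 = 1"
    and central: "\<iota> a * z = z * \<iota> a"
begin

lemma zero [simp]: "\<iota> 0 = 0"
  using add[of 0 0] by simp

text \<open>Substitution, i.e. the universal property of the free algebra. It is multiplicative
  because scalars go to central elements.\<close>

definition ev :: "('g \<Rightarrow> 'k) \<Rightarrow> ('g free_monoid \<Rightarrow>\<^sub>0 'r) \<Rightarrow> 'k" where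
  "ev \<phi> f = (\<Sum>w\<in>Poly_Mapping.keys f. \<iota> (Poly_Mapping.lookup f w) * prod_list (map \<phi> (letters w)))"

lemma ev_zero [simp]: "ev \<phi> 0 = 0"
  by (simp add: ev_def)

lemma ev_single: "ev \<phi> (Poly_Mapping.single w c) = \<iota> c * prod_list (map \<phi> (letters w))"
  by (simp add: ev_def)

lemma ev_add [simp]: "ev \<phi> (f + g) = ev \<phi> f + ev \<phi> g"
proof -
  have ev: "ev \<phi> h = (\<Sum>w\<in>S. \<iota> (Poly_Mapping.lookup h w) * prod_list (map \<phi> (letters w)))"
    if "finite S" "Poly_Mapping.keys h \<subseteq> S" for h S
    unfolding ev_def using that by (intro sum.mono_neutral_left) (auto simp: in_keys_iff)
  let ?S = "Poly_Mapping.keys f \<union> Poly_Mapping.keys g"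
  have "ev \<phi> (f + g) = (\<Sum>w\<in>?S. \<iota> (Poly_Mapping.lookup (f + g) w) * prod_list (map \<phi> (letters w)))"
    using keys_add[of f g] by (intro ev) auto
  also have "\<dots> = ev \<phi> f + ev \<phi> g"
    by (simp add: ev[of ?S] lookup_add add distrib_right sum.distrib)
  finally show ?thesis .
qed

lemma ev_uminus [simp]: "ev \<phi> (- f) = - ev \<phi> f"
  using ev_add[of \<phi> "- f" f] by (simp add: eq_neg_iff_add_eq_0 del: ev_add)

lemma ev_diff [simp]: "ev \<phi> (f - g) = ev \<phi> f - ev \<phi> g"
  using ev_add[of \<phi> f "- g"] by simp

lemma ev_sum [simp]: "ev \<phi> (sum h A) = (\<Sum>i\<in>A. ev \<phi> (h i))"
  by (induction A rule: infinite_finite_induct) auto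

lemma ev_mult [simp]: "ev \<phi> (f * g) = ev \<phi> f * ev \<phi> g"
proof -
  have single: "ev \<phi> (Poly_Mapping.single u c * Poly_Mapping.single w d) =
      ev \<phi> (Poly_Mapping.single u c) * ev \<phi> (Poly_Mapping.single w d)" for u w c d
    by (simp add: mult_single ev_single mult)
       (metis central mult.assoc)
  have *: "ev \<phi> (Poly_Mapping.single u c * g) = ev \<phi> (Poly_Mapping.single u c) * ev \<phi> g" for u c
    by (rule free_algebra_induct[where f = g and X = UNIV])
       (auto simp: carrier_free_algebra single distrib_left)
  show ?thesis
    by (rule free_algebra_induct[where f = f and X = UNIV])
       (auto simp: carrier_free_algebra * distrib_right)
qed

lemma ev_one [simp]: "ev \<phi> 1 = 1"
  using ev_single[of \<phi> 0 1] by (simp add: one)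

lemma ev_gvar [simp]: "ev \<phi> (gvar g) = \<phi> g"
  by (simp add: gvar_def ev_single one)

lemma ev_word: "ev \<phi> (Poly_Mapping.single (FMon ws) 1) = prod_list (map \<phi> ws)"
  by (simp add: ev_single one)

lemma ev_const: "ev \<phi> (Poly_Mapping.single 0 c) = \<iota> c"
  by (simp add: ev_single)

end

definition subrng :: "'k::ring_1 set \<Rightarrow> 'k ring" where
  "subrng C = \<lparr>carrier = C, mult = (*), one = 1, zero = 0, add = (+)\<rparr>"

lemma subrng_sel [simp]:
  "carrier (subrng C) = C" "mult (subrng C) = (*)" "zero (subrng C) = 0" "add (subrng C) = (+)"
  by (simp_all add: subrng_def)

lemma nonunital_ring_subrng:
  assumes "0 \<in> C" "\<And>x y. x \<in> C \<Longrightarrow> y \<in> C \<Longrightarrow> x + y \<in> C" "\<And>x. x \<in> C \<Longrightarrow> - x \<in> C"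
    "\<And>x y. x \<in> C \<Longrightarrow> y \<in> C \<Longrightarrow> x * y \<in> C"
  shows "nonunital_ring (subrng C)"
proof -
  have "abelian_group (subrng C)"
  proof (rule abelian_groupI)
    fix x assume "x \<in> carrier (subrng C)"
    then show "\<exists>y\<in>carrier (subrng C). y \<oplus>\<^bsub>subrng C\<^esub> x = \<zero>\<^bsub>subrng C\<^esub>"
      using assms(3) by (intro bexI[of _ "- x"]) auto
  qed (use assms in \<open>auto simp: algebra_simps\<close>)
  then show ?thesis
    by (rule nonunital_ring.intro) (unfold_locales, use assms in \<open>auto simp: algebra_simps\<close>)
qed

section \<open>Families of ring elements that satisfy the defining relations\<close>

locale lpa_rep = lpa_graph E + central_hom \<iota>
  for E :: "('v, 'e) pre_digraph" and \<iota> :: "'r::comm_ring_1 \<Rightarrow> 'k::ring_1" +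
  fixes \<phi> :: "('v, 'e) lpa_gen \<Rightarrow> 'k"
  assumes rel_vv: "v \<in> verts E \<Longrightarrow> \<phi> (Vert v) * \<phi> (Vert v) = \<phi> (Vert v)"
    and rel_vw: "v \<in> verts E \<Longrightarrow> w \<in> verts E \<Longrightarrow> v \<noteq> w \<Longrightarrow> \<phi> (Vert v) * \<phi> (Vert w) = 0"
    and rel_se: "e \<in> arcs E \<Longrightarrow> \<phi> (Vert (tail E e)) * \<phi> (Edge e) = \<phi> (Edge e)"
    and rel_er: "e \<in> arcs E \<Longrightarrow> \<phi> (Edge e) * \<phi> (Vert (head E e)) = \<phi> (Edge e)"
    and rel_rg: "e \<in> arcs E \<Longrightarrow> \<phi> (Vert (head E e)) * \<phi> (Ghost e) = \<phi> (Ghost e)"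
    and rel_gs: "e \<in> arcs E \<Longrightarrow> \<phi> (Ghost e) * \<phi> (Vert (tail E e)) = \<phi> (Ghost e)"
    and rel_ge: "e \<in> arcs E \<Longrightarrow> \<phi> (Ghost e) * \<phi> (Edge e) = \<phi> (Vert (head E e))"
    and rel_gf: "e \<in> arcs E \<Longrightarrow> f \<in> arcs E \<Longrightarrow> e \<noteq> f \<Longrightarrow> \<phi> (Ghost e) * \<phi> (Edge f) = 0"
    and rel_vertex: "v \<in> verts E \<Longrightarrow> out_arcs E v \<noteq> {} \<Longrightarrow> finite (out_arcs E v) \<Longrightarrow>
      \<phi> (Vert v) = (\<Sum>e\<in>out_arcs E v. \<phi> (Edge e) * \<phi> (Ghost e))"
    and nonzero: "v \<in> verts E \<Longrightarrow> \<phi> (Vert v) \<noteq> 0"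
begin

abbreviation \<rho> where "\<rho> \<equiv> ev \<phi>"

lemma \<rho>_I: "f \<in> I \<Longrightarrow> \<rho> f = 0"
proof -
  have "ideal {f \<in> F1. \<rho> f = 0} (free_algebra gens)"
  proof (rule idealI[OF ring_free_algebra])
    show "subgroup {f \<in> F1. \<rho> f = 0} (add_monoid (free_algebra gens))"
    proof (rule group.subgroupI)
      show "Group.group (add_monoid (free_algebra gens :: ('a free_monoid \<Rightarrow>\<^sub>0 'r) ring))" for gens :: "'a set"
        using ring_free_algebra abelian_group.a_group ring.is_abelian_group by blast
      fix f assume f: "f \<in> {f \<in> F1. \<rho> f = 0}"
      interpret ring "free_algebra gens :: (_ \<Rightarrow>\<^sub>0 'r) ring" by (rule ring_free_algebra)
      have "\<ominus>\<^bsub>free_algebra gens\<^esub> f = - f"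
        using f by (intro minus_equality) (auto simp: F1_def)
      then have "inv\<^bsub>add_monoid (free_algebra gens)\<^esub> f = - f"
        by (simp only: a_inv_def)
      then show "inv\<^bsub>add_monoid (free_algebra gens)\<^esub> f \<in> {f \<in> F1. \<rho> f = 0}"
        using f by (simp only:) simp
    qed (auto simp: F1_def[symmetric] intro!: exI[of _ 0])
  qed (auto simp: F1_def[symmetric])
  moreover have "lpa_relators E \<subseteq> {f \<in> F1. \<rho> f = 0}"
  proof
    fix f :: "_ \<Rightarrow>\<^sub>0 'r" assume f: "f \<in> lpa_relators E"
    then have "\<rho> f = 0"
      by (induction rule: lpa_relators.induct)
         (simp_all add: rel_vv rel_vw rel_se rel_er rel_rg rel_gs rel_ge rel_gf rel_vertex)
    then show "f \<in> {f \<in> F1. \<rho> f = 0}" using f relators_F by auto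
  qed
  ultimately have "I \<subseteq> {f \<in> F1. \<rho> f = 0}" by (rule I_minimal)
  then show "f \<in> I \<Longrightarrow> \<rho> f = 0" by auto
qed

definition Im :: "'k ring" where
  "Im = subrng (\<rho> ` F)"

lemma Im_sel [simp]:
  "carrier Im = \<rho> ` F" "mult Im = (*)" "zero Im = 0" "add Im = (+)"
  by (simp_all add: Im_def)

lemma \<rho>_gens: "g \<in> gens \<Longrightarrow> \<phi> g \<in> \<rho> ` F"
  by (intro image_eqI[of _ _ "gvar g"]) auto

lemma \<rho>_closed:
  "x \<in> \<rho> ` F \<Longrightarrow> y \<in> \<rho> ` F \<Longrightarrow> x + y \<in> \<rho> ` F"
  "x \<in> \<rho> ` F \<Longrightarrow> y \<in> \<rho> ` F \<Longrightarrow> x - y \<in> \<rho> ` F"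
  "x \<in> \<rho> ` F \<Longrightarrow> y \<in> \<rho> ` F \<Longrightarrow> x * y \<in> \<rho> ` F"
  "x \<in> \<rho> ` F \<Longrightarrow> - x \<in> \<rho> ` F" "0 \<in> \<rho> ` F" "x \<in> \<rho> ` F \<Longrightarrow> \<iota> c * x \<in> \<rho> ` F"
  by (auto simp: image_iff intro: bexI[of _ "_ + _"])
     (metis F_simps ev_add ev_diff ev_mult ev_uminus ev_zero ev_const F1_simps F_F1)+

lemma nonunital_ring_Im: "nonunital_ring Im"
  unfolding Im_def by (rule nonunital_ring_subrng) (auto intro: \<rho>_closed)

lemma \<rho>_proj_eq:
  assumes "f \<in> F1" "g \<in> F1" "proj f = proj g"
  shows "\<rho> f = \<rho> g"
  using \<rho>_I[of "f - g"] assms by (simp add: proj_eq_iff)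

text \<open>The map induced on the quotient; by \<open>\<rho>_I\<close> the choice of a
  representative does not affect the value.\<close>

definition \<Phi> :: "(('v, 'e) lpa_gen free_monoid \<Rightarrow>\<^sub>0 'r) set \<Rightarrow> 'k" where
  "\<Phi> x = \<rho> (SOME f. f \<in> F \<and> proj f = x)"

lemma \<Phi>_proj: "f \<in> F \<Longrightarrow> \<Phi> (proj f) = \<rho> f"
  unfolding \<Phi>_def by (rule someI2[of _ f]) (auto intro: \<rho>_proj_eq)

lemma \<Phi>_image: "\<Phi> ` carrier L = \<rho> ` F"
  by (force simp: L_sel(1) \<Phi>_proj)

lemma Im_chain_conditions:
  "left_noetherian (L :: ('r, _) module) \<Longrightarrow> left_noetherian Im"
  "left_artinian (L :: ('r, _) module) \<Longrightarrow> left_artinian Im"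
proof -
  have *: "\<Phi> ` carrier L = carrier Im"
    "x \<in> carrier L \<Longrightarrow> y \<in> carrier L \<Longrightarrow> \<Phi> (x \<oplus>\<^bsub>L\<^esub> y) = \<Phi> x \<oplus>\<^bsub>Im\<^esub> \<Phi> y"
    "x \<in> carrier L \<Longrightarrow> y \<in> carrier L \<Longrightarrow> \<Phi> (x \<otimes>\<^bsub>L\<^esub> y) = \<Phi> x \<otimes>\<^bsub>Im\<^esub> \<Phi> y" for x y
    using \<Phi>_image by (auto simp: L_sel(1) \<Phi>_proj)
  show "left_noetherian (L :: ('r, _) module) \<Longrightarrow> left_noetherian Im"
    "left_artinian (L :: ('r, _) module) \<Longrightarrow> left_artinian Im"
    using chain_conditions_image[OF nonunital_ring_L nonunital_ring_Im, of \<Phi>] * by blast+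
qed

text \<open>Infinitely many vertices are themselves orthogonal idempotents; infinitely many arcs e
  give the orthogonal idempotents e e^*. The latter are nonzero since e^* (e e^* ) e = r(e), and
  vertices act as nonzero elements.\<close>

lemma chain_condition_imp_fin_digraph:
  assumes "left_noetherian (L :: ('r, _) module) \<or> left_artinian (L :: ('r, _) module)"
  shows "fin_digraph E"
proof -
  interpret Im: nonunital_ring Im by (rule nonunital_ring_Im)
  have Im: "left_noetherian Im \<or> left_artinian Im"
    using assms Im_chain_conditions by blast
  have "finite (verts E)"
  proof (rule ccontr)
    assume "infinite (verts E)"
    then obtain v :: "nat \<Rightarrow> 'v" where v: "inj v" "range v \<subseteq> verts E"
      using infinite_countable_subset by blast
    show False
      using Im.orthogonal_idempotents_imp_no_chain_condition[of "\<lambda>n. \<phi> (Vert (v n))"] Im v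
      by (auto simp: rel_vv rel_vw nonzero inj_eq \<rho>_gens range_subsetD)
  qed
  moreover have "finite (arcs E)"
  proof (rule ccontr)
    assume "infinite (arcs E)"
    then obtain e :: "nat \<Rightarrow> 'e" where "inj e" "range e \<subseteq> arcs E"
      using infinite_countable_subset by blast
    then have e: "e n \<in> arcs E" "e m = e n \<longleftrightarrow> m = n" for m n
      by (auto simp: inj_eq)
    define a where "a n = \<phi> (Edge (e n)) * \<phi> (Ghost (e n))" for n
    have aa: "a m * a n = (if m = n then a n else 0)" for m n
    proof -
      have "a m * a n = \<phi> (Edge (e m)) * (\<phi> (Ghost (e m)) * \<phi> (Edge (e n))) * \<phi> (Ghost (e n))"
        by (simp add: a_def mult.assoc)
      then show ?thesis
        using e[of n] e[of m] rel_gf[of "e m" "e n"] by (auto simp: a_def rel_ge rel_er e)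
    qed
    have "\<phi> (Ghost (e n)) * a n * \<phi> (Edge (e n)) = \<phi> (Vert (head E (e n)))" for n
    proof -
      have "\<phi> (Ghost (e n)) * a n * \<phi> (Edge (e n)) =
        (\<phi> (Ghost (e n)) * \<phi> (Edge (e n))) * (\<phi> (Ghost (e n)) * \<phi> (Edge (e n)))"
        by (simp add: a_def mult.assoc)
      then show ?thesis using e by (simp add: rel_ge rel_vv)
    qed
    then have "a n \<noteq> 0" for n
      using nonzero[of "head E (e n)"] e[of n] by (metis head_in_verts mult_zero_left mult_zero_right)
    moreover have "a n \<in> \<rho> ` F" for n
      unfolding a_def using e by (intro \<rho>_closed \<rho>_gens) auto
    ultimately show False
      using Im.orthogonal_idempotents_imp_no_chain_condition[of a] Im by (simp add: aa)
  qed
  ultimately show ?thesis by unfold_locales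
qed

text \<open>The images of a path and of its ghost path, which runs through the arcs in reverse
  order. The empty list gives the identity and not a vertex, which is why nonempty walks are
  required in what follows.\<close>

definition pe :: "'e list \<Rightarrow> 'k" where "pe p = prod_list (map (\<lambda>e. \<phi> (Edge e)) p)"
definition pg :: "'e list \<Rightarrow> 'k" where "pg p = prod_list (map (\<lambda>e. \<phi> (Ghost e)) (rev p))"

lemma pe_closed: "p \<noteq> [] \<Longrightarrow> set p \<subseteq> arcs E \<Longrightarrow> pe p \<in> \<rho> ` F"
  by (induction p rule: list_nonempty_induct) (auto simp: pe_def intro!: \<rho>_closed \<rho>_gens)

lemma pe_append [simp]: "pe (p @ q) = pe p * pe q"
  by (simp add: pe_def)

lemma pg_append [simp]: "pg (p @ q) = pg q * pg p"
  by (simp add: pg_def)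

lemma pg_closed: "p \<noteq> [] \<Longrightarrow> set p \<subseteq> arcs E \<Longrightarrow> pg p \<in> \<rho> ` F"
  by (induction p rule: list_nonempty_induct) (auto simp: pg_def intro!: \<rho>_closed \<rho>_gens)

lemma walk_vertex:
  assumes "awalk u p w" "p \<noteq> []"
  shows "\<phi> (Vert u) * pe p = pe p" "pe p * \<phi> (Vert w) = pe p" "pg p * \<phi> (Vert u) = pg p"
    "\<phi> (Vert w) * pg p = pg p"
proof -
  obtain e p' where p: "p = e # p'" using assms(2) by (cases p) auto
  have e: "e \<in> arcs E" "tail E e = u" using assms(1) by (auto simp: p awalk_Cons_iff)
  show "\<phi> (Vert u) * pe p = pe p" "pg p * \<phi> (Vert u) = pg p"
    using rel_se[OF e(1)] rel_gs[OF e(1)] e(2) by (auto simp: p pe_def pg_def mult.assoc[symmetric])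
       (simp add: mult.assoc)
  obtain f p'' where p: "p = p'' @ [f]" using assms(2) by (cases p rule: rev_cases) auto
  have f: "f \<in> arcs E" "head E f = w" using assms(1) by (auto simp: p awalk_Cons_iff)
  show "pe p * \<phi> (Vert w) = pe p" "\<phi> (Vert w) * pg p = pg p"
    using rel_er[OF f(1)] rel_rg[OF f(1)] f(2) by (auto simp: p pe_def pg_def mult.assoc[symmetric])
       (simp add: mult.assoc)
qed

lemma pg_pe:
  assumes "awalk u p w" "p \<noteq> []"
  shows "pg p * pe p = \<phi> (Vert w)"
  using assms
proof (induction p arbitrary: u)
  case (Cons e p)
  then have e: "e \<in> arcs E" "awalk (head E e) p w" by (auto simp: awalk_Cons_iff)
  have "pg (e # p) * pe (e # p) = pg p * (\<phi> (Ghost e) * \<phi> (Edge e)) * pe p"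
    by (simp add: pg_def pe_def mult.assoc)
  also have "\<dots> = pg p * (\<phi> (Vert (head E e)) * pe p)"
    using e by (simp add: rel_ge mult.assoc)
  also have "\<dots> = \<phi> (Vert w)"
  proof (cases "p = []")
    case True
    then show ?thesis using e by (auto simp: pe_def pg_def awalk_Nil_iff)
  next
    case False
    then show ?thesis using e Cons.IH[OF e(2)] walk_vertex[OF e(2)] by simp
  qed
  finally show ?case .
qed simp

text \<open>
  If \<open>f\<close> is an exit of the closed walk \<open>c\<close> at its base point, then the elements
  \<open>c\<^sup>n f f\<^sup>* c\<^sup>*\<^sup>n\<close> are pairwise orthogonal idempotents.
\<close>

lemma chain_condition_imp_NE:
  assumes "left_noetherian (L :: ('r, _) module) \<or> left_artinian (L :: ('r, _) module)"
  shows "condition_NE E"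
  unfolding condition_NE_def
proof (intro allI impI notI)
  fix p assume "cycle p" "has_exit E p"
  then obtain u v e e' where p: "awalk u p u" "v \<in> tail E ` set p"
    and ee: "e \<in> out_arcs E v" "e' \<in> out_arcs E v" "e \<noteq> e'"
    unfolding has_exit_def cycle_def by blast
  obtain g where "g \<in> set p" "tail E g = v" using p(2) by auto
  \<comment> \<open>Rotation makes the cycle start at v with the arc g. Of the two arcs leaving v
    one differs from g and is an exit at the base point.\<close>
  then obtain p1 p2 where pg12: "p = p1 @ g # p2" by (meson split_list)
  define c where "c = g # p2 @ p1"
  have c: "awalk v c v" "c \<noteq> []"
    using p(1) \<open>tail E g = v\<close> unfolding c_def pg12 by (auto simp: awalk_Cons_iff)
  obtain f where f: "f \<in> arcs E" "tail E f = v" "f \<noteq> g"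
    using ee by auto
  have g: "g \<in> arcs E" using c by (auto simp: c_def)
  interpret Im: nonunital_ring Im by (rule nonunital_ring_Im)
  define C where "C = pe c"
  define C' where "C' = pg c"
  define f1 where "f1 = \<phi> (Edge f)"
  define f2 where "f2 = \<phi> (Ghost f)"
  have C: "C' * C = \<phi> (Vert v)" "\<phi> (Vert v) * C = C" "C' * \<phi> (Vert v) = C'"
    using walk_vertex[OF c] pg_pe[OF c] by (simp_all add: C_def C'_def)
  have fC: "f2 * C = 0" "C' * f1 = 0"
    using rel_gf[OF f(1) g] rel_gf[OF g f(1)] f(3)
    by (auto simp: f1_def f2_def C_def C'_def c_def pe_def pg_def mult.assoc[symmetric])
       (simp add: mult.assoc)
  have f12: "f2 * f1 = \<phi> (Vert (head E f))" "\<phi> (Vert v) * f1 = f1" "f2 * \<phi> (Vert v) = f2"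
    "f1 * \<phi> (Vert (head E f)) = f1" "\<phi> (Vert (head E f)) * f2 = f2"
    using rel_ge[OF f(1)] rel_se[OF f(1)] rel_gs[OF f(1)] rel_er[OF f(1)] rel_rg[OF f(1)] f(2)
    by (auto simp: f1_def f2_def)
  \<comment> \<open>\<open>C ^ 0\<close> is the identity and not v, so the relation
    \<open>C' * C = v\<close> cancels powers only in front of a factor that v fixes, such as
    f1.\<close>
  have vC: "\<phi> (Vert v) * (C ^ n * f1) = C ^ n * f1" for n
    using C f12 by (cases n) (auto simp: mult.assoc[symmetric])
  have cancel: "C' ^ n * (C ^ n * (C ^ m * f1)) = C ^ m * f1" for n m
  proof (induction n)
    case (Suc n)
    have "C' ^ Suc n * (C ^ Suc n * (C ^ m * f1)) = C' ^ n * ((C' * C) * (C ^ (n + m) * f1))"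
      by (simp add: mult.assoc power_add power_commutes[of C', symmetric])
    also have "\<dots> = C' ^ n * (C ^ n * (C ^ m * f1))"
      using vC[of "n + m"] by (simp add: C power_add mult.assoc)
    finally show ?case using Suc by simp
  qed simp
  define b where "b n = C ^ n * f1" for n
  \<comment> \<open>The product of \<open>b' m\<close> and \<open>b n\<close> is f^* c^*^m c^n f.
    The smaller power cancels; a remaining c meets f^* or a remaining c^* meets f, and both give 0
    since f is not the first arc of c.\<close>
  define b' where "b' n = f2 * C' ^ n" for n
  have b'b: "b' m * b n = (if m = n then \<phi> (Vert (head E f)) else 0)" for m n
  proof (cases m n rule: linorder_cases)
    case less
    then obtain k where k: "n = m + Suc k" using less_natE by auto
    have "b' m * b n = f2 * (C' ^ m * (C ^ m * (C ^ Suc k * f1)))"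
      unfolding k power_add b_def b'_def by (simp add: mult.assoc)
    also have "\<dots> = (f2 * C) * (C ^ k * f1)"
      unfolding cancel by (simp add: mult.assoc)
    finally show ?thesis using less fC by simp
  next
    case equal
    have "b' m * b n = f2 * (C' ^ n * (C ^ n * (C ^ 0 * f1)))"
      by (simp add: equal mult.assoc b_def b'_def)
    also have "\<dots> = f2 * f1" unfolding cancel by simp
    finally show ?thesis using equal f12 by simp
  next
    case greater
    then obtain k where k: "m = Suc k + n" using less_natE by (metis add.commute add_Suc_right)
    have "b' m * b n = f2 * (C' ^ Suc k * (C' ^ n * (C ^ n * (C ^ 0 * f1))))"
      unfolding k power_add b_def b'_def by (simp add: mult.assoc)
    also have "\<dots> = f2 * (C' ^ k * (C' * f1))"
      unfolding cancel by (simp add: power_Suc2 mult.assoc del: power_Suc)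
    finally show ?thesis using greater fC by simp
  qed
  define a where "a n = b n * b' n" for n
  have aa: "a m * a n = (if m = n then a n else 0)" for m n
  proof -
    have "a m * a n = b m * (b' m * b n) * b' n" by (simp add: a_def mult.assoc)
    also have "\<dots> = (if m = n then a n else 0)"
      unfolding b'b using f12(4) by (simp add: a_def b_def mult.assoc) (simp flip: mult.assoc)
    finally show ?thesis .
  qed
  have "a n \<noteq> 0" for n
  proof
    assume "a n = 0"
    have "(b' n * b n) * (b' n * b n) = b' n * a n * b n"
      by (simp only: a_def mult.assoc)
    then have "(b' n * b n) * (b' n * b n) = 0"
      by (simp only: \<open>a n = 0\<close> mult_zero_left mult_zero_right)
    then show False
      using nonzero[of "head E f"] f(1) by (simp add: b'b rel_vv)
  qed
  moreover have "a n \<in> \<rho> ` F" for n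
  proof -
    have gens: "C \<in> \<rho> ` F" "C' \<in> \<rho> ` F" "f1 \<in> \<rho> ` F" "f2 \<in> \<rho> ` F"
      using c f by (auto simp: C_def C'_def f1_def f2_def intro!: pe_closed pg_closed \<rho>_gens)
    have "C ^ n * f1 \<in> \<rho> ` F"
      by (induction n) (simp_all only: power_0 mult_1 power_Suc mult.assoc gens \<rho>_closed(3))
    moreover have "f2 * C' ^ n \<in> \<rho> ` F"
      by (induction n) (simp_all only: power_0 mult_1_right power_Suc2 mult.assoc[symmetric] gens \<rho>_closed(3))
    ultimately show ?thesis
      unfolding a_def b_def b'_def by (rule \<rho>_closed(3))
  qed
  ultimately show False
    using Im.orthogonal_idempotents_imp_no_chain_condition[of a] assms Im_chain_conditions
    by (auto simp add: aa)
qed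

end

section \<open>The boundary path representation\<close>

text \<open>The endomorphism ring of the module of all functions on \<open>'x\<close>, as a type, so
  that it can serve as the target of a representation.\<close>

typedef (overloaded) ('x, 's::comm_ring_1) lin =
  "{\<phi> :: ('x \<Rightarrow> 's) \<Rightarrow> 'x \<Rightarrow> 's. (\<forall>y z. \<phi> (\<lambda>x. y x + z x) = (\<lambda>x. \<phi> y x + \<phi> z x)) \<and>
      (\<forall>c y. \<phi> (\<lambda>x. c * y x) = (\<lambda>x. c * \<phi> y x))}"
  morphisms app Lin
  by (rule exI[of _ "\<lambda>y. y"]) auto

setup_lifting type_definition_lin

lemma app_add: "app \<phi> (\<lambda>x. y x + z x) x' = app \<phi> y x' + app \<phi> z x'"
  using app[of \<phi>] by (auto simp: fun_eq_iff)

lemma app_scale: "app \<phi> (\<lambda>x. c * y x) x' = c * app \<phi> y x'"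
  using app[of \<phi>] by (auto simp: fun_eq_iff)

lemma app_zero [simp]: "app \<phi> (\<lambda>x. 0) x' = 0"
  using app_scale[of \<phi> 0 "\<lambda>x. 0"] by simp

instantiation lin :: (type, comm_ring_1) ring_1
begin

lift_definition zero_lin :: "('a, 'b) lin" is "\<lambda>y x. 0" by simp
lift_definition one_lin :: "('a, 'b) lin" is "\<lambda>y. y" by simp
lift_definition plus_lin :: "('a, 'b) lin \<Rightarrow> ('a, 'b) lin \<Rightarrow> ('a, 'b) lin" is "\<lambda>\<phi> \<psi> y x. \<phi> y x + \<psi> y x"
  by (auto simp: algebra_simps)
lift_definition uminus_lin :: "('a, 'b) lin \<Rightarrow> ('a, 'b) lin" is "\<lambda>\<phi> y x. - \<phi> y x"
  by (auto simp: algebra_simps)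
lift_definition minus_lin :: "('a, 'b) lin \<Rightarrow> ('a, 'b) lin \<Rightarrow> ('a, 'b) lin" is "\<lambda>\<phi> \<psi> y x. \<phi> y x - \<psi> y x"
  by (auto simp: algebra_simps)
lift_definition times_lin :: "('a, 'b) lin \<Rightarrow> ('a, 'b) lin \<Rightarrow> ('a, 'b) lin" is "\<lambda>\<phi> \<psi> y. \<phi> (\<psi> y)"
  by auto

lemma lin_eqI: "(\<And>y x. app \<phi> y x = app \<psi> y x) \<Longrightarrow> \<phi> = \<psi>" for \<phi> \<psi> :: "('a, 'b) lin"
  by (metis app_inject ext)

lemma app_simps [simp]:
  "app (0 :: ('a, 'b) lin) y = (\<lambda>x. 0)" "app (1 :: ('a, 'b) lin) y = y"
  "app (\<phi> + \<psi> :: ('a, 'b) lin) y = (\<lambda>x. app \<phi> y x + app \<psi> y x)"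
  "app (- \<phi> :: ('a, 'b) lin) y = (\<lambda>x. - app \<phi> y x)"
  "app (\<phi> - \<psi> :: ('a, 'b) lin) y = (\<lambda>x. app \<phi> y x - app \<psi> y x)"
  "app (\<phi> * \<psi> :: ('a, 'b) lin) y = app \<phi> (app \<psi> y)"
  by (transfer; simp)+

instance
proof
  show "(0 :: ('a, 'b) lin) \<noteq> 1"
  proof
    assume "(0 :: ('a, 'b) lin) = 1"
    then have "app (0 :: ('a, 'b) lin) (\<lambda>x. 1) = app 1 (\<lambda>x. 1)" by simp
    then show False by (simp add: fun_eq_iff)
  qed
qed (rule lin_eqI, simp add: app_add algebra_simps; fail)+

end

lemma app_sum [simp]: "app (sum h A) y x = (\<Sum>i\<in>A. app (h i) y x)"
  by (induction A rule: infinite_finite_induct) auto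

lift_definition lin_scalar :: "'s::comm_ring_1 \<Rightarrow> ('x, 's) lin" is "\<lambda>c y x. c * y x"
  by (auto simp: algebra_simps)

lemma app_lin_scalar [simp]: "app (lin_scalar c) y x = c * y x"
  by transfer simp

text \<open>Weighted composition with a partial map. All generators act in this form, which reduces
  most relations to comparisons of partial maps. In a product of two such operators the map of the
  left factor is applied to the point first.\<close>

lift_definition pull :: "('x \<Rightarrow> bool) \<Rightarrow> 's::comm_ring_1 \<Rightarrow> ('x \<Rightarrow> 'x) \<Rightarrow> ('x, 's) lin"
  is "\<lambda>D c \<sigma> y x. if D x then c * y (\<sigma> x) else 0"
  by (auto simp: algebra_simps fun_eq_iff)

lemma app_pull [simp]: "app (pull D c \<sigma>) y x = (if D x then c * y (\<sigma> x) else 0)"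
  by transfer simp

lemma pull_mult: "pull D c \<sigma> * pull D' c' \<sigma>' = pull (\<lambda>x. D x \<and> D' (\<sigma> x)) (c * c') (\<sigma>' \<circ> \<sigma>)"
  by (rule lin_eqI) (simp add: mult.assoc)

lemma pull_cong:
  assumes "\<And>x. D x \<longleftrightarrow> D' x" "c = c'" "\<And>x. D x \<Longrightarrow> \<sigma> x = \<sigma>' x"
  shows "pull D c \<sigma> = pull D' c' \<sigma>'"
proof (rule lin_eqI)
  fix y x
  show "app (pull D c \<sigma>) y x = app (pull D' c' \<sigma>') y x"
    using assms(1)[of x] assms(3)[of x] by (cases "D x") (simp_all add: assms(2))
qed

lemma pull_0: "(\<And>x. \<not> D x) \<Longrightarrow> pull D c \<sigma> = 0"
  by (rule lin_eqI) simp

abbreviation (input) delta :: "'x \<Rightarrow> 'x \<Rightarrow> 's::comm_ring_1" where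
  "delta a \<equiv> \<lambda>x. if x = a then 1 else 0"

type_synonym ('v, 'e) bpoint = "'v \<times> (nat \<Rightarrow> 'e option)"

section \<open>Boundary paths\<close>

context lpa_graph
begin

definition singular :: "'v \<Rightarrow> bool" where
  "singular v \<longleftrightarrow> out_arcs E v = {} \<or> infinite (out_arcs E v)"

text \<open>
  A boundary path from \<open>v\<close> is encoded by the sequence of its arcs; after the value \<open>None\<close>,
  which ends a finite path, the sequence is arbitrary.
\<close>

coinductive bpath :: "'v \<Rightarrow> (nat \<Rightarrow> 'e option) \<Rightarrow> bool" where
  stop: "v \<in> verts E \<Longrightarrow> singular v \<Longrightarrow> s 0 = None \<Longrightarrow> bpath v s"
| step: "e \<in> arcs E \<Longrightarrow> s 0 = Some e \<Longrightarrow> tail E e = v \<Longrightarrow> bpath (head E e) (s \<circ> Suc) \<Longrightarrow> bpath v s"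

abbreviation "bpt x \<equiv> bpath (fst x) (snd x)"

definition uncons :: "('v, 'e) bpoint \<Rightarrow> ('v, 'e) bpoint" where
  "uncons x = (head E (the (snd x 0)), snd x \<circ> Suc)"

definition cons :: "'e \<Rightarrow> ('v, 'e) bpoint \<Rightarrow> ('v, 'e) bpoint" where
  "cons e x = (tail E e, case_nat (Some e) (snd x))"

lemma case_nat_Suc_comp [simp]: "case_nat a f \<circ> Suc = f"
  by (simp add: fun_eq_iff)

lemma cons_simps [simp]: "fst (cons e x) = tail E e" "snd (cons e x) 0 = Some e"
  by (simp_all add: cons_def)

lemma uncons_cons: "fst x = head E e \<Longrightarrow> uncons (cons e x) = x"
  by (cases x) (simp add: uncons_def cons_def)

lemma cons_uncons: "snd x 0 = Some e \<Longrightarrow> fst x = tail E e \<Longrightarrow> cons e (uncons x) = x"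
  by (cases x) (auto simp: uncons_def cons_def fun_eq_iff split: nat.split)

lemma bpt_cases:
  assumes "bpt x"
  shows "(snd x 0 = None \<and> singular (fst x)) \<or> (\<exists>e\<in>out_arcs E (fst x). snd x 0 = Some e)"
  using assms by (cases rule: bpath.cases) auto

lemma bpt_vert: "bpt x \<Longrightarrow> fst x \<in> verts E"
  by (erule bpath.cases) (simp, metis tail_in_verts)

lemma bpt_SomeD:
  assumes "bpt x" "snd x 0 = Some e"
  shows "e \<in> arcs E" "tail E e = fst x" "bpt (uncons x)" "fst (uncons x) = head E e"
  using assms by (auto simp: uncons_def elim: bpath.cases)

lemma bpt_cons: "e \<in> arcs E \<Longrightarrow> bpt x \<Longrightarrow> fst x = head E e \<Longrightarrow> bpt (cons e x)"
  unfolding cons_def fst_conv snd_conv by (rule bpath.step[of e]) auto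

lemma bpath_cons [simp]:
  "e \<in> arcs E \<Longrightarrow> bpt x \<Longrightarrow> fst x = head E e \<Longrightarrow> bpath (tail E e) (snd (cons e x))"
  using bpt_cons[of e x] by simp

text \<open>Following one chosen arc at each nonsingular vertex either reaches a singular vertex or
  goes on forever; coinduction covers both. This is what keeps the vertices from acting as
  zero.\<close>

lemma bpath_exists:
  assumes "v \<in> verts E"
  shows "\<exists>s. bpath v s"
proof -
  define ch where "ch u = (if singular u then None else Some (SOME e. e \<in> out_arcs E u))" for u
  define nx where "nx u = head E (the (ch u))" for u
  have "bpath u s" if "u \<in> verts E \<and> s = (\<lambda>n. ch ((nx ^^ n) u))" for u s
    using that
  proof (coinduction arbitrary: u s)
    case bpath
    show ?case
    proof (cases "singular u")
      case True
      then show ?thesis using bpath by (auto simp: ch_def)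
    next
      case False
      then obtain e' where "e' \<in> out_arcs E u" by (auto simp only: singular_def)
      then have "(SOME e. e \<in> out_arcs E u) \<in> out_arcs E u" by (rule someI)
      then obtain e where e: "ch u = Some e" "e \<in> out_arcs E u"
        using False by (simp add: ch_def)
      have "s \<circ> Suc = (\<lambda>n. ch ((nx ^^ n) (head E e)))"
        using bpath e by (auto simp: fun_eq_iff nx_def funpow_swap1)
      then show ?thesis using bpath e by auto
    qed
  qed
  then show ?thesis using assms by blast
qed

end

definition mono_t :: "int \<Rightarrow> 'r::comm_ring_1 laurent" where
  "mono_t k = Poly_Mapping.single k 1"

lemma single_0_mult:
  "Poly_Mapping.single (0::int) (a * b) = Poly_Mapping.single 0 a * Poly_Mapping.single 0 (b :: 'r::comm_ring_1)"
  by (simp add: mult_single)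

lemma mono_t_mult: "mono_t j * mono_t k = mono_t (j + k)"
  by (simp add: mono_t_def mult_single)

lemma mono_t_0 [simp]: "mono_t 0 = 1"
  by (simp add: mono_t_def)

lemma mono_t_cancel [simp]: "mono_t (- k) * (mono_t k * z) = z" "mono_t k * (mono_t (- k) * z) = z"
  by (simp_all add: mult.assoc[symmetric] mono_t_mult)

section \<open>The action of the generators\<close>

locale bpath_rep = lpa_graph E for E :: "('v, 'e) pre_digraph" +
  fixes W :: "'v set"
begin

definition wt :: "'e \<Rightarrow> int" where
  "wt e = (if tail E e \<in> W then 1 else 0)"

text \<open>On functions \<open>Edge e\<close> evaluates after removing the first arc e, so on
  indicators it does the expected: the indicator of x goes to t^(wt e) times that of e x. The ghost
  arc carries the inverse weight, so that the weights cancel in e^* e and e e^*.\<close>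

primrec act :: "('v, 'e) lpa_gen \<Rightarrow> (('v, 'e) bpoint, 'r::comm_ring_1 laurent) lin" where
  "act (Vert v) = pull (\<lambda>x. bpt x \<and> fst x = v) 1 id"
| "act (Edge e) = pull (\<lambda>x. bpt x \<and> snd x 0 = Some e) (mono_t (wt e)) uncons"
| "act (Ghost e) = pull (\<lambda>x. e \<in> arcs E \<and> bpt x \<and> fst x = head E e) (mono_t (- wt e)) (cons e)"

definition scal :: "'r::comm_ring_1 \<Rightarrow> (('v, 'e) bpoint, 'r laurent) lin" where
  "scal c = lin_scalar (Poly_Mapping.single 0 c)"

lemma app_scal: "app (scal c) y = (\<lambda>x. Poly_Mapping.single 0 c * y x)"
  by (simp add: scal_def fun_eq_iff)

lemma central_hom_scal: "central_hom (scal :: 'r::comm_ring_1 \<Rightarrow> _)"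
proof
  fix a b :: 'r and z :: "(('v, 'e) bpoint, 'r laurent) lin"
  show "scal (a + b) = (scal a + scal b :: (('v, 'e) bpoint, 'r laurent) lin)"
    by (rule lin_eqI) (simp add: app_scal single_add algebra_simps)
  show "scal (a * b) = (scal a * scal b :: (('v, 'e) bpoint, 'r laurent) lin)"
    by (rule lin_eqI) (simp add: app_scal single_0_mult mult.assoc)
  show "scal (1 :: 'r) = (1 :: (('v, 'e) bpoint, 'r laurent) lin)"
    by (rule lin_eqI) (simp add: app_scal)
  show "scal a * z = z * scal a"
    by (rule lin_eqI) (simp add: app_scal app_scale)
qed

lemma act_Edge_Ghost:
  "app (act (Edge e)) (app (act (Ghost e)) y) x = (if bpt x \<and> snd x 0 = Some e then y x else 0)"
proof (cases "bpt x \<and> snd x 0 = Some e")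
  case True
  then show ?thesis using bpt_SomeD[of x e] cons_uncons[of x e] by simp
qed auto

text \<open>A boundary path cannot stop at a nonsingular vertex, so a point at v begins with exactly
  one arc, and only the summand of this arc contributes.\<close>

lemma act_vertex_sum:
  assumes v: "v \<in> verts E" "out_arcs E v \<noteq> {}" "finite (out_arcs E v)"
  shows "act (Vert v) = (\<Sum>e\<in>out_arcs E v. act (Edge e) * act (Ghost e))"
proof (rule lin_eqI)
  fix y :: "('v, 'e) bpoint \<Rightarrow> 'a laurent" and x
  show "app (act (Vert v)) y x = app (\<Sum>e\<in>out_arcs E v. act (Edge e) * act (Ghost e)) y x"
  proof (cases "bpt x \<and> fst x = v")
    case True
    then obtain e where e: "e \<in> out_arcs E v" "snd x 0 = Some e"
      using bpt_cases[of x] v unfolding singular_def by blast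
    then have "app (\<Sum>e\<in>out_arcs E v. act (Edge e) * act (Ghost e)) y x = (\<Sum>e'\<in>out_arcs E v. if e' = e then y x else 0)"
      using True unfolding app_sum app_simps act_Edge_Ghost by (intro sum.cong) auto
    also have "\<dots> = y x" using e v by simp
    also have "y x = app (act (Vert v)) y x"
      unfolding act.simps app_pull if_P[OF True] by simp
    finally show ?thesis by (rule sym)
  next
    case False
    have "app (act (Edge e)) (app (act (Ghost e)) y) x = 0" if "e \<in> out_arcs E v" for e
      unfolding act_Edge_Ghost using False bpt_SomeD(2)[of x e] that by auto
    then have "app (\<Sum>e\<in>out_arcs E v. act (Edge e) * act (Ghost e)) y x = 0"
      unfolding app_sum app_simps by (intro sum.neutral ballI)
    moreover have "app (act (Vert v)) y x = 0"
      unfolding act.simps app_pull if_not_P[OF False] by simp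
    ultimately show ?thesis by (simp only:)
  qed
qed

lemma lpa_rep_act: "lpa_rep E (scal :: 'r::comm_ring_1 \<Rightarrow> _) act"
proof (rule lpa_rep.intro[OF lpa_graph_axioms central_hom_scal], rule lpa_rep_axioms.intro)
  fix v assume v: "v \<in> verts E"
  obtain s where s: "bpath v s" using bpath_exists[OF v] by auto
  show "act (Vert v) \<noteq> (0 :: (('v, 'e) bpoint, 'r laurent) lin)"
  proof
    assume "act (Vert v) = (0 :: (('v, 'e) bpoint, 'r laurent) lin)"
    then have "app (act (Vert v)) (delta (v, s)) (v, s) = app (0 :: (('v, 'e) bpoint, 'r laurent) lin) (delta (v, s)) (v, s)"
      by (simp only:)
    then show False using s by simp
  qed
next
  fix e assume e: "e \<in> arcs E"
  have "bpt x \<and> snd x 0 = Some e \<Longrightarrow> fst x = tail E e" for x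
    using bpt_SomeD(2) by metis
  then show "act (Vert (tail E e)) * act (Edge e) = (act (Edge e) :: (('v, 'e) bpoint, 'r laurent) lin)"
    unfolding act.simps pull_mult by (intro pull_cong) (simp_all, blast)
  have "bpt x \<and> snd x 0 = Some e \<Longrightarrow> bpt (uncons x) \<and> fst (uncons x) = head E e" for x
    using bpt_SomeD(3,4) by metis
  then show "act (Edge e) * act (Vert (head E e)) = (act (Edge e) :: (('v, 'e) bpoint, 'r laurent) lin)"
    unfolding act.simps pull_mult by (intro pull_cong) (simp_all, blast)
  show "act (Vert (head E e)) * act (Ghost e) = (act (Ghost e) :: (('v, 'e) bpoint, 'r laurent) lin)"
    unfolding act.simps pull_mult by (intro pull_cong) (simp_all, blast)
  have cons: "bpt (cons e x) \<and> fst (cons e x) = tail E e \<and> uncons (cons e x) = x" if "bpt x \<and> fst x = head E e" for x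
    using e that bpt_cons[of e x] uncons_cons[of x e] cons_simps(1)[of e x] by blast
  then show "act (Ghost e) * act (Vert (tail E e)) = (act (Ghost e) :: (('v, 'e) bpoint, 'r laurent) lin)"
    unfolding act.simps pull_mult by (intro pull_cong) (simp_all, blast)
  show "act (Ghost e) * act (Edge e) = (act (Vert (head E e)) :: (('v, 'e) bpoint, 'r laurent) lin)"
    unfolding act.simps pull_mult
  proof (rule pull_cong)
    fix x
    show "((e \<in> arcs E \<and> bpt x \<and> fst x = head E e) \<and> bpt (cons e x) \<and> snd (cons e x) 0 = Some e) \<longleftrightarrow>
        bpt x \<and> fst x = head E e"
      using e cons[of x] by (simp only: cons_simps) blast
  qed (use cons in \<open>auto simp: mono_t_mult\<close>)
  show "act (Ghost e) * act (Edge f) = (0 :: (('v, 'e) bpoint, 'r laurent) lin)" if "f \<in> arcs E" "e \<noteq> f" for f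
    unfolding act.simps pull_mult using that by (intro pull_0) (simp only: cons_simps, blast)
next
  fix v assume v: "v \<in> verts E"
  show "act (Vert v) * act (Vert v) = (act (Vert v) :: (('v, 'e) bpoint, 'r laurent) lin)"
    unfolding act.simps pull_mult by (intro pull_cong) simp_all
  show "act (Vert v) * act (Vert w) = (0 :: (('v, 'e) bpoint, 'r laurent) lin)" if "w \<in> verts E" "v \<noteq> w" for w
    unfolding act.simps pull_mult using that by (intro pull_0) auto
  show "act (Vert v) = (\<Sum>e\<in>out_arcs E v. act (Edge e) * act (Ghost e) :: (('v, 'e) bpoint, 'r laurent) lin)"
    if "out_arcs E v \<noteq> {}" "finite (out_arcs E v)"
    using v that by (rule act_vertex_sum)
qed

sublocale lpa_rep E "scal :: 'r::comm_ring_1 \<Rightarrow> _" act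
  by (rule lpa_rep_act)

end

section \<open>Laurent polynomials\<close>

lemma poly_mapping_additive_induct [case_names single add]:
  assumes "\<And>k c. P (Poly_Mapping.single k c)" "\<And>f g. P f \<Longrightarrow> P g \<Longrightarrow> P (f + g)"
  shows "P (f :: 'a \<Rightarrow>\<^sub>0 'b::comm_monoid_add)"
proof -
  have "P (sum h A)" if "finite A" "\<And>k. P (h k)" for h and A :: "'a set"
    using that assms(1)[of undefined 0] by (induction A) (auto intro: assms(2))
  from this[OF finite_keys assms(1)] show ?thesis
    by (subst poly_mapping_sum_single)
qed

lemma lookup_single_times:
  fixes s :: "'r::comm_ring_1 laurent"
  shows "Poly_Mapping.lookup (Poly_Mapping.single j c * s) k = c * Poly_Mapping.lookup s (k - j)"
proof (induction s rule: poly_mapping_additive_induct)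
  case (single i d)
  then show ?case by (auto simp: mult_single lookup_single when_def)
next
  case (add f g)
  then show ?case by (simp add: lookup_add algebra_simps)
qed

lemma lookup_mono_t_times [simp]:
  "Poly_Mapping.lookup (mono_t j * s) k = Poly_Mapping.lookup s (k - j)"
  by (simp add: mono_t_def lookup_single_times)

text \<open>Evaluation at t = 1, the augmentation of the group ring of the integers.\<close>

definition aug :: "'r::comm_ring_1 laurent \<Rightarrow> 'r" where
  "aug s = (\<Sum>k\<in>Poly_Mapping.keys s. Poly_Mapping.lookup s k)"

lemma aug_single [simp]: "aug (Poly_Mapping.single k c) = c"
  by (simp add: aug_def)

lemma aug_zero [simp]: "aug 0 = 0"
  by (simp add: aug_def)

lemma aug_add [simp]: "aug (s + s') = aug s + aug s'"
proof -
  have aug: "aug u = (\<Sum>k\<in>A. Poly_Mapping.lookup u k)" if "finite A" "Poly_Mapping.keys u \<subseteq> A" for u :: "'a laurent" and A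
    unfolding aug_def using that by (intro sum.mono_neutral_left) (auto simp: in_keys_iff)
  let ?A = "Poly_Mapping.keys s \<union> Poly_Mapping.keys s'"
  have "aug (s + s') = (\<Sum>k\<in>?A. Poly_Mapping.lookup (s + s') k)"
    using keys_add[of s s'] by (intro aug) auto
  then show ?thesis
    by (simp add: aug[of ?A] lookup_add sum.distrib)
qed

lemma aug_mult [simp]: "aug (s * s') = aug s * aug s'"
proof (induction s rule: poly_mapping_additive_induct)
  case (single k c)
  show ?case
    by (induction s' rule: poly_mapping_additive_induct) (simp_all add: mult_single algebra_simps)
qed (simp add: algebra_simps)

lemma aug_one [simp]: "aug 1 = 1"
  using aug_single[of 0 1] by simp

lemma aug_uminus [simp]: "aug (- s) = - aug s"
  using aug_add[of "- s" s] by (simp add: eq_neg_iff_add_eq_0 del: aug_add)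

lemma aug_diff [simp]: "aug (s - s') = aug s - aug s'"
  using aug_add[of s "- s'"] by simp

text \<open>If 1 - t kills s, then all coefficients of s are equal, and a nonzero one would give
  infinite support. Zero divisors among the coefficients do no harm.\<close>

lemma one_minus_t_cancel:
  fixes s :: "'r::comm_ring_1 laurent"
  assumes "(1 - mono_t 1) * s = 0"
  shows "s = 0"
proof (rule ccontr)
  assume "s \<noteq> 0"
  then obtain k where k: "Poly_Mapping.lookup s k \<noteq> 0" by (metis poly_mapping_eqI lookup_zero)
  have step: "Poly_Mapping.lookup s j = Poly_Mapping.lookup s (j - 1)" for j
  proof -
    have "Poly_Mapping.lookup ((1 - mono_t 1) * s) j = 0" by (simp add: assms)
    then show ?thesis by (simp add: left_diff_distrib lookup_minus)
  qed
  have "Poly_Mapping.lookup s (k - int n) = Poly_Mapping.lookup s k" for n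
    by (induction n) (simp_all add: step[of "k - int _"] algebra_simps)
  then have "range (\<lambda>n. k - int n) \<subseteq> Poly_Mapping.keys s"
    using k by (auto simp: in_keys_iff)
  moreover have "infinite (range (\<lambda>n. k - int n))"
    by (rule range_inj_infinite) (simp add: inj_def)
  ultimately show False using finite_keys finite_subset by blast
qed

text \<open>Cancelling 1 - t repeatedly leaves 1 = (1 - t) s, which evaluation at t = 1 turns into 1
  = 0.\<close>

lemma one_minus_t_power:
  fixes s :: "'r::comm_ring_1 laurent"
  assumes "(1 - mono_t 1) ^ n = (1 - mono_t 1) ^ Suc n * s"
  shows False
  using assms
proof (induction n)
  case 0
  then have "aug 1 = aug ((1 - mono_t 1) * s)" by simp
  then show ?case by (simp add: mono_t_def del: aug_mult) (simp add: mono_t_def)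
next
  case (Suc n)
  have "(1 - mono_t 1) * ((1 - mono_t 1) ^ n - (1 - mono_t 1) ^ Suc n * s) = 0"
    using Suc.prems by (simp add: algebra_simps)
  then show ?case using one_minus_t_cancel Suc.IH by force
qed

section \<open>Ideals of commutative rings\<close>

definition is_ideal :: "'a::comm_ring_1 set \<Rightarrow> bool" where
  "is_ideal K \<longleftrightarrow> 0 \<in> K \<and> (\<forall>x\<in>K. \<forall>y\<in>K. x + y \<in> K) \<and> (\<forall>a. \<forall>x\<in>K. a * x \<in> K)"

lemma is_ideal_0: "is_ideal K \<Longrightarrow> 0 \<in> K"
  and is_ideal_add: "is_ideal K \<Longrightarrow> x \<in> K \<Longrightarrow> y \<in> K \<Longrightarrow> x + y \<in> K"
  and is_ideal_mult: "is_ideal K \<Longrightarrow> x \<in> K \<Longrightarrow> a * x \<in> K"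
  by (auto simp: is_ideal_def)

lemma is_ideal_uminus: "is_ideal K \<Longrightarrow> x \<in> K \<Longrightarrow> - x \<in> K"
  using is_ideal_mult[of K x "- 1"] by simp

lemma is_ideal_diff: "is_ideal K \<Longrightarrow> x \<in> K \<Longrightarrow> y \<in> K \<Longrightarrow> x - y \<in> K"
  using is_ideal_add[of K x "- y"] is_ideal_uminus[of K y] by simp

lemma nonunital_ring_class_ring: "nonunital_ring (class_ring :: 'a::comm_ring_1 ring)"
  using nonunital_ring_subrng[of "UNIV :: 'a set"] by (simp add: subrng_def)

lemma left_ideal_class_ring_iff: "left_ideal K (class_ring :: 'a::comm_ring_1 ring) \<longleftrightarrow> is_ideal K"
proof
  assume K: "left_ideal K (class_ring :: 'a ring)"
  show "is_ideal K"
    using left_ideal_zero[OF K] left_ideal_add[OF K] left_ideal_l_closed[OF K] by (simp add: is_ideal_def)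
next
  interpret nonunital_ring "class_ring :: 'a ring" by (rule nonunital_ring_class_ring)
  assume K: "is_ideal K"
  have uminus: "a_inv (class_ring :: 'a ring) x = - x" for x :: 'a
    by (simp add: class_ring_simps)
  show "left_ideal K (class_ring :: 'a ring)"
    by (rule left_idealI)
       (use K in \<open>auto simp: uminus is_ideal_0 is_ideal_add is_ideal_mult is_ideal_uminus\<close>)
qed

lemma is_ideal_principal: "is_ideal (range (\<lambda>s. c * s))"
proof -
  have "c * x + c * y \<in> range (\<lambda>s. c * s)" "a * (c * x) \<in> range (\<lambda>s. c * s)" for a x y
    by (metis distrib_left rangeI) (metis mult.left_commute rangeI)
  moreover have "0 \<in> range (\<lambda>s. c * s)" by (metis mult_zero_right rangeI)
  ultimately show ?thesis unfolding is_ideal_def by blast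
qed

text \<open>The extended ideal K[t, t^-1]; the constants in it are exactly K.\<close>

definition laurent_ext :: "'r::comm_ring_1 set \<Rightarrow> 'r laurent set" where
  "laurent_ext K = {s. \<forall>k. Poly_Mapping.lookup s k \<in> K}"

lemma is_ideal_laurent_ext:
  assumes "is_ideal K"
  shows "is_ideal (laurent_ext K)"
proof -
  have "a * x \<in> laurent_ext K" if "x \<in> laurent_ext K" for a x
    using that
    by (induction a rule: poly_mapping_additive_induct)
       (use assms in \<open>auto simp: laurent_ext_def lookup_single_times is_ideal_mult is_ideal_add
          lookup_add distrib_right\<close>)
  then show ?thesis
    using assms unfolding is_ideal_def by (auto simp: laurent_ext_def lookup_add)
qed

section \<open>Necessary conditions\<close>

fun prefix_seq :: "'e list \<Rightarrow> (nat \<Rightarrow> 'e option) \<Rightarrow> nat \<Rightarrow> 'e option" where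
  "prefix_seq [] s = s"
| "prefix_seq (e # q) s = case_nat (Some e) (prefix_seq q s)"

lemma prefix_seq_nth: "prefix_seq q s n = (if n < length q then Some (q ! n) else s (n - length q))"
  by (induction q arbitrary: n) (auto split: nat.split)

definition cyc :: "'e list \<Rightarrow> nat \<Rightarrow> 'e option" where
  "cyc c n = Some (c ! (n mod length c))"

lemma prefix_seq_cyc [simp]: "prefix_seq c (cyc c) = cyc c"
  by (auto simp: fun_eq_iff prefix_seq_nth cyc_def le_mod_geq)

context lpa_graph
begin

lemma bpath_prefix_seq:
  assumes "awalk u q w" "bpath w s"
  shows "bpath u (prefix_seq q s)"
  using assms
proof (induction q arbitrary: u)
  case Nil
  then show ?case by (simp add: awalk_Nil_iff)
next
  case (Cons e q)
  then have "e \<in> arcs E" "tail E e = u" "awalk (head E e) q w" by (auto simp: awalk_Cons_iff)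
  with Cons show ?case by - (rule bpath.step[of e], simp_all)
qed

text \<open>The coinduction runs over all points consisting of a walk q to v followed by
  c^\<infinity>; when q is used up, another copy of c is unfolded.\<close>

lemma bpath_cyc:
  assumes "awalk v c v" "c \<noteq> []"
  shows "bpath v (cyc c)"
proof -
  have "bpath u s" if "\<exists>q. awalk u q v \<and> s = prefix_seq q (cyc c)" for u s
    using that
  proof (coinduction arbitrary: u s)
    case bpath
    then obtain q where q: "awalk u q v" "s = prefix_seq q (cyc c)" by auto
    obtain e q' where q': "awalk u (e # q') v" "s = prefix_seq (e # q') (cyc c)"
    proof (cases q)
      case Nil
      obtain e q' where "c = e # q'" using assms(2) by (cases c) auto
      then show ?thesis
        using q Nil assms(1) that[of e q'] by (metis awalk_Nil_iff prefix_seq.simps(1) prefix_seq_cyc)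
    next
      case (Cons e q')
      then show ?thesis using q that by auto
    qed
    then have "e \<in> arcs E" "s 0 = Some e" "tail E e = u" "awalk (head E e) q' v"
      "s \<circ> Suc = prefix_seq q' (cyc c)"
      by (auto simp: awalk_Cons_iff fun_eq_iff)
    then show ?case by blast
  qed
  moreover have "awalk v [] v" using assms(1) by (auto simp: awalk_Nil_iff)
  ultimately show ?thesis by (metis prefix_seq.simps(1))
qed

end

section \<open>Left ideals obtained from ideals of the coefficient ring\<close>

context bpath_rep
begin

definition wts :: "'e list \<Rightarrow> int" where
  "wts q = (\<Sum>e\<leftarrow>q. wt e)"

lemma app_scale_fun: "app \<psi> (\<lambda>x. c * y x) = (\<lambda>x. c * app \<psi> y x)"
  by (simp add: fun_eq_iff app_scale)

lemma app_pe:
  assumes "awalk u q w" "bpath w s"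
  shows "app (pe q) y (u, prefix_seq q s) = mono_t (wts q) * (y (w, s) :: 'r::comm_ring_1 laurent)"
  using assms
proof (induction q arbitrary: u)
  case Nil
  then show ?case by (simp add: pe_def wts_def awalk_Nil_iff)
next
  case (Cons e q)
  then have e: "e \<in> arcs E" "tail E e = u" "awalk (head E e) q w" by (auto simp: awalk_Cons_iff)
  have "bpath u (prefix_seq (e # q) s)"
    using bpath_prefix_seq[OF Cons.prems] .
  then have "app (pe (e # q)) y (u, prefix_seq (e # q) s) =
      mono_t (wt e) * app (pe q) y (head E e, prefix_seq q s)"
    by (simp add: pe_def uncons_def)
  then show ?case
    using Cons.IH[OF e(3) Cons.prems(2)] by (simp add: wts_def mono_t_mult mult.assoc[symmetric])
qed

lemma act_Edge_delta:
  assumes "e \<in> arcs E" "bpath (head E e) s"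
  shows "app (act (Edge e)) (delta (head E e, s)) =
    (\<lambda>x. mono_t (wt e) * (delta (tail E e, case_nat (Some e) s) x :: 'r::comm_ring_1 laurent))"
proof
  fix x :: "('v, 'e) bpoint"
  show "app (act (Edge e)) (delta (head E e, s)) x =
      mono_t (wt e) * (delta (tail E e, case_nat (Some e) s) x :: 'r laurent)"
  proof (cases "bpt x \<and> snd x 0 = Some e")
    case True
    then have "cons e (uncons x) = x" using bpt_SomeD[of x e] cons_uncons[of x e] by simp
    moreover have "uncons (cons e (head E e, s)) = (head E e, s)" by (simp add: uncons_cons)
    ultimately have "uncons x = (head E e, s) \<longleftrightarrow> x = (tail E e, case_nat (Some e) s)"
      by (metis cons_def snd_conv)
    then show ?thesis unfolding act.simps app_pull if_P[OF True] by simp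
  next
    case False
    moreover have "bpt (tail E e, case_nat (Some e) s)"
      using bpath_cons[of e "(head E e, s)"] assms by (simp add: cons_def)
    ultimately have "x \<noteq> (tail E e, case_nat (Some e) s)" by auto
    then show ?thesis unfolding act.simps app_pull if_not_P[OF False] by simp
  qed
qed

text \<open>A path q moves the indicator of x to that of q x, up to its weight. Whereas
  \<open>app_pe\<close> gives the value at one point for every function, this gives all values for
  an indicator; arguments with cycles use both sides.\<close>

lemma pe_delta:
  assumes "awalk u q w" "bpath w s"
  shows "app (pe q) (delta (w, s)) = (\<lambda>x. mono_t (wts q) * (delta (u, prefix_seq q s) x :: 'r::comm_ring_1 laurent))"
  using assms
proof (induction q arbitrary: u)
  case Nil
  then show ?case by (simp add: pe_def wts_def awalk_Nil_iff)
next
  case (Cons e q)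
  then have e: "e \<in> arcs E" "tail E e = u" "awalk (head E e) q w" by (auto simp: awalk_Cons_iff)
  have "app (pe (e # q)) (delta (w, s)) = app (act (Edge e)) (app (pe q) (delta (w, s) :: _ \<Rightarrow> 'r laurent))"
    by (simp add: pe_def)
  also have "\<dots> = (\<lambda>x. mono_t (wts q) * app (act (Edge e)) (delta (head E e, prefix_seq q s)) x)"
    by (simp only: Cons.IH[OF e(3) Cons.prems(2)] app_scale_fun)
  also have "\<dots> = (\<lambda>x. mono_t (wts q) * (mono_t (wt e) * delta (tail E e, case_nat (Some e) (prefix_seq q s)) x))"
    by (simp only: act_Edge_delta[OF e(1) bpath_prefix_seq[OF e(3) Cons.prems(2)]])
  finally show ?case
    by (simp only: e(2) wts_def mono_t_mult mult.assoc[symmetric] prefix_seq.simps list.map sum_list.Cons add.commute)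
qed

text \<open>Generators only move values between points, multiply them by scalars or replace them by
  0; so the functions with values in an ideal form a submodule.\<close>

lemma preserves_ideal_values:
  assumes "is_ideal K" "\<And>x. y x \<in> K"
  shows "app (\<rho> f) y x \<in> K"
proof -
  have gen: "app (act g) y x \<in> K" if "\<And>x. y x \<in> K" for g y x
    using that assms(1) by (cases g) (auto simp: is_ideal_mult is_ideal_0)
  have word: "app (prod_list (map act ws)) y x \<in> K" for ws x
    by (induction ws arbitrary: x) (auto simp: assms(2) gen)
  show ?thesis
    by (induction f arbitrary: x rule: poly_mapping_additive_induct)
       (use word assms(1) in \<open>auto simp: ev_single app_scal is_ideal_mult is_ideal_add\<close>)
qed

text \<open>The operators sending one fixed function into a submodule form a left ideal.\<close>

lemma left_ideal_ideal_values:
  fixes K :: "'r::comm_ring_1 laurent set"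
  assumes "is_ideal K"
  shows "left_ideal {\<psi> \<in> \<rho> ` F. \<forall>x. app \<psi> (delta a) x \<in> K} Im"
proof -
  interpret nonunital_ring Im by (rule nonunital_ring_Im)
  have uminus: "a_inv Im \<psi> = - \<psi>" if "\<psi> \<in> \<rho> ` F" for \<psi>
    using that by (intro minus_equality) (simp_all add: \<rho>_closed(4))
  show ?thesis
  proof (rule left_idealI)
    fix b \<psi> :: "(('v, 'e) bpoint, 'r laurent) lin"
    assume b: "b \<in> carrier Im" and \<psi>: "\<psi> \<in> {\<psi> \<in> \<rho> ` F. \<forall>x. app \<psi> (delta a) x \<in> K}"
    obtain f where f: "b = \<rho> f" using b by auto
    have "b * \<psi> \<in> \<rho> ` F"
      using b \<psi> \<rho>_closed(3)[of b \<psi>] by simp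
    moreover have "app \<psi> (delta a) x \<in> K" for x
      using \<psi> by blast
    then have "app (b * \<psi>) (delta a) x \<in> K" for x
      unfolding f app_simps by (rule preserves_ideal_values[OF assms])
    ultimately show "b \<otimes>\<^bsub>Im\<^esub> \<psi> \<in> {\<psi> \<in> \<rho> ` F. \<forall>x. app \<psi> (delta a) x \<in> K}" by simp
  qed (use assms in \<open>simp_all add: uminus is_ideal_0 is_ideal_add is_ideal_uminus \<rho>_closed Collect_restrict\<close>)
qed

lemma scaled_delta_values:
  assumes "0 \<in> K"
  shows "(\<forall>x. c * delta a x \<in> K) \<longleftrightarrow> c \<in> K"
proof (intro iffI allI)
  assume "\<forall>x. c * delta a x \<in> K"
  from this[rule_format, of a] show "c \<in> K" by simp
next
  fix x assume "c \<in> K"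
  then show "c * delta a x \<in> K"
    using assms by (cases "x = a") simp_all
qed

lemma scal_vert_delta:
  assumes "bpt a"
  shows "app (scal r * act (Vert (fst a))) (delta a) = (\<lambda>x. Poly_Mapping.single 0 r * delta a x)"
  using assms by (auto simp: app_scal fun_eq_iff)

lemma scal_vert_Im: "v \<in> verts E \<Longrightarrow> scal r * act (Vert v) \<in> \<rho> ` F"
  by (intro \<rho>_closed \<rho>_gens) simp

lemma ideal_values_scal_vert:
  assumes "bpt a" "is_ideal K"
  shows "scal r * act (Vert (fst a)) \<in> {\<psi> \<in> \<rho> ` F. \<forall>x. app \<psi> (delta a) x \<in> laurent_ext K} \<longleftrightarrow> r \<in> K"
proof -
  have "Poly_Mapping.single 0 r \<in> laurent_ext K \<longleftrightarrow> r \<in> K"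
    using is_ideal_0[OF assms(2)] by (auto simp: laurent_ext_def lookup_single when_def)
  moreover have "scal r * act (Vert (fst a)) \<in> \<rho> ` F"
    using bpt_vert[OF assms(1)] by (rule scal_vert_Im)
  moreover have "(\<forall>x. app (scal r * act (Vert (fst a))) (delta a) x \<in> laurent_ext K) \<longleftrightarrow>
      Poly_Mapping.single 0 r \<in> laurent_ext K"
    unfolding scal_vert_delta[OF assms(1)]
    by (rule scaled_delta_values) (rule is_ideal_0[OF is_ideal_laurent_ext[OF assms(2)]])
  ultimately show ?thesis
    by blast
qed

text \<open>An ideal K of scalars goes to the left ideal of operators whose values on one indicator
  have coefficients in K. This is monotone, and K is recovered from it: r is in K iff r v is in the
  left ideal.\<close>

lemma scalars_chain_conditions:
  assumes "verts E \<noteq> {}"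
  shows "left_noetherian (L :: ('r::comm_ring_1, _) module) \<Longrightarrow> left_noetherian (class_ring :: 'r ring)"
    and "left_artinian (L :: ('r::comm_ring_1, _) module) \<Longrightarrow> left_artinian (class_ring :: 'r ring)"
proof -
  obtain v where "v \<in> verts E" using assms by auto
  then obtain s where "bpath v s" using bpath_exists by blast
  then have a: "bpt (v, s)" by simp
  define J where "J K = {\<psi> \<in> \<rho> ` F. \<forall>x. app \<psi> (delta (v, s)) x \<in> laurent_ext K}" for K :: "'r set"
  have J: "left_ideal (J K) Im" if "is_ideal K" for K
    unfolding J_def using that by (intro left_ideal_ideal_values is_ideal_laurent_ext)
  have mem: "scal r * act (Vert v) \<in> J K \<longleftrightarrow> r \<in> K" if "is_ideal K" for r K
    using ideal_values_scal_vert[OF a that] by (simp add: J_def)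
  have mono: "J K \<subseteq> J K'" if "K \<subseteq> K'" for K K'
    using that by (auto simp: J_def laurent_ext_def)
  have eq: "K = K'" if "is_ideal K" "is_ideal K'" "J K = J K'" for K K'
    using mem[OF that(1)] mem[OF that(2)] that(3) by blast
  show "left_noetherian (class_ring :: 'r ring)" if noeth: "left_noetherian (L :: ('r, _) module)"
    unfolding left_noetherian_def
  proof (intro allI impI, elim conjE)
    fix I :: "nat \<Rightarrow> 'r set" assume I: "\<forall>n. left_ideal (I n) class_ring" "\<forall>n. I n \<subseteq> I (Suc n)"
    then have ideal: "is_ideal (I n)" for n by (simp add: left_ideal_class_ring_iff)
    obtain N where N: "\<And>n. n \<ge> N \<Longrightarrow> J (I n) = J (I N)"
    proof (rule left_noetherianD[OF Im_chain_conditions(1)[OF noeth]])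
      show "left_ideal (J (I n)) Im" for n by (rule J[OF ideal])
      show "J (I n) \<subseteq> J (I (Suc n))" for n by (rule mono) (use I(2) in auto)
    qed (rule that)
    show "\<exists>N. \<forall>n\<ge>N. I n = I N"
      using eq[OF ideal ideal N] by blast
  qed
  show "left_artinian (class_ring :: 'r ring)" if art: "left_artinian (L :: ('r, _) module)"
    unfolding left_artinian_def
  proof (intro allI impI, elim conjE)
    fix I :: "nat \<Rightarrow> 'r set" assume I: "\<forall>n. left_ideal (I n) class_ring" "\<forall>n. I (Suc n) \<subseteq> I n"
    then have ideal: "is_ideal (I n)" for n by (simp add: left_ideal_class_ring_iff)
    obtain N where N: "\<And>n. n \<ge> N \<Longrightarrow> J (I n) = J (I N)"
    proof (rule left_artinianD[OF Im_chain_conditions(2)[OF art]])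
      show "left_ideal (J (I n)) Im" for n by (rule J[OF ideal])
      show "J (I (Suc n)) \<subseteq> J (I n)" for n by (rule mono) (use I(2) in auto)
    qed (rule that)
    show "\<exists>N. \<forall>n\<ge>N. I n = I N"
      using eq[OF ideal ideal N] by blast
  qed
qed

lemma semisimple_imp_regular_image:
  assumes "semisimple_ring (L :: ('r::comm_ring_1, _) module)" "\<psi> \<in> \<rho> ` F"
  obtains \<chi> :: "(('v, 'e) bpoint, 'r::comm_ring_1 laurent) lin" where "\<psi> * (\<chi> * \<psi>) = \<psi>"
proof -
  interpret L: nonunital_ring "L :: ('r, _) module" by (rule nonunital_ring_L)
  obtain f where f: "f \<in> F" "\<psi> = \<rho> f" using assms(2) by auto
  obtain b where b: "b \<in> carrier L" "proj f \<otimes>\<^bsub>L\<^esub> (b \<otimes>\<^bsub>L\<^esub> proj f) = proj f"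
    using L.semisimple_imp_von_Neumann_regular[OF assms(1), of "proj f"] f by (auto simp: L_sel(1))
  then obtain g where g: "g \<in> F" "b = proj g" by (auto simp: L_sel(1))
  then have "proj (f * (g * f)) = proj f" using b f by simp
  then have "\<rho> (f * (g * f)) = \<rho> f" using f g by (intro \<rho>_proj_eq) auto
  then show ?thesis using that[of "\<rho> g"] f by simp
qed

text \<open>Regularity of the element r v, read at one point with vertex v: comparing constant
  coefficients in r v = (r v) \<chi> (r v) gives an equation in the scalars.\<close>

lemma semisimple_imp_regular_scalars:
  assumes "verts E \<noteq> {}" "semisimple_ring (L :: ('r::comm_ring_1, _) module)"
  shows "\<exists>s. r * (r * s) = (r :: 'r::comm_ring_1)"
proof -
  obtain v where v: "v \<in> verts E" using assms by auto
  then obtain s where "bpath v s" using bpath_exists by blast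
  then have a: "bpt (v, s)" by simp
  obtain \<chi> where \<chi>: "(scal r * act (Vert v)) * (\<chi> * (scal r * act (Vert v))) = scal r * act (Vert v)"
    using semisimple_imp_regular_image[OF assms(2) scal_vert_Im[OF v]] .
  define y where "y = app (scal r * act (Vert v)) (delta (v, s))"
  have y: "y = (\<lambda>x. Poly_Mapping.single 0 r * delta (v, s) x)"
    using scal_vert_delta[OF a, of r] by (simp add: y_def)
  have "y (v, s) = app (scal r * act (Vert v)) (app \<chi> y) (v, s)"
    unfolding y_def by (subst \<chi>[symmetric]) simp
  also have "\<dots> = Poly_Mapping.single 0 r * (Poly_Mapping.single 0 r * app \<chi> (delta (v, s)) (v, s))"
    using a by (simp add: app_scal) (simp add: y app_scale)
  finally have "Poly_Mapping.lookup (y (v, s)) 0 =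
    Poly_Mapping.lookup (Poly_Mapping.single 0 r * (Poly_Mapping.single 0 r * app \<chi> (delta (v, s)) (v, s))) 0"
    by simp
  then have "r * (r * Poly_Mapping.lookup (app \<chi> (delta (v, s)) (v, s)) 0) = r"
    by (simp add: lookup_single_times y)
  then show ?thesis by blast
qed

end

text \<open>Being a cycle is defined by distinct heads; on a closed walk the sequence of tails is
  the sequence of heads rotated by one place.\<close>

lemma (in wf_digraph) cycle_tails_distinct:
  assumes "awalk u p u" "distinct (tl (awalk_verts u p))" "p \<noteq> []"
  shows "distinct (map (tail G) p)"
proof -
  have cas: "cas u p u" using assms(1) by auto
  have 1: "awalk_verts u p = u # map (head G) p"
    using awalk_verts_conv'[OF cas] assms(3) cas by (cases p) auto
  have 2: "awalk_verts u p = map (tail G) p @ [head G (last p)]"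
    using assms(3) by (simp add: awalk_verts_conv)
  have "last (awalk_verts u p) = u" using cas awlast_if_cas by auto
  then have last: "last (map (head G) p) = u" using 1 assms(3) by simp
  have "map (tail G) p = butlast (u # map (head G) p)" using 1 2 by (metis butlast_snoc)
  also have "\<dots> = u # butlast (map (head G) p)" using assms(3) by simp
  finally have *: "map (tail G) p = u # butlast (map (head G) p)" .
  have "map (head G) p = butlast (map (head G) p) @ [u]"
    using last assms(3) by (metis append_butlast_last_id list.map_disc_iff)
  moreover have "distinct (map (head G) p)" using assms(2) 1 by simp
  ultimately have "distinct (butlast (map (head G) p) @ [u])" by metis
  then show ?thesis unfolding * by simp
qed

context bpath_rep
begin

lemma wts_single:
  assumes "distinct (map (tail E) q)" "tail E ` set q \<inter> W = {w}"
  shows "wts q = 1"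
proof -
  have "w \<in> tail E ` set q \<inter> W" using assms(2) by simp
  then obtain e where e: "e \<in> set q" "tail E e = w" "w \<in> W" by auto
  have "wts q = (\<Sum>e'\<in>set q. wt e')"
    unfolding wts_def using assms(1) by (simp add: sum_list_distinct_conv_sum_set distinct_map)
  also have "\<dots> = (\<Sum>e'\<in>set q. if e' = e then 1 else 0)"
  proof (rule sum.cong)
    fix e' assume "e' \<in> set q"
    then have "tail E e' \<in> W \<longleftrightarrow> e' = e"
      using e assms by (auto simp: distinct_map inj_on_def)
    then show "wt e' = (if e' = e then 1 else 0)" by (simp add: wt_def)
  qed simp
  finally show ?thesis using e by simp
qed

end

context lpa_graph
begin

text \<open>
  For a cycle \<open>c\<close> based at \<open>v\<close>, weighted so that \<open>c\<close> acts as \<open>t\<close> on the point \<open>c\<^sup>\<infinity>\<close>, the powers of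
  \<open>v - c\<close> distinguish the left ideals belonging to the ideals generated by \<open>(1 - t)\<^sup>n\<close>.
\<close>

lemma cycle_imp_not_artinian_semisimple:
  assumes "cycle p"
  shows "\<not> left_artinian (L :: ('r::comm_ring_1, _) module)" "\<not> semisimple_ring (L :: ('r::comm_ring_1, _) module)"
proof -
  obtain v where p: "awalk v p v" "distinct (tl (awalk_verts v p))" "p \<noteq> []"
    using assms by (auto simp: cycle_def)
  interpret bpath_rep E "{v}" ..
  have v: "v \<in> verts E" using p(1) by auto
  have "v \<in> tail E ` set p" using p by (cases p) (auto simp: awalk_Cons_iff)
  then have wts: "wts p = 1"
    using cycle_tails_distinct[OF p] by (intro wts_single[of _ v]) auto
  define a where "a = (v, cyc p)"
  have bp: "bpath v (cyc p)" using bpath_cyc p by auto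
  define X :: "(('v, 'e) bpoint, 'r laurent) lin" where "X = act (Vert v) - pe p"
  have X_Im: "X \<in> \<rho> ` F"
    unfolding X_def using p v by (intro \<rho>_closed \<rho>_gens pe_closed) auto
  \<comment> \<open>X acts as 1 - t on the left, when values at a are read, and on the right, when
    it is applied to the indicator of a. So X \<chi> X = X becomes 1 - t = (1 - t)^2 s with s the
    diagonal entry of \<chi> at a.\<close>
  have X_val: "app X y a = (1 - mono_t 1) * y a" for y
    using app_pe[OF p(1) bp, of y] bp by (simp add: X_def a_def wts left_diff_distrib)
  have X_delta: "app X (delta a) = (\<lambda>x. (1 - mono_t 1) * delta a x)"
  proof -
    have "app (pe p) (delta a) = (\<lambda>x. mono_t 1 * (delta a x :: 'r laurent))"
      using pe_delta[OF p(1) bp] by (simp only: wts prefix_seq_cyc a_def)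
    moreover have "app (act (Vert v)) (delta a) = (delta a :: _ \<Rightarrow> 'r laurent)"
    proof
      fix x show "app (act (Vert v)) (delta a) x = (delta a x :: 'r laurent)"
        by (cases "x = a") (use bp in \<open>simp_all add: a_def\<close>)
    qed
    ultimately show ?thesis by (simp only: X_def app_simps left_diff_distrib mult_1)
  qed
  have X_pow: "app (X ^ n) (delta a) = (\<lambda>x. (1 - mono_t 1) ^ n * delta a x)" for n
  proof (induction n)
    case (Suc n)
    have "app (X ^ Suc n) (delta a) = app X (app (X ^ n) (delta a))" by simp
    also have "\<dots> = (\<lambda>x. (1 - mono_t 1) ^ n * ((1 - mono_t 1) * delta a x))"
      by (simp only: Suc app_scale_fun X_delta)
    finally show ?case by (simp only: power_Suc2 mult.assoc)
  qed simp
  show "\<not> semisimple_ring (L :: ('r, _) module)"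
  proof
    assume "semisimple_ring (L :: ('r, _) module)"
    then obtain \<chi> :: "(('v, 'e) bpoint, 'r laurent) lin" where "X * (\<chi> * X) = X"
      using semisimple_imp_regular_image X_Im by blast
    then have "app (X * (\<chi> * X)) (delta a) a = app X (delta a) a" by simp
    also have "\<dots> = 1 - mono_t 1" by (simp add: X_delta)
    also have "app (X * (\<chi> * X)) (delta a) a = (1 - mono_t 1) * ((1 - mono_t 1) * app \<chi> (delta a) a)"
      by (simp only: app_simps X_val) (simp only: X_delta app_scale)
    finally show False
      using one_minus_t_power[of 1 "app \<chi> (delta a) a"] by (simp add: mult.assoc)
  qed
  define K where "K n = range (\<lambda>s :: 'r laurent. (1 - mono_t 1) ^ n * s)" for n
  have K: "is_ideal (K n)" for n
    unfolding K_def by (rule is_ideal_principal)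
  define J where "J n = {\<psi> \<in> \<rho> ` F. \<forall>x. app \<psi> (delta a) x \<in> K n}" for n
  \<comment> \<open>Only positive powers are used: \<open>X ^ 0\<close> is the identity operator,
    which need not come from an element of \<open>F\<close>.\<close>
  have mem: "X ^ Suc m \<in> J n \<longleftrightarrow> (1 - mono_t 1) ^ Suc m \<in> K n" for m n
  proof -
    have "X ^ Suc m \<in> \<rho> ` F" for m
      by (induction m) (use X_Im \<rho>_closed(3) in auto)
    moreover have "(\<forall>x. app (X ^ Suc m) (delta a) x \<in> K n) \<longleftrightarrow> (1 - mono_t 1) ^ Suc m \<in> K n"
      unfolding X_pow by (rule scaled_delta_values) (rule is_ideal_0[OF K])
    ultimately show ?thesis unfolding J_def by blast
  qed
  show "\<not> left_artinian (L :: ('r, _) module)"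
  proof
    assume art: "left_artinian (L :: ('r, _) module)"
    obtain N where N: "\<And>n. n \<ge> N \<Longrightarrow> J n = J N"
    proof (rule left_artinianD[OF Im_chain_conditions(2)[OF art]])
      show "left_ideal (J n) Im" for n
        unfolding J_def by (rule left_ideal_ideal_values[OF K])
      have "K (Suc n) \<subseteq> K n" for n
        unfolding K_def by (auto simp: mult.assoc power_Suc2 simp del: power_Suc)
      then show "J (Suc n) \<subseteq> J n" for n
        unfolding J_def by blast
    qed (rule that)
    have "X ^ Suc N \<in> J (Suc N)"
      unfolding mem by (auto simp: K_def intro: range_eqI[of _ _ 1])
    then have "X ^ Suc N \<in> J (Suc (Suc N))"
      using N[of "Suc N"] N[of "Suc (Suc N)"] by simp
    then show False
      unfolding mem using one_minus_t_power[of "Suc N"] by (auto simp: K_def simp del: power_Suc)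
  qed
qed

end

section \<open>Products of rings\<close>

lemma RDirProd_list_carrier_iff:
  "as \<in> carrier (RDirProd_list Rs) \<longleftrightarrow> length as = length Rs \<and> (\<forall>i<length Rs. as ! i \<in> carrier (Rs ! i))"
  using RDirProd_list_carrier_mem RDirProd_list_carrier_memI by blast

lemma RDirProd_list_ops:
  assumes "as \<in> carrier (RDirProd_list Rs)" "bs \<in> carrier (RDirProd_list Rs)"
  shows "as \<otimes>\<^bsub>RDirProd_list Rs\<^esub> bs = map (\<lambda>i. as ! i \<otimes>\<^bsub>Rs ! i\<^esub> bs ! i) [0..<length Rs]"
    and "as \<oplus>\<^bsub>RDirProd_list Rs\<^esub> bs = map (\<lambda>i. as ! i \<oplus>\<^bsub>Rs ! i\<^esub> bs ! i) [0..<length Rs]"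
  using assms
proof (induction Rs arbitrary: as bs)
  case Nil
  { case 1 then show ?case by (auto simp: monoid.defs) }
  { case 2 then show ?case by (auto simp: monoid.defs) }
next
  case (Cons R Rs)
  have upt: "map f [0..<length (R # Rs)] = f 0 # map (\<lambda>i. f (Suc i)) [0..<length Rs]" for f :: "nat \<Rightarrow> 'a"
    by (simp add: upt_rec[of 0 "Suc _"] map_Suc_upt[symmetric] del: upt_Suc)
  have hom: "(\<lambda>(a, as). a # as) \<in> Ring.ring_hom (RDirProd R (RDirProd_list Rs)) (RDirProd_list (R # Rs))"
    by (rule RDirProd_list_hom1)
  { case 1
    then obtain a as' b bs' where *: "as = a # as'" "bs = b # bs'" "a \<in> carrier R" "b \<in> carrier R"
      "as' \<in> carrier (RDirProd_list Rs)" "bs' \<in> carrier (RDirProd_list Rs)"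
      unfolding RDirProd_list_carrier by auto
    have "as \<otimes>\<^bsub>RDirProd_list (R # Rs)\<^esub> bs = (a \<otimes>\<^bsub>R\<^esub> b) # (as' \<otimes>\<^bsub>RDirProd_list Rs\<^esub> bs')"
      using ring_hom_mult[OF hom, of "(a, as')" "(b, bs')"] *
      by (simp add: RDirProd_carrier) (simp add: RDirProd_def DirProd_def monoid.defs)
    then show ?case unfolding upt using Cons.IH(1) * by simp }
  { case 2
    then obtain a as' b bs' where *: "as = a # as'" "bs = b # bs'" "a \<in> carrier R" "b \<in> carrier R"
      "as' \<in> carrier (RDirProd_list Rs)" "bs' \<in> carrier (RDirProd_list Rs)"
      unfolding RDirProd_list_carrier by auto
    have "as \<oplus>\<^bsub>RDirProd_list (R # Rs)\<^esub> bs = (a \<oplus>\<^bsub>R\<^esub> b) # (as' \<oplus>\<^bsub>RDirProd_list Rs\<^esub> bs')"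
      using ring_hom_add[OF hom, of "(a, as')" "(b, bs')"] *
      by (simp add: RDirProd_carrier) (simp add: RDirProd_def DirProd_def monoid.defs)
    then show ?case unfolding upt using Cons.IH(2) * by simp }
qed

lemma RDirProd_list_nth:
  assumes "as \<in> carrier (RDirProd_list Rs)" "bs \<in> carrier (RDirProd_list Rs)" "i < length Rs"
  shows "(as \<otimes>\<^bsub>RDirProd_list Rs\<^esub> bs) ! i = as ! i \<otimes>\<^bsub>Rs ! i\<^esub> bs ! i"
    and "(as \<oplus>\<^bsub>RDirProd_list Rs\<^esub> bs) ! i = as ! i \<oplus>\<^bsub>Rs ! i\<^esub> bs ! i"
  using assms by (simp_all add: RDirProd_list_ops)

lemma RDirProd_list_one_map: "\<one>\<^bsub>RDirProd_list Rs\<^esub> = map one Rs"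
  unfolding RDirProd_list_one by (induction Rs) auto

section \<open>Noetherian von Neumann regular rings\<close>

definition primitive_idem :: "'a::comm_ring_1 \<Rightarrow> bool" where
  "primitive_idem e \<longleftrightarrow> e \<noteq> 0 \<and> e * e = e \<and> (\<forall>f. f * f = f \<and> f * e = f \<longrightarrow> f = 0 \<or> f = e)"

text \<open>A strictly descending sequence of idempotents has ascending annihilators, and they are
  all different: 1 - e' kills the smaller idempotent e' but sends the larger e to e - e'.\<close>

lemma wf_idempotents:
  assumes "left_noetherian (class_ring :: 'a::comm_ring_1 ring)"
  shows "wf {(f, e :: 'a). f * f = f \<and> e * e = e \<and> f * e = f \<and> f \<noteq> e}"
proof (rule ccontr)
  assume "\<not> ?thesis"
  then obtain e :: "nat \<Rightarrow> 'a" where e: "e (Suc n) * e (Suc n) = e (Suc n)" "e n * e n = e n"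
    "e (Suc n) * e n = e (Suc n)" "e (Suc n) \<noteq> e n" for n
    unfolding wf_iff_no_infinite_down_chain by auto
  obtain N where N: "\<And>n. n \<ge> N \<Longrightarrow> {x. x * e n = 0} = {x. x * e N = 0}"
  proof (rule left_noetherianD[OF assms])
    show "left_ideal {x. x * e n = 0} class_ring" for n
      unfolding left_ideal_class_ring_iff is_ideal_def by (simp add: distrib_right mult.assoc)
    show "{x. x * e n = 0} \<subseteq> {x. x * e (Suc n) = 0}" for n
      by (auto, metis e(3) mult.assoc mult.commute mult_zero_left)
  qed (rule that)
  have "1 - e (Suc N) \<in> {x. x * e (Suc N) = 0}"
    by (simp add: left_diff_distrib e)
  then have "(1 - e (Suc N)) * e N = 0" unfolding N[OF le_SucI[OF order_refl]] by simp
  then show False using e(3,4)[of N] by (simp add: left_diff_distrib)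
qed

text \<open>An idempotent that is neither zero nor primitive splits as f + (e - f) into orthogonal
  smaller ones, and well-foundedness stops the splitting.\<close>

lemma primitive_idempotent_decomposition:
  assumes "left_noetherian (class_ring :: 'a::comm_ring_1 ring)" "e * e = (e :: 'a)"
  shows "\<exists>es. (\<forall>x\<in>set es. primitive_idem x \<and> x * e = x) \<and> sorted_wrt (\<lambda>x y. x * y = 0) es \<and> sum_list es = e"
  using wf_idempotents[OF assms(1)] assms(2)
proof (induction e)
  case (less e)
  consider "e = 0" | "primitive_idem e" | f where "f * f = f" "f * e = f" "f \<noteq> 0" "f \<noteq> e"
    using less.prems unfolding primitive_idem_def by blast
  then show ?case
  proof cases
    case 1
    then show ?thesis by (intro exI[of _ "[]"]) simp
  next
    case 2
    then show ?thesis by (intro exI[of _ "[e]"]) (simp add: primitive_idem_def)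
  next
    case (3 f)
    have ef: "e * f = f" using 3 by (simp add: mult.commute)
    have "(e - f) * (e - f) = e - f" "(e - f) * e = e - f" "e - f \<noteq> e"
      using 3 less.prems ef by (simp_all add: algebra_simps)
    then obtain es fs where es: "\<forall>x\<in>set es. primitive_idem x \<and> x * (e - f) = x"
        "sorted_wrt (\<lambda>x y. x * y = 0) es" "sum_list es = e - f"
      and fs: "\<forall>x\<in>set fs. primitive_idem x \<and> x * f = x" "sorted_wrt (\<lambda>x y. x * y = 0) fs" "sum_list fs = f"
      using less.IH[of "e - f"] less.IH[of f] 3 less.prems by auto
    have mult_e: "x * e = x" if "x * (e - f) = x \<or> x * f = x" for x
      using that 3 less.prems ef by (metis \<open>(e - f) * e = e - f\<close> mult.assoc)
    have "x * y = 0" if "x \<in> set es" "y \<in> set fs" for x y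
    proof -
      have "x * y = (x * (e - f)) * (y * f)" using that es fs by simp
      also have "\<dots> = x * y * ((e - f) * f)" by (simp only: mult_ac)
      also have "(e - f) * f = 0" using 3 ef by (simp add: algebra_simps)
      finally show ?thesis by simp
    qed
    then show ?thesis
      using es fs mult_e by (intro exI[of _ "es @ fs"]) (auto simp: sorted_wrt_append)
  qed
qed

definition corner :: "'a::comm_ring_1 \<Rightarrow> 'a ring" where
  "corner e = \<lparr>carrier = {x. x * e = x}, mult = (*), one = e, zero = 0, add = (+)\<rparr>"

text \<open>From a (a s) = a it follows that a s is a nonzero idempotent below e, hence equal to e
  by primitivity; cut down to the corner, s e is the inverse of a.\<close>

lemma field_corner:
  fixes e :: "'a::comm_ring_1"
  assumes "primitive_idem e" and vnr: "\<And>r :: 'a. \<exists>s. r * (r * s) = r"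
  shows "field (corner e)"
proof -
  have e: "e \<noteq> 0" "e * e = e" "\<And>f. f * f = f \<Longrightarrow> f * e = f \<Longrightarrow> f = 0 \<or> f = e"
    using assms(1) by (auto simp: primitive_idem_def)
  have "cring (corner e)"
  proof (rule cringI)
    show "abelian_group (corner e)"
    proof (rule abelian_groupI)
      fix x assume "x \<in> carrier (corner e)"
      then show "\<exists>y\<in>carrier (corner e). y \<oplus>\<^bsub>corner e\<^esub> x = \<zero>\<^bsub>corner e\<^esub>"
        by (intro bexI[of _ "- x"]) (auto simp: corner_def)
    qed (auto simp: corner_def algebra_simps)
    show "comm_monoid (corner e)"
      by (rule comm_monoidI) (auto simp: corner_def mult.assoc e, simp_all add: mult.commute)
  qed (auto simp: corner_def algebra_simps)
  then show ?thesis
  proof (rule cring.cring_fieldI2)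
    show "\<zero>\<^bsub>corner e\<^esub> \<noteq> \<one>\<^bsub>corner e\<^esub>" using e by (simp add: corner_def)
    fix a assume a: "a \<in> carrier (corner e)" "a \<noteq> \<zero>\<^bsub>corner e\<^esub>"
    then have ae: "a * e = a" "a \<noteq> 0" by (auto simp: corner_def)
    obtain s where s: "a * (a * s) = a" using vnr by blast
    have "(a * s) * (a * s) = a * (a * s) * s" by (simp only: mult_ac)
    then have "(a * s) * (a * s) = a * s" by (simp add: s)
    moreover have "(a * s) * e = a * s" using ae by (metis mult.assoc mult.commute)
    moreover have "a * s \<noteq> 0" using s ae by auto
    ultimately have "a * s = e" using e(3) by blast
    then have "a * (s * e) = e" using e by (metis mult.assoc)
    then show "\<exists>b\<in>carrier (corner e). a \<otimes>\<^bsub>corner e\<^esub> b = \<one>\<^bsub>corner e\<^esub>"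
      using e by (intro bexI[of _ "s * e"]) (auto simp: corner_def mult.assoc)
  qed
qed

lemma sorted_wrt_orthogonal_sum:
  assumes "sorted_wrt (\<lambda>x y. x * y = (0 :: 'a::comm_ring_1)) es" "\<And>x. x \<in> set es \<Longrightarrow> x * x = x"
    "j < length es" "\<And>i. i < length es \<Longrightarrow> y i * es ! i = y i"
  shows "(\<Sum>i<length es. y i) * es ! j = y j"
proof -
  have orth: "es ! i * es ! j = 0" if "i < length es" "i \<noteq> j" for i
    using assms(1,3) that sorted_wrt_nth_less[of "\<lambda>x y. x * y = 0" es] by (metis linorder_neqE_nat mult.commute)
  have "y i * es ! j = (if i = j then y i else 0)" if "i < length es" for i
  proof (cases "i = j")
    case False
    then have "y i * es ! j = y i * (es ! i * es ! j)" using assms(4)[OF that] by (metis mult.assoc)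
    then show ?thesis using orth[OF that False] False by simp
  qed (use assms that in auto)
  then have "(\<Sum>i<length es. y i) * es ! j = (\<Sum>i<length es. if i = j then y i else 0)"
    unfolding sum_distrib_right by (intro sum.cong) auto
  then show ?thesis using assms(3) by simp
qed

text \<open>Decompose 1 into orthogonal primitive idempotents. The isomorphism sends x to its
  products with them; its inverse is the sum of the components.\<close>

lemma finite_product_of_fields_class_ringI:
  assumes "left_noetherian (class_ring :: 'a::comm_ring_1 ring)" and vnr: "\<And>r :: 'a. \<exists>s. r * (r * s) = r"
  shows "finite_product_of_fields (class_ring :: 'a ring)"
proof -
  obtain es :: "'a list" where es: "\<forall>x\<in>set es. primitive_idem x" "sorted_wrt (\<lambda>x y. x * y = 0) es" "sum_list es = 1"
    using primitive_idempotent_decomposition[OF assms(1), of 1] by auto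
  have idem: "x * x = x" if "x \<in> set es" for x using es(1) that by (simp add: primitive_idem_def)
  let ?P = "RDirProd_list (map corner es)"
  let ?h = "\<lambda>x. map (\<lambda>e. x * e) es"
  have carrier: "ys \<in> carrier ?P \<longleftrightarrow> length ys = length es \<and> (\<forall>i<length es. ys ! i * es ! i = ys ! i)" for ys
    by (auto simp: RDirProd_list_carrier_iff corner_def)
  have h: "?h x \<in> carrier ?P" for x
    unfolding carrier using idem by (simp add: mult.assoc)
  have "?h \<in> ring_iso class_ring ?P"
    unfolding ring_iso_def
  proof (intro CollectI conjI)
    show "?h \<in> Ring.ring_hom class_ring ?P"
    proof (rule ring_hom_memI)
      fix x y :: 'a
      show "?h (x \<otimes>\<^bsub>class_ring\<^esub> y) = ?h x \<otimes>\<^bsub>?P\<^esub> ?h y"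
        unfolding RDirProd_list_ops(1)[OF h h]
        by (rule nth_equalityI) (use idem in \<open>auto simp: corner_def, metis (no_types, lifting) mult.assoc mult.commute nth_mem\<close>)
      show "?h (x \<oplus>\<^bsub>class_ring\<^esub> y) = ?h x \<oplus>\<^bsub>?P\<^esub> ?h y"
        unfolding RDirProd_list_ops(2)[OF h h]
        by (rule nth_equalityI) (auto simp: corner_def distrib_right)
      show "?h \<one>\<^bsub>class_ring\<^esub> = \<one>\<^bsub>?P\<^esub>"
        unfolding RDirProd_list_one_map by (rule nth_equalityI) (auto simp: corner_def)
    qed (use h in auto)
    show "bij_betw ?h (carrier class_ring) (carrier ?P)"
    proof (rule bij_betw_imageI)
      show "inj_on ?h (carrier class_ring)"
      proof (rule inj_onI)
        fix x y assume "?h x = ?h y"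
        then have "sum_list (?h x) = sum_list (?h y)" by (rule arg_cong)
        moreover have "sum_list (?h z) = z" for z
          using sum_list_const_mult[of z "\<lambda>e. e" es] by (simp add: es)
        ultimately show "x = y" by (simp only:)
      qed
      have "ys \<in> range ?h" if "ys \<in> carrier ?P" for ys
      proof -
        have "(\<Sum>i<length es. ys ! i) * es ! j = ys ! j" if "j < length es" for j
          using \<open>ys \<in> carrier ?P\<close> by (intro sorted_wrt_orthogonal_sum es idem that) (auto simp: carrier)
        then have "ys = ?h (\<Sum>i<length es. ys ! i)"
          using that by (intro nth_equalityI) (auto simp: carrier)
        then show ?thesis by blast
      qed
      then show "?h ` carrier class_ring = carrier ?P" using h by auto
    qed
  qed
  then have "(class_ring :: 'a ring) \<simeq> ?P" by (auto simp: is_ring_iso_def)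
  moreover have "\<forall>F\<in>set (map corner es). field F" using es(1) field_corner vnr by auto
  ultimately show ?thesis unfolding finite_product_of_fields_def by blast
qed

text \<open>The unit vectors of the product are pulled back to the ring. The result no longer
  mentions the fields and is the form in which the criterion for semisimplicity consumes the
  hypothesis.\<close>

lemma finite_product_of_fields_class_ringD:
  assumes "finite_product_of_fields (class_ring :: 'a::comm_ring_1 ring)"
  obtains n and e :: "nat \<Rightarrow> 'a::comm_ring_1" where
    "\<And>i. i < n \<Longrightarrow> e i \<noteq> 0" "\<And>i j. i < n \<Longrightarrow> j < n \<Longrightarrow> e i * e j = (if i = j then e i else 0)"
    "(\<Sum>i<n. e i) = 1" "\<And>i r. i < n \<Longrightarrow> r * e i \<noteq> 0 \<Longrightarrow> \<exists>s. s * (r * e i) = e i"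
proof -
  obtain Fs :: "'a ring list" where Fs: "\<And>F. F \<in> set Fs \<Longrightarrow> field F" and "(class_ring :: 'a ring) \<simeq> RDirProd_list Fs"
    using assms unfolding finite_product_of_fields_def by blast
  then obtain h where "h \<in> ring_iso (class_ring :: 'a ring) (RDirProd_list Fs)" by (auto simp: is_ring_iso_def)
  then have hom: "h \<in> Ring.ring_hom (class_ring :: 'a ring) (RDirProd_list Fs)" and bij: "bij_betw h UNIV (carrier (RDirProd_list Fs))"
    by (auto simp: ring_iso_def)
  define n where "n = length Fs"
  have F: "field (Fs ! i)" if "i < n" for i using Fs that by (simp add: n_def)
  then have R: "ring (Fs ! i)" if "i < n" for i using that by (simp add: field.is_ring cring.axioms domain.axioms field.axioms)
  have hc: "h x \<in> carrier (RDirProd_list Fs)" for x using bij by (auto simp: bij_betw_def)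
  then have hi: "h x ! i \<in> carrier (Fs ! i)" if "i < n" for x i
    using that by (simp add: RDirProd_list_carrier_iff n_def)
  have mult: "h (x * y) ! i = h x ! i \<otimes>\<^bsub>Fs ! i\<^esub> h y ! i" if "i < n" for x y i
    using ring_hom_mult[OF hom, of x y] RDirProd_list_nth(1)[OF hc hc, of i] that by (simp add: n_def)
  have add: "h (x + y) ! i = h x ! i \<oplus>\<^bsub>Fs ! i\<^esub> h y ! i" if "i < n" for x y i
    using ring_hom_add[OF hom, of x y] RDirProd_list_nth(2)[OF hc hc, of i] that by (simp add: n_def)
  have zero: "h 0 ! i = \<zero>\<^bsub>Fs ! i\<^esub>" if "i < n" for i
  proof -
    interpret ring "Fs ! i" using R that by simp
    show ?thesis using add[OF that, of 0 0] hi[OF that, of 0] by (metis add_0 local.add.r_cancel_one')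
  qed
  have eqI: "x = y" if "\<And>i. i < n \<Longrightarrow> h x ! i = h y ! i" for x y
  proof -
    have "h x = h y"
      using hc[of x] hc[of y] that by (intro nth_equalityI) (auto simp: RDirProd_list_carrier_iff n_def)
    then show ?thesis using bij by (auto simp: bij_betw_def inj_def)
  qed
  define e where "e i = inv_into UNIV h (map (\<lambda>j. if j = i then \<one>\<^bsub>Fs ! j\<^esub> else \<zero>\<^bsub>Fs ! j\<^esub>) [0..<n])" for i
  have e: "h (e i) ! j = (if j = i then \<one>\<^bsub>Fs ! j\<^esub> else \<zero>\<^bsub>Fs ! j\<^esub>)" if "j < n" for i j
  proof -
    have "map (\<lambda>j. if j = i then \<one>\<^bsub>Fs ! j\<^esub> else \<zero>\<^bsub>Fs ! j\<^esub>) [0..<n] \<in> carrier (RDirProd_list Fs)"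
      using R by (auto simp: RDirProd_list_carrier_iff n_def ring.ring_simprules)
    then have "h (e i) = map (\<lambda>j. if j = i then \<one>\<^bsub>Fs ! j\<^esub> else \<zero>\<^bsub>Fs ! j\<^esub>) [0..<n]"
      unfolding e_def by (rule bij_betw_inv_into_right[OF bij])
    then show ?thesis using that by simp
  qed
  have field_facts: "\<one>\<^bsub>Fs ! i\<^esub> \<noteq> \<zero>\<^bsub>Fs ! i\<^esub>"
    "\<And>x. x \<in> carrier (Fs ! i) \<Longrightarrow> x \<otimes>\<^bsub>Fs ! i\<^esub> \<one>\<^bsub>Fs ! i\<^esub> = x"
    "\<And>x. x \<in> carrier (Fs ! i) \<Longrightarrow> \<one>\<^bsub>Fs ! i\<^esub> \<otimes>\<^bsub>Fs ! i\<^esub> x = x"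
    "\<And>x. x \<in> carrier (Fs ! i) \<Longrightarrow> x \<otimes>\<^bsub>Fs ! i\<^esub> \<zero>\<^bsub>Fs ! i\<^esub> = \<zero>\<^bsub>Fs ! i\<^esub>"
    "\<one>\<^bsub>Fs ! i\<^esub> \<in> carrier (Fs ! i)" "\<zero>\<^bsub>Fs ! i\<^esub> \<in> carrier (Fs ! i)"
    "\<And>x. x \<in> carrier (Fs ! i) \<Longrightarrow> x \<noteq> \<zero>\<^bsub>Fs ! i\<^esub> \<Longrightarrow> \<exists>y\<in>carrier (Fs ! i). y \<otimes>\<^bsub>Fs ! i\<^esub> x = \<one>\<^bsub>Fs ! i\<^esub>"
    if "i < n" for i
  proof -
    interpret field "Fs ! i" using F that by simp
    show "\<one>\<^bsub>Fs ! i\<^esub> \<noteq> \<zero>\<^bsub>Fs ! i\<^esub>"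
      "\<And>x. x \<in> carrier (Fs ! i) \<Longrightarrow> x \<otimes>\<^bsub>Fs ! i\<^esub> \<one>\<^bsub>Fs ! i\<^esub> = x"
      "\<And>x. x \<in> carrier (Fs ! i) \<Longrightarrow> \<one>\<^bsub>Fs ! i\<^esub> \<otimes>\<^bsub>Fs ! i\<^esub> x = x"
      "\<And>x. x \<in> carrier (Fs ! i) \<Longrightarrow> x \<otimes>\<^bsub>Fs ! i\<^esub> \<zero>\<^bsub>Fs ! i\<^esub> = \<zero>\<^bsub>Fs ! i\<^esub>"
      "\<one>\<^bsub>Fs ! i\<^esub> \<in> carrier (Fs ! i)" "\<zero>\<^bsub>Fs ! i\<^esub> \<in> carrier (Fs ! i)"
      by simp_all
    show "\<exists>y\<in>carrier (Fs ! i). y \<otimes>\<^bsub>Fs ! i\<^esub> x = \<one>\<^bsub>Fs ! i\<^esub>"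
      if "x \<in> carrier (Fs ! i)" "x \<noteq> \<zero>\<^bsub>Fs ! i\<^esub>" for x
      using that field_Units by (intro bexI[of _ "inv\<^bsub>Fs ! i\<^esub> x"]) auto
  qed
  have ee: "e i * e j = (if i = j then e i else 0)" if "i < n" "j < n" for i j
  proof (rule eqI)
    fix k assume k: "k < n"
    show "h (e i * e j) ! k = h (if i = j then e i else 0) ! k"
      using that k by (auto simp: mult e zero field_facts)
  qed
  have mult_e: "h (x * e i) ! k = (if k = i then h x ! k else \<zero>\<^bsub>Fs ! k\<^esub>)" if "k < n" for x i k
    using that by (simp add: mult e field_facts hi)
  have detect: "x = 0" if "\<And>i. i < n \<Longrightarrow> x * e i = 0" for x
  proof (rule eqI)
    fix i assume i: "i < n"
    show "h x ! i = h 0 ! i" using mult_e[OF i, of x i] that[OF i] by simp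
  qed
  show ?thesis
  proof (rule that[of n e])
    show "e i \<noteq> 0" if "i < n" for i
      using e[OF that, of i] zero[OF that] field_facts(1)[OF that] by auto
    show "(\<Sum>i<n. e i) = 1"
    proof -
      have "(1 - (\<Sum>i<n. e i)) * e j = 0" if "j < n" for j
      proof -
        have "(\<Sum>i<n. e i) * e j = (\<Sum>i<n. if i = j then e i else 0)"
          unfolding sum_distrib_right using that by (intro sum.cong) (auto simp: ee)
        then show ?thesis using that by (simp add: left_diff_distrib)
      qed
      then have "1 - (\<Sum>i<n. e i) = 0" by (rule detect)
      then show ?thesis by simp
    qed
    show "\<exists>s. s * (r * e i) = e i" if i: "i < n" and ne: "r * e i \<noteq> 0" for i r
    proof -
      have "h r ! i \<noteq> \<zero>\<^bsub>Fs ! i\<^esub>"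
      proof
        assume "h r ! i = \<zero>\<^bsub>Fs ! i\<^esub>"
        then have "r * e i = 0" by - (rule eqI, simp add: mult_e zero)
        then show False using ne by simp
      qed
      then obtain y where y: "y \<in> carrier (Fs ! i)" "y \<otimes>\<^bsub>Fs ! i\<^esub> h r ! i = \<one>\<^bsub>Fs ! i\<^esub>"
        using field_facts(7)[OF i hi[OF i]] by blast
      define ys where "ys = map (\<lambda>j. if j = i then y else \<zero>\<^bsub>Fs ! j\<^esub>) [0..<n]"
      have "ys \<in> carrier (RDirProd_list Fs)"
        using y field_facts(6) by (auto simp: RDirProd_list_carrier_iff ys_def n_def)
      then have "ys \<in> range h" using bij_betw_imp_surj_on[OF bij] by simp
      then obtain s where s: "h s = ys" by blast
      have "s * r * e i = e i"
      proof (rule eqI)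
        fix k assume k: "k < n"
        show "h (s * r * e i) ! k = h (e i) ! k"
          unfolding mult_e[OF k] e[OF k] using k by (auto simp: mult s ys_def y)
      qed
      then show ?thesis by (auto simp: mult.assoc)
    qed
  qed (use ee in auto)
qed

section \<open>Finite graphs in which no cycle has an exit\<close>

text \<open>\<open>W\<close> is a transversal of the cycles and \<open>c w\<close> is the cycle
  through w rotated to start at w. Fixing this data removes all choices of base points; the absence
  of exits is recorded as uniqueness of the arc leaving each vertex of the cycle.\<close>

locale ne_graph = bpath_rep E W for E :: "('v, 'e) pre_digraph" and W +
  fixes c :: "'v \<Rightarrow> 'e list"
  assumes finite_verts: "finite (verts E)" and finite_arcs: "finite (arcs E)"
    and W_verts: "W \<subseteq> verts E"
    and W_hits: "cycle p \<Longrightarrow> tail E ` set p \<inter> W \<noteq> {}"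
    and c_walk: "w \<in> W \<Longrightarrow> awalk w (c w) w" and c_ne: "w \<in> W \<Longrightarrow> c w \<noteq> []"
    and c_distinct: "w \<in> W \<Longrightarrow> distinct (map (tail E) (c w))"
    and c_once: "w \<in> W \<Longrightarrow> tail E ` set (c w) \<inter> W = {w}"
    and c_no_exit: "w \<in> W \<Longrightarrow> e \<in> set (c w) \<Longrightarrow> out_arcs E (tail E e) = {e}"

text \<open>
  A vertex set of least cardinality meeting all cycles meets, by minimality, for each of its
  vertices some cycle in this vertex only.
\<close>

lemma (in lpa_graph) ne_graph_exists:
  assumes "fin_digraph E" "condition_NE E"
  obtains W c where "ne_graph E W c" "acyclic_digraph E \<Longrightarrow> W = {}"
proof -
  interpret fin_digraph E by fact
  define \<W> where "\<W> = {W. W \<subseteq> verts E \<and> (\<forall>p. cycle p \<longrightarrow> tail E ` set p \<inter> W \<noteq> {})}"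
  have nonempty_cycle: "\<exists>e p'. p = e # p' \<and> e \<in> arcs E" if "cycle p" for p
    using that by (cases p) (auto simp: cycle_def awalk_Cons_iff)
  have "verts E \<in> \<W>"
    unfolding \<W>_def using nonempty_cycle tail_in_verts by fastforce
  then obtain W where W: "W \<in> \<W>" "\<And>W'. W' \<in> \<W> \<Longrightarrow> card W \<le> card W'"
    using ex_min_if_finite[of "card ` \<W>"] arg_min_nat_lemma[of "\<lambda>W. W \<in> \<W>" "verts E" card] by metis
  have fW: "finite W" using W(1) finite_verts by (auto simp: \<W>_def intro: finite_subset)
  have "\<exists>c. awalk w c w \<and> c \<noteq> [] \<and> distinct (map (tail E) c) \<and> tail E ` set c \<inter> W = {w} \<and>
      (\<forall>e\<in>set c. out_arcs E (tail E e) = {e})" if w: "w \<in> W" for w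
  proof -
    have "card (W - {w}) < card W" using fW w by (rule card_Diff1_less)
    then have "W - {w} \<notin> \<W>" using W(2) by (meson leD)
    then obtain p where p: "cycle p" "tail E ` set p \<inter> (W - {w}) = {}"
      using W(1) unfolding \<W>_def by blast
    then have pw: "tail E ` set p \<inter> W = {w}"
      using W(1) unfolding \<W>_def by blast
    obtain u where u: "awalk u p u" "distinct (tl (awalk_verts u p))" "p \<noteq> []"
      using p(1) by (auto simp: cycle_def)
    have "w \<in> tail E ` set p" using pw by blast
    then obtain g where g: "g \<in> set p" "tail E g = w" by blast
    obtain p1 p2 where split: "p = p1 @ g # p2" using split_list[OF g(1)] by blast
    have walk: "awalk w (g # p2 @ p1) w"
      using u(1) g(2) unfolding split by (auto simp: awalk_Cons_iff)
    have set: "set (g # p2 @ p1) = set p" unfolding split by auto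
    have "distinct (map (tail E) (g # p2 @ p1))"
      using cycle_tails_distinct[OF u] unfolding split by auto
    moreover have "out_arcs E (tail E e) = {e}" if e: "e \<in> set p" for e
    proof -
      have "\<not> has_exit E p" using assms(2) p(1) by (simp add: condition_NE_def)
      then have "e = f" if "f \<in> out_arcs E (tail E e)" for f
        using that e u(1) unfolding has_exit_def by (auto simp: awalk_def)
      moreover have "e \<in> out_arcs E (tail E e)" using e u(1) by (auto simp: awalk_def)
      ultimately show ?thesis by blast
    qed
    ultimately show ?thesis
      using walk set pw by (intro exI[of _ "g # p2 @ p1"] conjI ballI) (simp_all only: set, simp)
  qed
  then obtain c where c: "\<And>w. w \<in> W \<Longrightarrow> awalk w (c w) w \<and> c w \<noteq> [] \<and> distinct (map (tail E) (c w)) \<and>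
      tail E ` set (c w) \<inter> W = {w} \<and> (\<forall>e\<in>set (c w). out_arcs E (tail E e) = {e})"
    by metis
  show ?thesis
  proof (rule that[of W c])
    show "ne_graph E W c"
      using W(1) c finite_verts finite_arcs unfolding \<W>_def by unfold_locales auto
    assume "acyclic_digraph E"
    then have "{} \<in> \<W>" by (auto simp: \<W>_def acyclic_digraph_def)
    then have "card W = 0" using W(2)[of "{}"] by simp
    then show "W = {}" using fW by simp
  qed
qed

lemma app_zero_fun [simp]: "app \<psi> (\<lambda>x. 0) = (\<lambda>x. 0)"
  by (simp add: fun_eq_iff)

section \<open>Basis paths and the points that belong to them\<close>

context ne_graph
begin

declare act.simps [simp del]

definition Sp :: "'v set" where
  "Sp = {u \<in> verts E. out_arcs E u = {}} \<union> W"

text \<open>A pair consists of a path and its end vertex; the end is recorded because the list of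
  arcs may be empty.\<close>

definition src :: "'e list \<times> 'v \<Rightarrow> 'v" where
  "src b = (case fst b of [] \<Rightarrow> snd b | e # _ \<Rightarrow> tail E e)"

lemma src_simps [simp]: "src ([], u) = u" "src (e # p, u) = tail E e"
  by (simp_all add: src_def)

text \<open>No arc leaves W, so a basis path meets \<open>Sp\<close> only at its end. Turns around a
  cycle are thereby excluded from p and q and counted by the exponent of c_u alone.\<close>

inductive_set BP :: "('e list \<times> 'v) set" where
  nil: "u \<in> Sp \<Longrightarrow> ([], u) \<in> BP"
| cons: "(p, u) \<in> BP \<Longrightarrow> e \<in> arcs E \<Longrightarrow> head E e = src (p, u) \<Longrightarrow> tail E e \<notin> W \<Longrightarrow> (e # p, u) \<in> BP"

lemma BP_Nil_iff [simp]: "([], u) \<in> BP \<longleftrightarrow> u \<in> Sp"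
  by (auto intro: BP.nil elim: BP.cases)

lemma BP_Cons_iff [simp]:
  "(e # p, u) \<in> BP \<longleftrightarrow> (p, u) \<in> BP \<and> e \<in> arcs E \<and> head E e = src (p, u) \<and> tail E e \<notin> W"
  by (auto intro: BP.cons elim: BP.cases)

lemma Sp_verts: "u \<in> Sp \<Longrightarrow> u \<in> verts E"
  using W_verts by (auto simp: Sp_def)

lemma BP_facts:
  assumes "(p, u) \<in> BP"
  shows "u \<in> Sp" "awalk (src (p, u)) p u" "e \<in> set p \<Longrightarrow> tail E e \<notin> W" "wts p = 0" "set p \<subseteq> arcs E"
  using assms
proof (induction p)
  case Nil
  { case 1 then show ?case by simp next case 2 then show ?case by (simp add: awalk_Nil_iff Sp_verts)
    next case 3 then show ?case by simp next case 4 then show ?case by (simp add: wts_def)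
    next case 5 show ?case by simp }
next
  case (Cons f p)
  { case 1 then show ?case using Cons.IH by simp
    next case 2 then show ?case using Cons.IH by (simp add: awalk_Cons_iff)
    next case 3 then show ?case using Cons.IH by auto
    next case 4 then show ?case using Cons.IH by (simp add: wts_def wt_def)
    next case 5 then show ?case using Cons.IH by simp }
qed

lemma src_not_Sp: "(e # p, u) \<in> BP \<Longrightarrow> tail E e \<notin> Sp"
  by (auto simp: Sp_def)

definition free_step :: "('v \<times> 'v) set" where
  "free_step = {(head E e, tail E e) | e. e \<in> arcs E \<and> tail E e \<notin> W}"

text \<open>A cycle among the arcs that do not leave W would contradict \<open>W_hits\<close>, so
  the subgraph of these arcs is acyclic, and it is finite. The relation is oriented so that in an
  induction at a vertex the heads of its arcs come first.\<close>

lemma wf_free_step: "wf free_step"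
proof (rule finite_acyclic_wf)
  have "free_step \<subseteq> (\<lambda>e. (head E e, tail E e)) ` arcs E"
    by (auto simp: free_step_def)
  then show "finite free_step" using finite_arcs finite_surj by blast
  define E' where "E' = E\<lparr>arcs := {e \<in> arcs E. tail E e \<notin> W}\<rparr>"
  have E': "verts E' = verts E" "arcs E' = {e \<in> arcs E. tail E e \<notin> W}" "tail E' = tail E" "head E' = head E"
    by (simp_all add: E'_def)
  interpret E': wf_digraph E'
    by unfold_locales (auto simp: E')
  have walk: "\<exists>p. p \<noteq> [] \<and> E'.awalk x p y" if "(y, x) \<in> free_step\<^sup>+" for x y
    using that
  proof (induction rule: trancl_induct)
    case (base x)
    then obtain e where e: "e \<in> arcs E'" "y = head E e" "x = tail E e" by (auto simp: free_step_def E')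
    then have "E'.awalk x [e] y"
      using E'.awalk_Cons_iff[of x e "[]" y] E'.awalk_Nil_iff[of y y] E'.head_in_verts[OF e(1)] by (simp add: E')
    then show ?case by blast
  next
    case (step x x')
    then obtain p where p: "E'.awalk x p y" by blast
    obtain e where e: "e \<in> arcs E'" "x = head E e" "x' = tail E e" using step by (auto simp: free_step_def E')
    then have "E'.awalk x' (e # p) y"
      using E'.awalk_Cons_iff[of x' e p y] p by (simp add: E')
    then show ?case by blast
  qed
  show "acyclic free_step"
  proof (rule acyclicI, rule allI, rule notI)
    fix x assume "(x, x) \<in> free_step\<^sup>+"
    then obtain p where "p \<noteq> []" "E'.awalk x p x" using walk by blast
    then have "E'.closed_w p" unfolding E'.closed_w_def by auto
    then obtain q where q: "E'.cycle q" using E'.closed_w_imp_cycle by blast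
    have cas: "E'.cas x p y = cas x p y" for x p y
      by (induction p arbitrary: x) (simp_all add: E'.cas.simps cas.simps E')
    have verts: "E'.awalk_verts x p = awalk_verts x p" for x p
      by (induction p arbitrary: x) (simp_all add: E')
    have "cycle q" using q unfolding E'.cycle_def cycle_def E'.awalk_def awalk_def by (auto simp: cas verts E')
    then have "tail E ` set q \<inter> W \<noteq> {}" by (rule W_hits)
    moreover have "set q \<subseteq> arcs E'" using q unfolding E'.cycle_def E'.awalk_def by blast
    ultimately show False by (auto simp: E')
  qed
qed

text \<open>Induction along \<open>free_step\<close>: a basis path from v is empty or one of
  finitely many arcs followed by a basis path from its head.\<close>

lemma finite_BP: "finite BP"
proof -
  have fin: "finite {b \<in> BP. src b = v}" for v
    using wf_free_step
  proof (induction v)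
    case (less v)
    have "{b \<in> BP. src b = v} \<subseteq> insert ([], v)
        (\<Union>e\<in>{e \<in> arcs E. tail E e = v \<and> tail E e \<notin> W}. (\<lambda>(p, u). (e # p, u)) ` {b \<in> BP. src b = head E e})"
    proof
      fix b assume b: "b \<in> {b \<in> BP. src b = v}"
      obtain p u where pu: "b = (p, u)" by (cases b)
      show "b \<in> insert ([], v) (\<Union>e\<in>{e \<in> arcs E. tail E e = v \<and> tail E e \<notin> W}. (\<lambda>(p, u). (e # p, u)) ` {b \<in> BP. src b = head E e})"
      proof (cases p)
        case (Cons e p')
        then have "b \<in> (\<lambda>(p, u). (e # p, u)) ` {b \<in> BP. src b = head E e}"
          using b pu by (intro image_eqI[of _ _ "(p', u)"]) auto
        moreover have "e \<in> {e \<in> arcs E. tail E e = v \<and> tail E e \<notin> W}"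
          using b pu Cons by auto
        ultimately show ?thesis by blast
      qed (use b pu in auto)
    qed
    moreover have "finite \<dots>"
      using less finite_arcs by (auto simp: free_step_def)
    ultimately show ?case by (rule finite_subset)
  qed
  have "BP \<subseteq> (\<Union>v\<in>verts E. {b \<in> BP. src b = v})"
  proof
    fix b assume b: "b \<in> BP"
    obtain p u where pu: "b = (p, u)" by (cases b)
    have "awalk (src b) p u" using b BP_facts(2) pu by simp
    then show "b \<in> (\<Union>v\<in>verts E. {b \<in> BP. src b = v})" using b by (auto simp: awalk_def)
  qed
  moreover have "finite \<dots>" using fin finite_verts by auto
  ultimately show ?thesis by (rule finite_subset)
qed

text \<open>The boundary path chosen at an endpoint: c_u^\<infinity>, or the empty path at a sink.
  Sequences are arbitrary after \<open>None\<close>, so the constant sequence fixes one code of the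
  empty path.\<close>

definition tail_seq :: "'v \<Rightarrow> nat \<Rightarrow> 'e option" where
  "tail_seq u = (if u \<in> W then cyc (c u) else (\<lambda>_. None))"

lemma bpath_tail_seq: "u \<in> Sp \<Longrightarrow> bpath u (tail_seq u)"
  using bpath_cyc c_walk c_ne
  by (auto simp: Sp_def tail_seq_def singular_def intro: bpath.stop)

definition pt :: "'e list \<times> 'v \<Rightarrow> ('v, 'e) bpoint" where
  "pt b = (src b, prefix_seq (fst b) (tail_seq (snd b)))"

lemma bpt_pt: "b \<in> BP \<Longrightarrow> bpt (pt b)"
  using bpath_prefix_seq[OF BP_facts(2) bpath_tail_seq[OF BP_facts(1)]]
  by (cases b) (auto simp: pt_def)

lemma pt_Nil: "pt ([], u) = (u, tail_seq u)"
  by (simp add: pt_def)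

lemma pt_Cons: "(e # p, u) \<in> BP \<Longrightarrow> pt (e # p, u) = cons e (pt (p, u))"
  by (simp add: pt_def cons_def)

lemma hd_c:
  assumes "w \<in> W"
  shows "c w = hd (c w) # tl (c w)" "tail E (hd (c w)) = w" "hd (c w) \<in> arcs E"
  using c_walk[OF assms] c_ne[OF assms] by (cases "c w"; auto simp: awalk_Cons_iff)+

lemma tail_seq_0: "u \<in> Sp \<Longrightarrow> tail_seq u 0 = (if u \<in> W then Some (hd (c u)) else None)"
  using c_ne[of u] by (auto simp: tail_seq_def cyc_def hd_conv_nth)

lemma act_Ghost_delta:
  "app (act (Ghost e)) (delta x) =
    (if e \<in> arcs E \<and> bpt x \<and> snd x 0 = Some e then (\<lambda>x'. mono_t (- wt e) * (delta (uncons x) x' :: 'r::comm_ring_1 laurent))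
     else (\<lambda>_. 0))"
proof
  fix x'
  have *: "(e \<in> arcs E \<and> bpt x' \<and> fst x' = head E e) \<and> cons e x' = x \<longleftrightarrow>
    (e \<in> arcs E \<and> bpt x \<and> snd x 0 = Some e) \<and> x' = uncons x"
    using bpt_cons[of e x'] uncons_cons[of x' e] cons_simps(2)[of e x']
      bpt_SomeD[of x e] cons_uncons[of x e] by metis
  show "app (act (Ghost e)) (delta x) x' =
    (if e \<in> arcs E \<and> bpt x \<and> snd x 0 = Some e then (\<lambda>x'. mono_t (- wt e) * (delta (uncons x) x' :: 'r laurent))
     else (\<lambda>_. 0)) x'"
    using * unfolding act.simps app_pull by (smt (verit) mult_zero_right)
qed

lemma act_Vert_delta:
  "bpt x \<Longrightarrow> app (act (Vert u)) (delta x) = (\<lambda>x'. if fst x = u then (delta x x' :: 'r::comm_ring_1 laurent) else 0)"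
  unfolding act.simps app_pull fun_eq_iff by auto

text \<open>Each ghost arc of q must match the first arc of the point. The matching cannot run into
  the periodic part, whose first arc leaves W while no arc of q does; and once q is stripped off, u
  retains only the empty basis path, as nonempty ones start outside \<open>Sp\<close>.\<close>

lemma Vert_pg_delta:
  assumes "(q, u) \<in> BP" "b' \<in> BP"
  shows "app (act (Vert u)) (app (pg q) (delta (pt b'))) =
    (\<lambda>x. if b' = (q, u) then (delta (u, tail_seq u) x :: 'r::comm_ring_1 laurent) else 0)"
  using assms
proof (induction q arbitrary: b')
  case Nil
  obtain p' u' where b': "b' = (p', u')" by (cases b')
  have "src b' = u \<longleftrightarrow> b' = ([], u)"
    using Nil src_not_Sp unfolding b' by (cases p') auto
  moreover have "fst (pt b') = src b'" by (simp add: pt_def)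
  ultimately show ?case
    using act_Vert_delta[OF bpt_pt[OF Nil.prems(2)], of u]
    by (cases "b' = ([], u)") (simp_all add: pg_def pt_Nil)
next
  case (Cons e q)
  have e: "e \<in> arcs E" "(q, u) \<in> BP" "tail E e \<notin> W" "wt e = 0" using Cons.prems by (auto simp: wt_def)
  have pg: "app (pg (e # q)) y = app (pg q) (app (act (Ghost e)) y)" for y :: "_ \<Rightarrow> 'r laurent"
    by (simp add: pg_def)
  obtain p' u' where b': "b' = (p', u')" by (cases b')
  show ?case
  proof (cases "snd (pt b') 0 = Some e")
    case True
    have "\<exists>p''. p' = e # p''"
    proof (cases p')
      case Nil
      then have "tail_seq u' 0 = Some e" "u' \<in> Sp" using True Cons.prems(2) by (auto simp: b' pt_def)
      then have "u' \<in> W" "e = hd (c u')" by (auto simp: tail_seq_0 split: if_splits)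
      then show ?thesis using e hd_c(2) by auto
    next
      case (Cons e' p'')
      then show ?thesis using True by (simp add: b' pt_def)
    qed
    then obtain p'' where p': "p' = e # p''" by blast
    have BP'': "(p'', u') \<in> BP" and hd: "head E e = src (p'', u')" using Cons.prems(2) by (auto simp: b' p')
    have "uncons (pt b') = pt (p'', u')"
      unfolding b' p' using pt_Cons[of e p'' u'] Cons.prems(2) hd by (simp add: b' p' uncons_cons pt_def)
    then have "app (act (Ghost e)) (delta (pt b')) = (delta (pt (p'', u')) :: _ \<Rightarrow> 'r laurent)"
      using act_Ghost_delta[of e "pt b'"] True e bpt_pt[OF Cons.prems(2)] by simp
    then show ?thesis
      using Cons.IH[OF e(2) BP''] by (simp add: pg b' p')
  next
    case False
    then have "app (act (Ghost e)) (delta (pt b')) = (\<lambda>_. 0 :: 'r laurent)"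
      by (simp only: act_Ghost_delta) simp
    moreover have "b' \<noteq> (e # q, u)" using False by (auto simp: pt_def)
    ultimately show ?thesis by (simp add: pg)
  qed
qed

text \<open>The word for c_u^k, with the ghost path as inverse for negative k. For k = 0 it is
  empty, which is also the only case at a sink.\<close>

definition zw :: "'v \<Rightarrow> int \<Rightarrow> ('v, 'e) lpa_gen list" where
  "zw u k = (if k \<ge> 0 then concat (replicate (nat k) (map Edge (c u)))
     else concat (replicate (nat (- k)) (map Ghost (rev (c u)))))"

definition Zop :: "'v \<Rightarrow> int \<Rightarrow> (('v, 'e) bpoint, 'r::comm_ring_1 laurent) lin" where
  "Zop u k = prod_list (map act (zw u k))"

lemma prod_list_map_Edge: "prod_list (map act (map Edge p)) = pe p"
  by (simp add: pe_def comp_def)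

lemma prod_list_map_Ghost: "prod_list (map act (map Ghost (rev p))) = pg p"
  by (simp add: pg_def comp_def)

text \<open>The cycle fixes c_u^\<infinity> and has weight 1, so it acts there as t. Since c_u^* c_u
  = u, its ghost path must act as t^-1.\<close>

lemma Zop_delta:
  assumes "u \<in> Sp" "u \<notin> W \<Longrightarrow> k = 0"
  shows "app (Zop u k) (delta (u, tail_seq u)) = (\<lambda>x. mono_t k * (delta (u, tail_seq u) x :: 'r::comm_ring_1 laurent))"
proof (cases "u \<in> W")
  case False
  then show ?thesis using assms by (simp add: Zop_def zw_def)
next
  case True
  let ?d = "delta (u, tail_seq u) :: _ \<Rightarrow> 'r laurent"
  have seq: "tail_seq u = cyc (c u)" using True by (simp add: tail_seq_def)
  have wts: "wts (c u) = 1" using wts_single[OF c_distinct c_once] True by blast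
  have C: "app (pe (c u)) ?d = (\<lambda>x. mono_t 1 * ?d x)"
    using pe_delta[OF c_walk[OF True] bpath_tail_seq[OF assms(1)]] by (simp only: wts seq prefix_seq_cyc)
  have "app (pg (c u)) (app (pe (c u)) ?d) = app (act (Vert u)) ?d"
    unfolding app_simps(6)[symmetric] by (simp only: pg_pe[OF c_walk[OF True] c_ne[OF True]])
  also have "\<dots> = ?d" using act_Vert_delta[of "(u, tail_seq u)" u] bpath_tail_seq[OF assms(1)] by simp
  finally have "(\<lambda>x. mono_t 1 * app (pg (c u)) ?d x) = ?d" by (simp only: C app_scale_fun)
  then have C': "app (pg (c u)) ?d = (\<lambda>x. mono_t (- 1) * ?d x)"
    by (metis (no_types, lifting) ext mono_t_cancel(1))
  have power: "app (\<psi> ^ n) ?d = (\<lambda>x. mono_t (int n * j) * ?d x)"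
    if "app \<psi> ?d = (\<lambda>x. mono_t j * ?d x)" for \<psi> n j
  proof (induction n)
    case (Suc n)
    have "app (\<psi> ^ Suc n) ?d = app \<psi> (app (\<psi> ^ n) ?d)" by simp
    also have "\<dots> = (\<lambda>x. mono_t (int n * j) * (mono_t j * ?d x))"
      by (simp only: Suc app_scale_fun that)
    finally show ?case by (simp only: mult.assoc[symmetric] mono_t_mult) (simp add: algebra_simps)
  qed simp
  have prod_rep: "prod_list (map act (concat (replicate n ws))) = prod_list (map act ws) ^ n" for n ws
    by (induction n) simp_all
  show ?thesis
  proof (cases "k \<ge> 0")
    case True
    then have "(Zop u k :: (_, 'r laurent) lin) = pe (c u) ^ nat k"
      by (simp add: Zop_def zw_def prod_rep prod_list_map_Edge del: map_map)
    then show ?thesis using power[OF C, of "nat k"] True by simp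
  next
    case False
    then have "(Zop u k :: (_, 'r laurent) lin) = pg (c u) ^ nat (- k)"
      by (simp add: Zop_def zw_def prod_rep prod_list_map_Ghost del: map_map)
    then show ?thesis using power[OF C', of "nat (- k)"] False by simp
  qed
qed

type_synonym ('w, 'f) index = "('f list \<times> 'w) \<times> int \<times> ('f list \<times> 'w)"

definition Idx :: "('v, 'e) index set" where
  "Idx = {(b, k, b'). b \<in> BP \<and> b' \<in> BP \<and> snd b = snd b' \<and> (snd b \<notin> W \<longrightarrow> k = 0)}"

text \<open>The word p u c_u^k u q^*. The copies of u keep it nonempty when everything else is empty
  and let the vertex relations be applied on either side of the power.\<close>

definition mword :: "('v, 'e) index \<Rightarrow> ('v, 'e) lpa_gen list" where
  "mword = (\<lambda>((p, u), k, (q, u')). map Edge p @ Vert u # zw u k @ Vert u # map Ghost (rev q))"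

definition m :: "('v, 'e) index \<Rightarrow> (('v, 'e) lpa_gen free_monoid \<Rightarrow>\<^sub>0 'r::comm_ring_1)" where
  "m i = Poly_Mapping.single (FMon (mword i)) 1"

text \<open>On the indicator of a point, q^* strips off q or gives 0, the power of the cycle
  contributes t^k, and p is put in front.\<close>

lemma \<rho>_m_delta:
  assumes "(b, k, b') \<in> Idx" "a \<in> BP"
  shows "app (\<rho> (m (b, k, b'))) (delta (pt a)) =
    (\<lambda>x. if a = b' then mono_t k * (delta (pt b) x :: 'r::comm_ring_1 laurent) else 0)"
proof -
  obtain p u q where b: "b = (p, u)" "b' = (q, u)" "(p, u) \<in> BP" "(q, u) \<in> BP" "u \<notin> W \<Longrightarrow> k = 0"
    using assms(1) by (cases b; cases b') (auto simp: Idx_def)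
  let ?d = "delta (u, tail_seq u) :: _ \<Rightarrow> 'r laurent"
  have "\<rho> (m (b, k, b') :: _ \<Rightarrow>\<^sub>0 'r) = pe p * (act (Vert u) * (Zop u k * (act (Vert u) * pg q)))"
    by (simp add: m_def ev_word mword_def b Zop_def prod_list_map_Edge prod_list_map_Ghost del: map_map)
  then have "app (\<rho> (m (b, k, b'))) (delta (pt a)) =
      app (pe p) (app (act (Vert u)) (app (Zop u k) (\<lambda>x. if a = (q, u) then ?d x else 0)))"
    by (simp only: app_simps Vert_pg_delta[OF b(4) assms(2)])
  also have "\<dots> = (\<lambda>x. if a = b' then mono_t k * delta (pt b) x else 0)"
  proof (cases "a = b'")
    case True
    have "app (Zop u k) ?d = (\<lambda>x. mono_t k * ?d x)"
      by (rule Zop_delta) (use BP_facts(1)[OF b(3)] b(5) in auto)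
    then have "app (pe p) (app (act (Vert u)) (app (Zop u k) ?d)) = (\<lambda>x. mono_t k * app (pe p) (app (act (Vert u)) ?d) x)"
      by (simp only: app_scale_fun)
    also have "app (act (Vert u)) ?d = ?d"
      using act_Vert_delta[of "(u, tail_seq u)" u] bpath_tail_seq[OF BP_facts(1)[OF b(3)]] by simp
    also have "app (pe p) ?d = delta (pt (p, u))"
      using pe_delta[OF BP_facts(2)[OF b(3)] bpath_tail_seq[OF BP_facts(1)[OF b(3)]]]
      by (simp add: BP_facts(4)[OF b(3)] pt_def)
    finally show ?thesis using True by (simp add: b)
  next
    case False
    then show ?thesis by (simp add: b)
  qed
  finally show ?thesis .
qed

text \<open>The place where a point first visits \<open>Sp\<close> shows where the basis path ends
  and the chosen tail begins.\<close>

lemma inj_on_pt: "inj_on pt BP"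
proof -
  have "(p, u) = (q, u')" if "(p, u) \<in> BP" "(q, u') \<in> BP" "pt (p, u) = pt (q, u')" for p u q u'
    using that
  proof (induction p arbitrary: q)
    case Nil
    then have "src (q, u') = u" "u \<in> Sp" by (auto simp: pt_def)
    then show ?case using Nil src_not_Sp by (cases q) auto
  next
    case (Cons e p)
    show ?case
    proof (cases q)
      case Nil
      then have "tail E e = u'" "u' \<in> Sp" using Cons.prems by (auto simp: pt_def)
      then show ?thesis using Cons.prems src_not_Sp by blast
    next
      case q: (Cons e' q')
      then have eq: "cons e (pt (p, u)) = cons e' (pt (q', u'))"
        using Cons.prems pt_Cons by metis
      then have ee: "e = e'" by (metis cons_simps(2) option.inject)
      have "pt (p, u) = pt (q', u')"
      proof -
        have "fst (pt (p, u)) = head E e" "fst (pt (q', u')) = head E e"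
          using Cons.prems q ee by (auto simp: pt_def)
        then show ?thesis using eq ee uncons_cons by metis
      qed
      then show ?thesis using Cons.IH[of q'] Cons.prems q ee by simp
    qed
  qed
  then show ?thesis by (intro inj_onI) (metis surj_pair)
qed

end

section \<open>A basis of the Leavitt path algebra\<close>

definition smul :: "'r::comm_ring_1 \<Rightarrow> ('g free_monoid \<Rightarrow>\<^sub>0 'r) \<Rightarrow> ('g free_monoid \<Rightarrow>\<^sub>0 'r)" where
  "smul r f = Poly_Mapping.single 0 r * f"

lemma free_const_central:
  fixes f :: "'g free_monoid \<Rightarrow>\<^sub>0 'r::comm_ring_1"
  shows "f * Poly_Mapping.single 0 r = Poly_Mapping.single 0 r * f"
proof (induction f rule: poly_mapping_additive_induct)
  case (single w d)
  then show ?case by (simp add: mult_single mult.commute)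
next
  case (add f g)
  then show ?case by (simp add: distrib_left distrib_right)
qed

interpretation free_mod: module "smul :: 'r::comm_ring_1 \<Rightarrow> _ \<Rightarrow> ('g free_monoid \<Rightarrow>\<^sub>0 'r)"
  by unfold_locales
     (auto simp: smul_def distrib_left distrib_right single_add mult_single mult.assoc[symmetric])

lemma smul_mult_right: "f * smul r g = smul r (f * g)"
  unfolding smul_def by (metis free_const_central mult.assoc)

lemma smul_mult_left: "smul r f * g = smul r (f * g)"
  by (simp add: smul_def mult.assoc)

abbreviation wd :: "'g list \<Rightarrow> ('g free_monoid \<Rightarrow>\<^sub>0 'r::comm_ring_1)" where
  "wd ws \<equiv> Poly_Mapping.single (FMon ws) 1"

lemma wd_mult: "wd ws * wd ws' = wd (ws @ ws')"
  by (simp add: mult_single)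

section \<open>Words modulo the defining relations\<close>

context lpa_graph
begin

definition eqv :: "(('v, 'e) lpa_gen free_monoid \<Rightarrow>\<^sub>0 'r::comm_ring_1) \<Rightarrow> _ \<Rightarrow> bool" where
  "eqv f g \<longleftrightarrow> f - g \<in> I"

lemma eqv_refl [simp]: "eqv f f"
  by (simp add: eqv_def)

lemma eqv_sym: "eqv f g \<Longrightarrow> eqv g f"
  using I_uminus[of "f - g"] by (simp add: eqv_def)

lemma eqv_trans [trans]: "eqv f g \<Longrightarrow> eqv g h \<Longrightarrow> eqv f h"
  using I_add[of "f - g" "g - h"] by (simp add: eqv_def)

lemma eqv_I: "eqv f g \<Longrightarrow> g \<in> I \<Longrightarrow> f \<in> I"
  using I_add[of "f - g" g] by (simp add: eqv_def)

lemma eqv_ctx: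
  assumes "eqv (wd ws) (wd ws' :: _ \<Rightarrow>\<^sub>0 'r::comm_ring_1)" "set a \<subseteq> gens" "set b \<subseteq> gens"
  shows "eqv (wd (a @ ws @ b)) (wd (a @ ws' @ b) :: _ \<Rightarrow>\<^sub>0 'r)"
proof -
  have "wd a * (wd ws - wd ws') * wd b \<in> (I :: (_ \<Rightarrow>\<^sub>0 'r) set)"
    using assms by (simp add: eqv_def)
  then show ?thesis
    by (simp add: eqv_def left_diff_distrib right_diff_distrib wd_mult)
qed

lemma I_ctx:
  assumes "wd ws \<in> (I :: (_ \<Rightarrow>\<^sub>0 'r::comm_ring_1) set)" "set a \<subseteq> gens" "set b \<subseteq> gens"
  shows "wd (a @ ws @ b) \<in> (I :: (_ \<Rightarrow>\<^sub>0 'r) set)"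
proof -
  have "wd a * wd ws * wd b \<in> (I :: (_ \<Rightarrow>\<^sub>0 'r) set)"
    using assms by simp
  then show ?thesis by (simp add: wd_mult)
qed

lemma relators_I_mem: "f \<in> lpa_relators E \<Longrightarrow> f \<in> (I :: (_ \<Rightarrow>\<^sub>0 'r::comm_ring_1) set)"
  using relators_I by blast

lemma word_relations:
  "v \<in> verts E \<Longrightarrow> eqv (wd [Vert v, Vert v]) (wd [Vert v] :: _ \<Rightarrow>\<^sub>0 'r::comm_ring_1)"
  "v \<in> verts E \<Longrightarrow> w \<in> verts E \<Longrightarrow> v \<noteq> w \<Longrightarrow> wd [Vert v, Vert w] \<in> (I :: (_ \<Rightarrow>\<^sub>0 'r::comm_ring_1) set)"
  "e \<in> arcs E \<Longrightarrow> eqv (wd [Vert (tail E e), Edge e]) (wd [Edge e] :: _ \<Rightarrow>\<^sub>0 'r::comm_ring_1)"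
  "e \<in> arcs E \<Longrightarrow> eqv (wd [Edge e, Vert (head E e)]) (wd [Edge e] :: _ \<Rightarrow>\<^sub>0 'r::comm_ring_1)"
  "e \<in> arcs E \<Longrightarrow> eqv (wd [Vert (head E e), Ghost e]) (wd [Ghost e] :: _ \<Rightarrow>\<^sub>0 'r::comm_ring_1)"
  "e \<in> arcs E \<Longrightarrow> eqv (wd [Ghost e, Vert (tail E e)]) (wd [Ghost e] :: _ \<Rightarrow>\<^sub>0 'r::comm_ring_1)"
  "e \<in> arcs E \<Longrightarrow> eqv (wd [Ghost e, Edge e]) (wd [Vert (head E e)] :: _ \<Rightarrow>\<^sub>0 'r::comm_ring_1)"
  "e \<in> arcs E \<Longrightarrow> f \<in> arcs E \<Longrightarrow> e \<noteq> f \<Longrightarrow> wd [Ghost e, Edge f] \<in> (I :: (_ \<Rightarrow>\<^sub>0 'r::comm_ring_1) set)"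
proof -
  show "v \<in> verts E \<Longrightarrow> eqv (wd [Vert v, Vert v]) (wd [Vert v] :: _ \<Rightarrow>\<^sub>0 'r)"
    using relators_I_mem[OF lpa_relators.vertex_idem, where 'r='r] by (simp add: eqv_def gvar_def wd_mult)
  show "v \<in> verts E \<Longrightarrow> w \<in> verts E \<Longrightarrow> v \<noteq> w \<Longrightarrow> wd [Vert v, Vert w] \<in> (I :: (_ \<Rightarrow>\<^sub>0 'r) set)"
    using relators_I_mem[OF lpa_relators.vertex_orth, where 'r='r] by (simp add: gvar_def wd_mult)
  show "e \<in> arcs E \<Longrightarrow> eqv (wd [Vert (tail E e), Edge e]) (wd [Edge e] :: _ \<Rightarrow>\<^sub>0 'r)"
    using relators_I_mem[OF lpa_relators.source_edge, where 'r='r] by (simp add: eqv_def gvar_def wd_mult)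
  show "e \<in> arcs E \<Longrightarrow> eqv (wd [Edge e, Vert (head E e)]) (wd [Edge e] :: _ \<Rightarrow>\<^sub>0 'r)"
    using relators_I_mem[OF lpa_relators.edge_range, where 'r='r] by (simp add: eqv_def gvar_def wd_mult)
  show "e \<in> arcs E \<Longrightarrow> eqv (wd [Vert (head E e), Ghost e]) (wd [Ghost e] :: _ \<Rightarrow>\<^sub>0 'r)"
    using relators_I_mem[OF lpa_relators.range_ghost, where 'r='r] by (simp add: eqv_def gvar_def wd_mult)
  show "e \<in> arcs E \<Longrightarrow> eqv (wd [Ghost e, Vert (tail E e)]) (wd [Ghost e] :: _ \<Rightarrow>\<^sub>0 'r)"
    using relators_I_mem[OF lpa_relators.ghost_source, where 'r='r] by (simp add: eqv_def gvar_def wd_mult)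
  show "e \<in> arcs E \<Longrightarrow> eqv (wd [Ghost e, Edge e]) (wd [Vert (head E e)] :: _ \<Rightarrow>\<^sub>0 'r)"
    using relators_I_mem[OF lpa_relators.ghost_edge_same, where 'r='r] by (simp add: eqv_def gvar_def wd_mult)
  show "e \<in> arcs E \<Longrightarrow> f \<in> arcs E \<Longrightarrow> e \<noteq> f \<Longrightarrow> wd [Ghost e, Edge f] \<in> (I :: (_ \<Rightarrow>\<^sub>0 'r) set)"
    using relators_I_mem[OF lpa_relators.ghost_edge_diff, where 'r='r] by (simp add: gvar_def wd_mult)
qed

lemma word_vertex_sum:
  assumes "v \<in> verts E" "out_arcs E v \<noteq> {}" "finite (out_arcs E v)"
  shows "eqv (wd [Vert v]) (\<Sum>e\<in>out_arcs E v. wd [Edge e, Ghost e] :: _ \<Rightarrow>\<^sub>0 'r::comm_ring_1)"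
  using relators_I_mem[OF lpa_relators.vertex_sum[OF assms], where 'r='r]
  by (simp add: eqv_def gvar_def wd_mult)

lemma awalk_verts_arcs:
  assumes "awalk v p u"
  shows "v \<in> verts E" "u \<in> verts E" "set p \<subseteq> arcs E"
proof -
  show 1: "v \<in> verts E" "set p \<subseteq> arcs E" using assms by (auto simp: awalk_def)
  show "u \<in> verts E" using awlast_in_verts[OF 1] awlast_if_cas[of v p u] assms by (simp add: awalk_def)
qed

lemma word_walk_vertex:
  assumes "awalk v p u"
  shows "eqv (wd (Vert v # map Edge p @ [Vert u])) (wd (map Edge p @ [Vert u]) :: _ \<Rightarrow>\<^sub>0 'r::comm_ring_1)"
proof (cases p)
  case Nil
  then show ?thesis using assms word_relations(1)[where 'r='r] by (auto simp: awalk_Nil_iff)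
next
  case (Cons e p')
  then have "eqv (wd ([] @ [Vert (tail E e), Edge e] @ (map Edge p' @ [Vert u])))
      (wd ([] @ [Edge e] @ (map Edge p' @ [Vert u])) :: _ \<Rightarrow>\<^sub>0 'r)"
    using awalk_verts_arcs[OF assms] by (intro eqv_ctx word_relations(3)[where 'r='r]) auto
  then show ?thesis using Cons assms by (simp add: awalk_Cons_iff)
qed

lemma word_walk_other_vertex:
  assumes "awalk v p u" "v' \<in> verts E" "v' \<noteq> v"
  shows "wd (Vert v' # map Edge p @ [Vert u]) \<in> (I :: (_ \<Rightarrow>\<^sub>0 'r::comm_ring_1) set)"
proof -
  have u: "u \<in> verts E" "v \<in> verts E" "set p \<subseteq> arcs E" using awalk_verts_arcs[OF assms(1)] by auto
  then have gens: "set (map Edge p @ [Vert u]) \<subseteq> gens" by auto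
  have "eqv (wd ([Vert v'] @ (Vert v # map Edge p @ [Vert u]) @ []))
     (wd ([Vert v'] @ (map Edge p @ [Vert u]) @ []) :: _ \<Rightarrow>\<^sub>0 'r)"
    using assms by (intro eqv_ctx word_walk_vertex[where 'r='r]) auto
  moreover have "wd ([] @ [Vert v', Vert v] @ (map Edge p @ [Vert u])) \<in> (I :: (_ \<Rightarrow>\<^sub>0 'r) set)"
    using assms u gens by (intro I_ctx word_relations(2)[where 'r='r]) auto
  ultimately show ?thesis using eqv_I[where 'a='r, OF eqv_sym] by auto
qed

lemma word_ghost_walk_vertex:
  assumes "awalk v q u"
  shows "eqv (wd (Vert u # map Ghost (rev q) @ [Vert v])) (wd (Vert u # map Ghost (rev q)) :: _ \<Rightarrow>\<^sub>0 'r::comm_ring_1)"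
proof (cases q)
  case Nil
  then show ?thesis using assms word_relations(1)[where 'r='r] by (auto simp: awalk_Nil_iff)
next
  case (Cons e q')
  have u: "u \<in> verts E" "set q \<subseteq> arcs E" using awalk_verts_arcs[OF assms] by auto
  then have "eqv (wd ((Vert u # map Ghost (rev q')) @ [Ghost e, Vert (tail E e)] @ []))
      (wd ((Vert u # map Ghost (rev q')) @ [Ghost e] @ []) :: _ \<Rightarrow>\<^sub>0 'r)"
    using Cons by (intro eqv_ctx word_relations(6)[where 'r='r]) auto
  then show ?thesis using Cons assms by (simp add: awalk_Cons_iff)
qed

lemma word_ghost_walk_other_vertex:
  assumes "awalk v q u" "v' \<in> verts E" "v' \<noteq> v"
  shows "wd (Vert u # map Ghost (rev q) @ [Vert v']) \<in> (I :: (_ \<Rightarrow>\<^sub>0 'r::comm_ring_1) set)"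
proof -
  have u: "u \<in> verts E" "v \<in> verts E" "set q \<subseteq> arcs E" using awalk_verts_arcs[OF assms(1)] by auto
  then have gens: "set (Vert u # map Ghost (rev q)) \<subseteq> gens" by auto
  have "eqv (wd ([] @ (Vert u # map Ghost (rev q) @ [Vert v]) @ [Vert v']))
     (wd ([] @ (Vert u # map Ghost (rev q)) @ [Vert v']) :: _ \<Rightarrow>\<^sub>0 'r)"
    using assms by (intro eqv_ctx word_ghost_walk_vertex[where 'r='r]) auto
  moreover have "wd ((Vert u # map Ghost (rev q)) @ [Vert v, Vert v'] @ []) \<in> (I :: (_ \<Rightarrow>\<^sub>0 'r) set)"
    using assms u gens by (intro I_ctx word_relations(2)[where 'r='r]) auto
  ultimately show ?thesis using eqv_I[where 'a='r, OF eqv_sym] by auto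
qed

text \<open>If e is the only arc leaving its tail, the vertex sum there has the single term e e^*;
  the word collapses from the inside. This is where the absence of exits makes a cycle
  invertible.\<close>

lemma word_walk_inverse:
  assumes "awalk v p w" "p \<noteq> []" "\<And>e. e \<in> set p \<Longrightarrow> out_arcs E (tail E e) = {e}"
  shows "eqv (wd (map Edge p @ map Ghost (rev p))) (wd [Vert v] :: _ \<Rightarrow>\<^sub>0 'r::comm_ring_1)"
  using assms
proof (induction p arbitrary: v)
  case (Cons e p)
  have e: "e \<in> arcs E" "tail E e = v" "awalk (head E e) p w" "v \<in> verts E"
    using Cons.prems by (auto simp: awalk_Cons_iff)
  have ee: "eqv (wd [Edge e, Ghost e]) (wd [Vert v] :: _ \<Rightarrow>\<^sub>0 'r)"
    using eqv_sym[OF word_vertex_sum[where 'r='r, of v]] Cons.prems(3)[of e] e by simp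
  show ?case
  proof (cases "p = []")
    case True
    then show ?thesis using ee by simp
  next
    case False
    have "eqv (wd ([Edge e] @ (map Edge p @ map Ghost (rev p)) @ [Ghost e]))
        (wd ([Edge e] @ [Vert (head E e)] @ [Ghost e]) :: _ \<Rightarrow>\<^sub>0 'r)"
      using Cons.IH[OF e(3) False] Cons.prems(3) e by (intro eqv_ctx) auto
    also have "eqv (wd ([Edge e] @ [Vert (head E e)] @ [Ghost e])) (wd ([] @ [Edge e] @ [Ghost e]) :: _ \<Rightarrow>\<^sub>0 'r)"
      using eqv_ctx[OF word_relations(4)[where 'r='r, OF e(1)], of "[]" "[Ghost e]"] e by simp
    finally have "eqv (wd (map Edge (e # p) @ map Ghost (rev (e # p)))) (wd [Edge e, Ghost e] :: _ \<Rightarrow>\<^sub>0 'r)" by simp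
    from eqv_trans[OF this ee] show ?thesis .
  qed
qed simp

end

section \<open>The words \<open>mword\<close> span the algebra\<close>

context ne_graph
begin

text \<open>A submodule containing \<open>I\<close>. As it turns out to be closed under left
  multiplication by generators, every nonempty word lies in it as soon as the single vertices
  do.\<close>

definition N :: "(('v, 'e) lpa_gen free_monoid \<Rightarrow>\<^sub>0 'r::comm_ring_1) set" where
  "N = {f. \<exists>s\<in>free_mod.span (m ` Idx). eqv f s}"

lemma N_add: "f \<in> N \<Longrightarrow> g \<in> N \<Longrightarrow> f + g \<in> N"
proof -
  assume "f \<in> N" "g \<in> N"
  then obtain s s' where s: "s \<in> free_mod.span (m ` Idx)" "s' \<in> free_mod.span (m ` Idx)" "f - s \<in> I" "g - s' \<in> I"
    by (auto simp: N_def eqv_def)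
  then have "eqv (f + g) (s + s')" using I_add[OF s(3,4)] by (simp add: eqv_def algebra_simps)
  then show ?thesis using free_mod.span_add[OF s(1,2)] by (auto simp: N_def)
qed

lemma N_smul: "f \<in> N \<Longrightarrow> smul r f \<in> N"
proof -
  assume "f \<in> N"
  then obtain s where s: "s \<in> free_mod.span (m ` Idx)" "f - s \<in> I"
    by (auto simp: N_def eqv_def)
  then have "smul r (f - s) \<in> I" by (simp add: smul_def)
  then have "eqv (smul r f) (smul r s)" by (simp add: eqv_def free_mod.scale_right_diff_distrib)
  then show ?thesis using free_mod.span_scale[OF s(1)] by (auto simp: N_def)
qed

lemma N_eqv: "eqv f g \<Longrightarrow> g \<in> N \<Longrightarrow> f \<in> N"
  using eqv_trans by (auto simp: N_def)

lemma N_I: "f \<in> I \<Longrightarrow> f \<in> N"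
  using free_mod.span_zero by (force simp: N_def eqv_def)

lemma N_sum: "(\<And>i. i \<in> A \<Longrightarrow> h i \<in> N) \<Longrightarrow> sum h A \<in> N"
  by (induction A rule: infinite_finite_induct) (auto simp: N_add N_I)

lemma N_m: "i \<in> Idx \<Longrightarrow> m i \<in> N"
  unfolding N_def by (rule CollectI, rule bexI, rule eqv_refl, rule free_mod.span_base, rule imageI)

lemma N_mult:
  assumes "a \<in> F1" "b \<in> F1" "\<And>i. i \<in> Idx \<Longrightarrow> a * m i * b \<in> N" "f \<in> N"
  shows "a * f * b \<in> N"
proof -
  obtain s where s: "s \<in> free_mod.span (m ` Idx)" "f - s \<in> I"
    using assms(4) by (auto simp: N_def eqv_def)
  from s(1) have "a * s * b \<in> N"
  proof (induction rule: free_mod.span_induct)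
    case base
    show ?case
      by (rule free_mod.subspaceI)
         (auto simp: N_I distrib_left distrib_right N_add smul_mult_left smul_mult_right N_smul)
  next
    case (step x)
    then show ?case using assms(3) by auto
  qed
  moreover have "eqv (a * f * b) (a * s * b)"
    using I_mult_r[OF I_mult_l[OF s(2) assms(1)] assms(2)]
    by (simp add: eqv_def left_diff_distrib right_diff_distrib)
  ultimately show ?thesis by (rule N_eqv[rotated])
qed

lemma set_zw: "u \<in> W \<or> k = 0 \<Longrightarrow> set (zw u k) \<subseteq> gens"
  using c_walk[of u] by (auto simp: zw_def awalk_def)

text \<open>The part of a basis word to the right of its first vertex; most cases of left
  multiplication leave it unchanged.\<close>

definition rest :: "'v \<Rightarrow> int \<Rightarrow> 'e list \<Rightarrow> ('v, 'e) lpa_gen list" where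
  "rest u k q = zw u k @ Vert u # map Ghost (rev q)"

lemma mword_rest: "mword ((p, u), k, (q, u)) = map Edge p @ [Vert u] @ rest u k q"
  by (simp add: mword_def rest_def)

lemma Idx_elim:
  assumes "i \<in> Idx"
  obtains p u k q where "i = ((p, u), k, (q, u))" "(p, u) \<in> BP" "(q, u) \<in> BP" "u \<notin> W \<longrightarrow> k = 0"
  using assms by (cases i) (auto simp: Idx_def)

lemma Idx_iff: "((p, u), k, (q, u')) \<in> Idx \<longleftrightarrow> (p, u) \<in> BP \<and> (q, u) \<in> BP \<and> u = u' \<and> (u \<notin> W \<longrightarrow> k = 0)"
  by (auto simp: Idx_def)

lemma set_rest:
  assumes "(q, u) \<in> BP" "u \<notin> W \<longrightarrow> k = 0"
  shows "set (rest u k q) \<subseteq> gens"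
  using set_zw[of u k] BP_facts(5)[OF assms(1)] Sp_verts[OF BP_facts(1)[OF assms(1)]] assms(2)
  by (auto simp: rest_def)

lemma set_mword: "i \<in> Idx \<Longrightarrow> set (mword i) \<subseteq> gens"
proof (erule Idx_elim)
  fix p u k q assume "i = ((p, u), k, (q, u))" "(p, u) \<in> BP" "(q, u) \<in> BP" "u \<notin> W \<longrightarrow> k = 0"
  then show ?thesis
    using set_rest[of q u k] BP_facts(5)[of p u] Sp_verts[OF BP_facts(1)[of p u]] by (auto simp: mword_rest)
qed

lemma m_F: "i \<in> Idx \<Longrightarrow> m i \<in> F"
  unfolding m_def by (rule F_simps(7)) (auto simp: set_mword, auto simp: mword_def split: prod.splits)

text \<open>For k \<ge> 0 this is concatenation. For k < 0 the new copy of the cycle cancels one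
  ghost copy, by c c^* = w.\<close>

lemma zw_Suc:
  assumes "w \<in> W"
  shows "eqv (wd ([Vert w] @ map Edge (c w) @ zw w k)) (wd ([Vert w] @ zw w (k + 1)) :: _ \<Rightarrow>\<^sub>0 'r::comm_ring_1)"
proof (cases "k \<ge> 0")
  case True
  then have "nat (k + 1) = Suc (nat k)" by simp
  then show ?thesis using True by (simp add: zw_def)
next
  case False
  then have k: "nat (- k) = Suc (nat (- (k + 1)))" by simp
  have zw: "zw w k = map Ghost (rev (c w)) @ zw w (k + 1)"
    using False unfolding zw_def k by (cases "k = -1") auto
  have w: "w \<in> verts E" using W_verts assms by auto
  have "eqv (wd ([Vert w] @ (map Edge (c w) @ map Ghost (rev (c w))) @ zw w (k + 1)))
     (wd ([Vert w] @ [Vert w] @ zw w (k + 1)) :: _ \<Rightarrow>\<^sub>0 'r)"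
    using w set_zw[of w "k + 1"] assms
    by (intro eqv_ctx word_walk_inverse[where 'r='r, OF c_walk[OF assms] c_ne[OF assms] c_no_exit[OF assms]]) auto
  also have "eqv (wd ([Vert w] @ [Vert w] @ zw w (k + 1))) (wd ([] @ [Vert w] @ zw w (k + 1)) :: _ \<Rightarrow>\<^sub>0 'r)"
    using eqv_ctx[OF word_relations(1)[where 'r='r, OF w], of "[]" "zw w (k + 1)"] set_zw[of w "k + 1"] assms by simp
  finally show ?thesis by (simp add: zw)
qed

text \<open>Both c w and w c are congruent to c, so w moves from the right of the cycle to its left,
  where \<open>zw_Suc\<close> applies.\<close>

lemma cycle_shift:
  assumes "w \<in> W" "set ws \<subseteq> gens"
  shows "eqv (wd (map Edge (c w) @ [Vert w] @ zw w k @ ws)) (wd ([Vert w] @ zw w (k + 1) @ ws) :: _ \<Rightarrow>\<^sub>0 'r::comm_ring_1)"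
proof -
  have w: "w \<in> verts E" using W_verts assms by auto
  have walk: "awalk w (c w) w" using c_walk assms by auto
  have cg: "set (map Edge (c w)) \<subseteq> gens" using walk by (auto simp: awalk_def)
  have rg: "set (zw w j @ ws) \<subseteq> gens" for j using set_zw[of w j] assms by auto
  obtain c' f where cf: "c w = c' @ [f]" using c_ne[OF assms(1)] by (cases "c w" rule: rev_cases) auto
  have f: "f \<in> arcs E" "head E f = w" using walk unfolding cf by (auto simp: awalk_Cons_iff)
  have c'g: "set (map Edge c') \<subseteq> gens" using cg cf by auto
  have "eqv (wd (map Edge c' @ [Edge f, Vert (head E f)] @ (zw w k @ ws)))
     (wd (map Edge c' @ [Edge f] @ (zw w k @ ws)) :: _ \<Rightarrow>\<^sub>0 'r)"
    by (rule eqv_ctx[OF word_relations(4)[where 'r='r, OF f(1)] c'g rg])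
  then have 1: "eqv (wd (map Edge (c w) @ [Vert w] @ zw w k @ ws)) (wd (map Edge (c w) @ zw w k @ ws) :: _ \<Rightarrow>\<^sub>0 'r)"
    by (simp add: cf f)
  have c: "map Edge (c w) = Edge (hd (c w)) # map Edge (tl (c w))"
    using hd_c(1)[OF assms(1)] by (metis list.simps(9))
  have "eqv (wd ([] @ [Vert (tail E (hd (c w))), Edge (hd (c w))] @ (map Edge (tl (c w)) @ zw w k @ ws)))
     (wd ([] @ [Edge (hd (c w))] @ (map Edge (tl (c w)) @ zw w k @ ws)) :: _ \<Rightarrow>\<^sub>0 'r)"
    by (rule eqv_ctx[OF word_relations(3)[where 'r='r, OF hd_c(3)[OF assms(1)]]]) (use cg c rg in auto)
  then have 2: "eqv (wd ([Vert w] @ map Edge (c w) @ zw w k @ ws)) (wd (map Edge (c w) @ zw w k @ ws) :: _ \<Rightarrow>\<^sub>0 'r)"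
    by (simp add: c hd_c(2)[OF assms(1)])
  have 3: "eqv (wd ([] @ ([Vert w] @ map Edge (c w) @ zw w k) @ ws)) (wd ([] @ ([Vert w] @ zw w (k + 1)) @ ws) :: _ \<Rightarrow>\<^sub>0 'r)"
    by (rule eqv_ctx[OF zw_Suc[where 'r='r, OF assms(1)]]) (use assms in auto)
  show ?thesis using eqv_trans[OF eqv_trans[OF 1 eqv_sym[OF 2]]] 3 by simp
qed

text \<open>Where a single arc leaves each vertex, two walks with the same start cannot diverge. The
  basis path cannot stop early, as the vertices before w are neither sinks nor in W, and it cannot
  go past w.\<close>

lemma forced_walk:
  assumes "awalk (src (p, u)) c' w" "(p, u) \<in> BP" "w \<in> W"
    "\<And>e. e \<in> set c' \<Longrightarrow> out_arcs E (tail E e) = {e} \<and> tail E e \<notin> W"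
  shows "p = c' \<and> u = w"
  using assms
proof (induction c' arbitrary: p)
  case Nil
  then have "src (p, u) \<in> Sp" by (auto simp: awalk_Nil_iff Sp_def)
  then show ?case using Nil src_not_Sp by (cases p) (auto simp: awalk_Nil_iff)
next
  case (Cons f c')
  have f: "f \<in> arcs E" "tail E f = src (p, u)" "awalk (head E f) c' w"
    using Cons.prems(1) by (auto simp: awalk_Cons_iff)
  have fo: "out_arcs E (tail E f) = {f}" "tail E f \<notin> W" using Cons.prems(4) by auto
  show ?case
  proof (cases p)
    case Nil
    then have "tail E f \<in> Sp" using f Cons.prems(2) by simp
    then show ?thesis using fo by (auto simp: Sp_def)
  next
    case p: (Cons g p')
    then have "g \<in> out_arcs E (tail E f)" using f Cons.prems(2) by simp
    then have gf: "g = f" using fo by simp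
    have p': "(p', u) \<in> BP" "src (p', u) = head E f" using Cons.prems(2) p gf by simp_all
    have "p' = c' \<and> u = w"
    proof (rule Cons.IH[OF _ p'(1) Cons.prems(3)])
      show "awalk (src (p', u)) c' w" using f p' by simp
      show "out_arcs E (tail E e) = {e} \<and> tail E e \<notin> W" if "e \<in> set c'" for e
        using Cons.prems(4) that by simp
    qed
    then show ?thesis using p gf by simp
  qed
qed

text \<open>The cycle without its first arc is a basis path: W is met only at the base point w, and
  that vertex is left only by the removed arc.\<close>

lemma tl_c:
  assumes "w \<in> W"
  shows "awalk (head E (hd (c w))) (tl (c w)) w" "e \<in> set (tl (c w)) \<Longrightarrow> tail E e \<notin> W"
    "(tl (c w), w) \<in> BP" "src (tl (c w), w) = head E (hd (c w))"
proof -
  have walk: "awalk w (hd (c w) # tl (c w)) w" using c_walk[OF assms] hd_c(1)[OF assms] by metis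
  then show 1: "awalk (head E (hd (c w))) (tl (c w)) w" by (simp add: awalk_Cons_iff)
  show 2: "tail E e \<notin> W" if "e \<in> set (tl (c w))" for e
  proof
    assume "tail E e \<in> W"
    moreover have "e \<in> set (c w)" using that c_ne[OF assms] by (metis list.set_sel(2))
    ultimately have "tail E e = w" using c_once[OF assms] by blast
    moreover have "distinct (tail E (hd (c w)) # map (tail E) (tl (c w)))"
      using c_distinct[OF assms] hd_c(1)[OF assms] by (metis list.simps(9))
    ultimately show False using that hd_c(2)[OF assms] by auto
  qed
  have "(p, w) \<in> BP \<and> src (p, w) = v" if "awalk v p w" "\<And>e. e \<in> set p \<Longrightarrow> tail E e \<notin> W" for p v
    using that
  proof (induction p arbitrary: v)
    case Nil
    then show ?case using assms by (auto simp: awalk_Nil_iff Sp_def)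
  next
    case (Cons e p)
    then show ?case by (auto simp: awalk_Cons_iff)
  qed
  from this[OF 1] 2 show "(tl (c w), w) \<in> BP" "src (tl (c w), w) = head E (hd (c w))" by auto
qed

lemma N_wd_m: "i \<in> Idx \<Longrightarrow> wd (mword i) \<in> (N :: (_ \<Rightarrow>\<^sub>0 'r::comm_ring_1) set)"
  using N_m[of i] unfolding m_def .

text \<open>A vertex is absorbed or gives 0. An arc lengthens p, unless it leaves W; then it closes
  p to a full cycle and raises k by one. A ghost arc cancels the first arc of p or gives 0; if p is
  empty, an arc is first borrowed from the cycle by lowering k.\<close>

lemma N_left_mult:
  assumes g: "g \<in> gens" and i: "i \<in> Idx"
  shows "wd (g # mword i) \<in> (N :: (_ \<Rightarrow>\<^sub>0 'r::comm_ring_1) set)"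
proof -
  obtain p u k q where i': "i = ((p, u), k, (q, u))" and p: "(p, u) \<in> BP" and q: "(q, u) \<in> BP"
    and k: "u \<notin> W \<longrightarrow> k = 0"
    using i by (rule Idx_elim)
  note rest = set_rest[OF q k]
  have walk: "awalk (src (p, u)) p u" using BP_facts(2)[OF p] .
  have u: "u \<in> verts E" "src (p, u) \<in> verts E" using walk Sp_verts[OF BP_facts(1)[OF p]] by auto
  have ghosts: "set (Vert v # map Ghost (rev q)) \<subseteq> gens" if "v \<in> verts E" for v
    using that BP_facts(5)[OF q] by auto
  have vert: "wd (Vert v # mword i) \<in> (N :: (_ \<Rightarrow>\<^sub>0 'r) set)" if v: "v \<in> verts E" for v
  proof (cases "v = src (p, u)")
    case True
    have "eqv (wd ([] @ (Vert v # map Edge p @ [Vert u]) @ rest u k q))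
       (wd ([] @ (map Edge p @ [Vert u]) @ rest u k q) :: _ \<Rightarrow>\<^sub>0 'r)"
      using word_walk_vertex[where 'r='r, OF walk] rest True by (intro eqv_ctx) auto
    then show ?thesis using N_wd_m[where 'r='r, OF i] N_eqv[where 'a='r] by (simp add: i' mword_rest)
  next
    case False
    have "wd ([] @ (Vert v # map Edge p @ [Vert u]) @ rest u k q) \<in> (I :: (_ \<Rightarrow>\<^sub>0 'r) set)"
      using word_walk_other_vertex[where 'r='r, OF walk v False] rest by (intro I_ctx) auto
    then show ?thesis using N_I[where 'a='r] by (simp add: i' mword_rest)
  qed
  show ?thesis
  proof (cases g)
    case (Vert v)
    then show ?thesis using g vert by simp
  next
    case (Edge e)
    then have e: "e \<in> arcs E" using g by simp
    show ?thesis
    proof (cases "head E e = src (p, u)")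
      case False
      have "wd ([Edge e] @ (Vert (head E e) # map Edge p @ [Vert u]) @ rest u k q) \<in> (I :: (_ \<Rightarrow>\<^sub>0 'r) set)"
        using word_walk_other_vertex[where 'r='r, OF walk head_in_verts[OF e] False] rest e by (intro I_ctx) auto
      moreover have "eqv (wd ([] @ [Edge e, Vert (head E e)] @ mword i)) (wd ([] @ [Edge e] @ mword i) :: _ \<Rightarrow>\<^sub>0 'r)"
        using word_relations(4)[where 'r='r, OF e] set_mword[OF i] by (intro eqv_ctx) auto
      ultimately have "wd (Edge e # mword i) \<in> (I :: (_ \<Rightarrow>\<^sub>0 'r) set)"
        using eqv_I[where 'a='r, OF eqv_sym] by (simp add: i' mword_rest)
      then show ?thesis using N_I[where 'a='r] Edge by simp
    next
      case True
      show ?thesis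
      proof (cases "tail E e \<in> W")
        case False
        then have "((e # p, u), k, (q, u)) \<in> Idx" using p q k e True by (simp add: Idx_iff)
        then show ?thesis using N_wd_m[where 'r='r, of "((e # p, u), k, (q, u))"] by (simp add: Edge i' mword_rest)
      next
        \<comment> \<open>No other arc than e leaves w, and from its head a basis path has no choice
          but to follow the rest of the cycle; so e p is the cycle at w.\<close>
        case w: True
        define w where "w = tail E e"
        have wW: "w \<in> W" using w by (simp add: w_def)
        have "out_arcs E w = {hd (c w)}"
          using c_no_exit[OF wW hd_in_set[OF c_ne[OF wW]]] hd_c(2)[OF wW] by simp
        moreover have "e \<in> out_arcs E w" using e by (simp add: w_def)
        ultimately have eh: "e = hd (c w)" by simp
        have pw: "p = tl (c w) \<and> u = w"
        proof (rule forced_walk[OF _ p wW])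
          show "awalk (src (p, u)) (tl (c w)) w" using tl_c(1)[OF wW] True eh by simp
          show "out_arcs E (tail E f) = {f} \<and> tail E f \<notin> W" if "f \<in> set (tl (c w))" for f
            using c_no_exit[OF wW list.set_sel(2)[OF c_ne[OF wW] that]] tl_c(2)[OF wW that] by simp
        qed
        have map_hd_tl: "map Edge (c w) = Edge (hd (c w)) # map Edge (tl (c w))"
          using hd_c(1)[OF wW] by (metis list.simps(9))
        have "g # mword i = map Edge (c w) @ [Vert w] @ zw w k @ (Vert w # map Ghost (rev q))"
          by (simp add: Edge i' mword_rest rest_def eh pw) (rule map_hd_tl[symmetric])
        moreover have "eqv (wd (map Edge (c w) @ [Vert w] @ zw w k @ (Vert w # map Ghost (rev q))))
            (wd (mword (([], w), k + 1, (q, w))) :: _ \<Rightarrow>\<^sub>0 'r)"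
          using cycle_shift[where 'r='r, OF wW ghosts[OF subsetD[OF W_verts wW]], of k]
          by (simp add: mword_rest rest_def)
        moreover have "(([], w), k + 1, (q, w)) \<in> Idx"
          using q wW pw by (simp add: Idx_iff Sp_def)
        ultimately show ?thesis using N_wd_m[where 'r='r] N_eqv[where 'a='r] by metis
      qed
    qed
  next
    case (Ghost e)
    then have e: "e \<in> arcs E" using g by simp
    \<comment> \<open>Stated for arbitrary f, p' and j, since it serves both for p = f p' and for
      the arc borrowed from the cycle, where the exponent has changed.\<close>
    have cancel: "wd (Ghost e # Edge f # map Edge p' @ [Vert u] @ rest u j q) \<in> (N :: (_ \<Rightarrow>\<^sub>0 'r) set)"
      if pf: "(p', u) \<in> BP" "f \<in> arcs E" "head E f = src (p', u)" and j: "u \<notin> W \<longrightarrow> j = 0" for f p' j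
    proof -
      have rest': "set (rest u j q) \<subseteq> gens" using set_rest[OF q] j by simp
      have Eg: "set (map Edge p' @ [Vert u]) \<subseteq> gens" using BP_facts(5)[OF pf(1)] u by auto
      show ?thesis
      proof (cases "e = f")
        case True
        have walk': "awalk (head E e) p' u" using BP_facts(2)[OF pf(1)] pf(3) True by simp
        have "eqv (wd ([] @ [Ghost e, Edge e] @ (map Edge p' @ [Vert u] @ rest u j q)))
           (wd ([] @ [Vert (head E e)] @ (map Edge p' @ [Vert u] @ rest u j q)) :: _ \<Rightarrow>\<^sub>0 'r)"
          using word_relations(7)[where 'r='r, OF e] Eg rest' by (intro eqv_ctx) auto
        also have "eqv \<dots> (wd ([] @ (map Edge p' @ [Vert u]) @ rest u j q) :: _ \<Rightarrow>\<^sub>0 'r)"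
          using eqv_ctx[OF word_walk_vertex[where 'r='r, OF walk'], of "[]" "rest u j q"] rest' by simp
        finally have "eqv (wd (Ghost e # Edge f # map Edge p' @ [Vert u] @ rest u j q))
           (wd (mword ((p', u), j, (q, u))) :: _ \<Rightarrow>\<^sub>0 'r)"
          using True by (simp add: mword_rest)
        moreover have "((p', u), j, (q, u)) \<in> Idx" using pf q j by (simp add: Idx_iff)
        ultimately show ?thesis using N_wd_m[where 'r='r] N_eqv[where 'a='r] by metis
      next
        case False
        have "wd ([] @ [Ghost e, Edge f] @ (map Edge p' @ [Vert u] @ rest u j q)) \<in> (I :: (_ \<Rightarrow>\<^sub>0 'r) set)"
          using word_relations(8)[where 'r='r, OF e pf(2) False] Eg rest' by (intro I_ctx) auto
        then show ?thesis using N_I[where 'a='r] by simp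
      qed
    qed
    show ?thesis
    proof (cases p)
      case (Cons f p')
      then show ?thesis
        using cancel[of p' f k] p k by (simp add: Ghost i' mword_rest)
    next
      case Nil
      show ?thesis
      proof (cases "tail E e = u")
        case False
        have "eqv (wd ([] @ [Ghost e, Vert (tail E e)] @ ([Vert u] @ rest u k q)))
            (wd ([] @ [Ghost e] @ ([Vert u] @ rest u k q)) :: _ \<Rightarrow>\<^sub>0 'r)"
          using word_relations(6)[where 'r='r, OF e] rest u by (intro eqv_ctx) auto
        moreover have "wd ([Ghost e] @ [Vert (tail E e), Vert u] @ rest u k q) \<in> (I :: (_ \<Rightarrow>\<^sub>0 'r) set)"
          using word_relations(2)[where 'r='r, OF tail_in_verts[OF e] u(1) False] rest e by (intro I_ctx) auto
        ultimately have "wd (Ghost e # mword i) \<in> (I :: (_ \<Rightarrow>\<^sub>0 'r) set)"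
          using eqv_I[where 'a='r, OF eqv_sym] by (simp add: i' mword_rest Nil)
        then show ?thesis using N_I[where 'a='r] Ghost by simp
      next
        case True
        \<comment> \<open>The arc e leaves u, so u is no sink. Writing c_u^k as c_u c_u^(k-1) brings
          the first arc of the cycle next to e^*.\<close>
        then have uW: "u \<in> W" using BP_facts(1)[OF p] e by (auto simp: Sp_def)
        have "eqv (wd (map Edge (c u) @ [Vert u] @ zw u (k - 1) @ (Vert u # map Ghost (rev q))))
            (wd (mword i) :: _ \<Rightarrow>\<^sub>0 'r)"
          using cycle_shift[where 'r='r, OF uW ghosts[OF u(1)], of "k - 1"]
          by (simp add: mword_rest rest_def i' Nil)
        from eqv_ctx[OF this, of "[Ghost e]" "[]"]
        have "eqv (wd (Ghost e # map Edge (c u) @ [Vert u] @ rest u (k - 1) q))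
            (wd (Ghost e # mword i) :: _ \<Rightarrow>\<^sub>0 'r)"
          using e by (simp add: rest_def)
        moreover have "Ghost e # map Edge (c u) @ [Vert u] @ rest u (k - 1) q =
            Ghost e # Edge (hd (c u)) # map Edge (tl (c u)) @ [Vert u] @ rest u (k - 1) q"
          using hd_c(1)[OF uW] by (metis append_Cons list.simps(9))
        moreover have "wd (Ghost e # Edge (hd (c u)) # map Edge (tl (c u)) @ [Vert u] @ rest u (k - 1) q) \<in> (N :: (_ \<Rightarrow>\<^sub>0 'r) set)"
          using tl_c[OF uW] hd_c(3)[OF uW] uW by (intro cancel) auto
        ultimately show ?thesis using N_eqv[where 'a='r, OF eqv_sym] Ghost by metis
      qed
    qed
  qed
qed

text \<open>Such a ghost arc lengthens q, or gives 0 if it does not fit. These are the ghost arcs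
  that the vertex sums at vertices outside \<open>Sp\<close> produce.\<close>

lemma N_right_ghost:
  assumes e: "e \<in> arcs E" "tail E e \<notin> W" and i: "i \<in> Idx"
  shows "wd (mword i @ [Ghost e]) \<in> (N :: (_ \<Rightarrow>\<^sub>0 'r::comm_ring_1) set)"
proof -
  obtain p u k q where i': "i = ((p, u), k, (q, u))" and p: "(p, u) \<in> BP" and q: "(q, u) \<in> BP"
    and k: "u \<notin> W \<longrightarrow> k = 0"
    using i by (rule Idx_elim)
  have walk: "awalk (src (q, u)) q u" using BP_facts(2)[OF q] .
  show ?thesis
  proof (cases "head E e = src (q, u)")
    case True
    then have "((p, u), k, (e # q, u)) \<in> Idx" using p q k e by (simp add: Idx_iff)
    then show ?thesis using N_wd_m[where 'r='r, of "((p, u), k, (e # q, u))"] by (simp add: i' mword_rest rest_def)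
  next
    case False
    let ?a = "map Edge p @ [Vert u] @ zw u k"
    have a: "set ?a \<subseteq> gens"
      using set_mword[OF i] by (auto simp: i' mword_rest rest_def)
    have "wd (?a @ (Vert u # map Ghost (rev q) @ [Vert (head E e)]) @ [Ghost e]) \<in> (I :: (_ \<Rightarrow>\<^sub>0 'r) set)"
      by (rule I_ctx[OF word_ghost_walk_other_vertex[where 'r='r, OF walk head_in_verts[OF e(1)] False] a]) (simp add: e)
    moreover have "eqv (wd (mword i @ [Vert (head E e), Ghost e] @ [])) (wd (mword i @ [Ghost e] @ []) :: _ \<Rightarrow>\<^sub>0 'r)"
      by (rule eqv_ctx[OF word_relations(5)[where 'r='r, OF e(1)] set_mword[OF i]]) simp
    ultimately have "wd (mword i @ [Ghost e]) \<in> (I :: (_ \<Rightarrow>\<^sub>0 'r) set)"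
      using eqv_I[where 'a='r, OF eqv_sym] by (simp add: i' mword_rest rest_def)
    then show ?thesis by (rule N_I[where 'a='r])
  qed
qed

lemma N_gen_mult: "g \<in> gens \<Longrightarrow> f \<in> N \<Longrightarrow> wd [g] * f \<in> N"
  using N_mult[of "wd [g]" 1 f] N_left_mult[where 'r='a, of g] by (simp add: m_def wd_mult)

lemma N_mult_ghost: "e \<in> arcs E \<Longrightarrow> tail E e \<notin> W \<Longrightarrow> f \<in> N \<Longrightarrow> f * wd [Ghost e] \<in> N"
  using N_mult[of 1 "wd [Ghost e]" f] N_right_ghost[where 'r='a, of e] by (simp add: m_def wd_mult)

text \<open>Induction along \<open>free_step\<close>. For v in \<open>Sp\<close> the word v v is a
  basis word. Otherwise v is the sum of the products e r(e) e^*, whose middle factors are covered by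
  the induction hypothesis.\<close>

lemma N_vert:
  assumes "v \<in> verts E"
  shows "wd [Vert v] \<in> (N :: (_ \<Rightarrow>\<^sub>0 'r::comm_ring_1) set)"
  using wf_free_step assms
proof (induction v)
  case (less v)
  show ?case
  proof (cases "v \<in> Sp")
    case True
    then have "(([], v), 0, ([], v)) \<in> Idx" by (simp add: Idx_iff)
    from N_wd_m[where 'r='r, OF this] have "wd [Vert v, Vert v] \<in> (N :: (_ \<Rightarrow>\<^sub>0 'r) set)"
      by (simp add: mword_def zw_def)
    then show ?thesis using N_eqv[where 'a='r, OF eqv_sym[OF word_relations(1)[where 'r='r, OF less.prems]]] by simp
  next
    case False
    have fin: "finite (out_arcs E v)" using finite_arcs by (simp add: out_arcs_def)
    have "wd [Edge e, Ghost e] \<in> (N :: (_ \<Rightarrow>\<^sub>0 'r) set)" if "e \<in> out_arcs E v" for e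
    proof -
      have e: "e \<in> arcs E" "tail E e = v" "tail E e \<notin> W" using that False by (auto simp: Sp_def)
      then have "(head E e, v) \<in> free_step" by (auto simp: free_step_def)
      then have "wd [Vert (head E e)] \<in> (N :: (_ \<Rightarrow>\<^sub>0 'r) set)" using less.IH e by simp
      then have "wd [Edge e] * (wd [Vert (head E e)] * wd [Ghost e]) \<in> (N :: (_ \<Rightarrow>\<^sub>0 'r) set)"
        using e by (intro N_gen_mult[where 'a='r] N_mult_ghost[where 'a='r]) simp_all
      then have "wd ([Edge e, Vert (head E e), Ghost e]) \<in> (N :: (_ \<Rightarrow>\<^sub>0 'r) set)" by (simp add: wd_mult)
      moreover have "eqv (wd ([] @ [Edge e] @ [Ghost e])) (wd ([] @ [Edge e, Vert (head E e)] @ [Ghost e]) :: _ \<Rightarrow>\<^sub>0 'r)"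
        using e by (intro eqv_ctx eqv_sym[OF word_relations(4)[where 'r='r]]) auto
      ultimately show ?thesis using N_eqv[where 'a='r] by simp
    qed
    then have "(\<Sum>e\<in>out_arcs E v. wd [Edge e, Ghost e]) \<in> (N :: (_ \<Rightarrow>\<^sub>0 'r) set)" by (rule N_sum)
    moreover have "out_arcs E v \<noteq> {}" using False less.prems by (auto simp: Sp_def)
    ultimately show ?thesis using N_eqv[where 'a='r, OF word_vertex_sum[where 'r='r]] less.prems fin by blast
  qed
qed

text \<open>Words are built from the right by left multiplications. The last letter is a vertex or
  equals itself times a vertex.\<close>

lemma F_subset_N: "F \<subseteq> (N :: (_ \<Rightarrow>\<^sub>0 'r::comm_ring_1) set)"
proof
  have word: "wd ws \<in> (N :: (_ \<Rightarrow>\<^sub>0 'r) set)" if "ws \<noteq> []" "set ws \<subseteq> gens" for ws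
    using that
  proof (induction ws rule: list_nonempty_induct)
    case (single g)
    show ?case
    proof (cases g)
      case (Vert v)
      then show ?thesis using single N_vert[where 'r='r] by simp
    next
      case (Edge e)
      then have "wd [Edge e] * wd [Vert (head E e)] \<in> (N :: (_ \<Rightarrow>\<^sub>0 'r) set)"
        using single by (intro N_gen_mult[where 'a='r] N_vert[where 'r='r]) auto
      then show ?thesis
        using N_eqv[where 'a='r, OF eqv_sym[OF word_relations(4)[where 'r='r, of e]]] single by (simp add: wd_mult Edge)
    next
      case (Ghost e)
      then have "wd [Ghost e] * wd [Vert (tail E e)] \<in> (N :: (_ \<Rightarrow>\<^sub>0 'r) set)"
        using single by (intro N_gen_mult[where 'a='r] N_vert[where 'r='r]) auto
      then show ?thesis
        using N_eqv[where 'a='r, OF eqv_sym[OF word_relations(6)[where 'r='r, of e]]] single by (simp add: wd_mult Ghost)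
    qed
  next
    case (cons g ws)
    then show ?case using N_gen_mult[where 'a='r, of g "wd ws"] by (simp add: wd_mult)
  qed
  fix f :: "_ \<Rightarrow>\<^sub>0 'r" assume f: "f \<in> F"
  have "Poly_Mapping.single w (Poly_Mapping.lookup f w) \<in> N" if w: "w \<in> Poly_Mapping.keys f" for w
  proof -
    obtain ws where ws: "w = FMon ws" by (cases w)
    have "ws \<noteq> []" using f w ws by (auto simp: F_iff in_keys_iff FMon_Nil)
    moreover have "set (letters w) \<subseteq> gens" using f w by (simp add: F_iff F1_def carrier_free_algebra)
    then have "set ws \<subseteq> gens" by (simp add: ws)
    ultimately have "smul (Poly_Mapping.lookup f w) (wd ws) \<in> N" using word N_smul[where 'a='r] by blast
    then show ?thesis by (simp add: smul_def mult_single ws)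
  qed
  then have "(\<Sum>w\<in>Poly_Mapping.keys f. Poly_Mapping.single w (Poly_Mapping.lookup f w)) \<in> N" by (rule N_sum)
  then show "f \<in> N" using poly_mapping_sum_single[of f] by simp
qed

end

section \<open>Rings of block matrices\<close>

text \<open>
  The matrices are indexed by \<open>Y\<close>, with one block for each value of the function \<open>en\<close> on \<open>Y\<close>; the
  entries of a block are arbitrary Laurent polynomials if this value is in \<open>W\<close>, constants otherwise.
\<close>

definition entries :: "'u set \<Rightarrow> 'u \<Rightarrow> 'r::comm_ring_1 laurent set" where
  "entries W u = (if u \<in> W then UNIV else range (Poly_Mapping.single 0))"

definition bmat :: "'y set \<Rightarrow> ('y \<Rightarrow> 'u) \<Rightarrow> 'u set \<Rightarrow> ('y \<Rightarrow> 'y \<Rightarrow> 'r::comm_ring_1 laurent) ring" where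
  "bmat Y en W =
     \<lparr>carrier = {g. \<forall>b a. g b a \<in> (if b \<in> Y \<and> a \<in> Y \<and> en b = en a then entries W (en b) else {0})},
      mult = (\<lambda>g h b a. \<Sum>y\<in>Y. g b y * h y a),
      one = (\<lambda>b a. if b = a \<and> b \<in> Y then 1 else 0), zero = (\<lambda>b a. 0), add = (\<lambda>g h b a. g b a + h b a)\<rparr>"

lemma bmat_sel [simp]:
  "mult (bmat Y en W) = (\<lambda>g h b a. \<Sum>y\<in>Y. g b y * h y a)"
  "one (bmat Y en W) = (\<lambda>b a. if b = a \<and> b \<in> Y then 1 else 0)"
  "zero (bmat Y en W) = (\<lambda>b a. 0)" "add (bmat Y en W) = (\<lambda>g h b a. g b a + h b a)"
  by (simp_all add: bmat_def)

lemma bmat_carrier: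
  "g \<in> carrier (bmat Y en W) \<longleftrightarrow>
    (\<forall>b a. g b a \<in> (if b \<in> Y \<and> a \<in> Y \<and> en b = en a then entries W (en b) else {0}))"
  by (simp add: bmat_def)

lemma entries_simps [simp]:
  fixes x y :: "'r::comm_ring_1 laurent"
  shows "0 \<in> (entries W u :: 'r laurent set)" "1 \<in> (entries W u :: 'r laurent set)"
    "Poly_Mapping.single 0 r \<in> (entries W u :: 'r laurent set)"
    "x \<in> entries W u \<Longrightarrow> y \<in> entries W u \<Longrightarrow> x + y \<in> entries W u"
    "x \<in> entries W u \<Longrightarrow> - x \<in> entries W u"
    "x \<in> entries W u \<Longrightarrow> y \<in> entries W u \<Longrightarrow> x * y \<in> entries W u"
proof -
  have "(0 :: 'r laurent) \<in> range (Poly_Mapping.single 0)" "(1 :: 'r laurent) \<in> range (Poly_Mapping.single 0)"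
    by (rule range_eqI[of _ _ 0], simp, rule range_eqI[of _ _ 1], simp)
  then show "0 \<in> (entries W u :: 'r laurent set)" "1 \<in> (entries W u :: 'r laurent set)"
    by (simp_all add: entries_def)
  show "Poly_Mapping.single 0 r \<in> (entries W u :: 'r laurent set)" by (simp add: entries_def)
  show "x \<in> entries W u \<Longrightarrow> y \<in> entries W u \<Longrightarrow> x + y \<in> entries W u"
    "x \<in> entries W u \<Longrightarrow> - x \<in> entries W u"
    "x \<in> entries W u \<Longrightarrow> y \<in> entries W u \<Longrightarrow> x * y \<in> entries W u"
    by (auto simp: entries_def single_add[symmetric] single_uminus[symmetric] single_0_mult[symmetric])
qed

lemma entries_sum: "(\<And>i. i \<in> A \<Longrightarrow> h i \<in> entries W u) \<Longrightarrow> sum h A \<in> entries W u"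
  by (induction A rule: infinite_finite_induct) auto

lemma bmat_carrierD:
  assumes "g \<in> carrier (bmat Y en W)"
  shows "b \<in> Y \<Longrightarrow> a \<in> Y \<Longrightarrow> en b = en a \<Longrightarrow> g b a \<in> entries W (en b)"
    "b \<notin> Y \<or> a \<notin> Y \<or> en b \<noteq> en a \<Longrightarrow> g b a = 0"
    "b \<in> Y \<Longrightarrow> a \<in> Y \<Longrightarrow> en b = en a \<Longrightarrow> g b a \<in> entries W (en a)"
  using assms unfolding bmat_carrier by (metis, metis singletonD, metis)

lemma bmat_carrierI:
  assumes "\<And>b a. b \<in> Y \<Longrightarrow> a \<in> Y \<Longrightarrow> en b = en a \<Longrightarrow> g b a \<in> entries W (en b)"
    "\<And>b a. b \<notin> Y \<or> a \<notin> Y \<or> en b \<noteq> en a \<Longrightarrow> g b a = 0"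
  shows "g \<in> carrier (bmat Y en W)"
  unfolding bmat_carrier using assms by auto

lemma bmat_mult_closed:
  assumes g: "g \<in> carrier (bmat Y en W)" and h: "h \<in> carrier (bmat Y en W)"
  shows "(\<lambda>b a. \<Sum>y\<in>Y. g b y * h y a) \<in> carrier (bmat Y en W)"
proof (rule bmat_carrierI)
  fix b a assume ba: "b \<in> Y" "a \<in> Y" "en b = en a"
  have "g b y * h y a \<in> entries W (en b)" if "y \<in> Y" for y
  proof (cases "en b = en y")
    case True
    then show ?thesis using bmat_carrierD(1)[OF g ba(1) that] bmat_carrierD(1)[OF h that ba(2)] ba by simp
  next
    case False
    then show ?thesis using bmat_carrierD(2)[OF g] by simp
  qed
  then show "(\<Sum>y\<in>Y. g b y * h y a) \<in> entries W (en b)" by (rule entries_sum)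
next
  fix b a assume ba: "b \<notin> Y \<or> a \<notin> Y \<or> en b \<noteq> en a"
  have "g b y = 0 \<or> h y a = 0" for y
    using bmat_carrierD(2)[OF g, of b y] bmat_carrierD(2)[OF h, of y a] ba by metis
  then have "g b y * h y a = 0" for y
    by (metis mult_zero_left mult_zero_right)
  then show "(\<Sum>y\<in>Y. g b y * h y a) = 0" by simp
qed

lemma nonunital_ring_bmat: "nonunital_ring (bmat Y en W :: ('y \<Rightarrow> 'y \<Rightarrow> 'r::comm_ring_1 laurent) ring)"
proof -
  let ?B = "bmat Y en W :: ('y \<Rightarrow> 'y \<Rightarrow> 'r laurent) ring"
  have "abelian_group ?B"
  proof (rule abelian_groupI)
    fix g assume g: "g \<in> carrier ?B"
    have "(\<lambda>b a. - g b a) \<in> carrier ?B"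
      by (rule bmat_carrierI) (simp_all add: bmat_carrierD[OF g])
    then show "\<exists>h\<in>carrier ?B. h \<oplus>\<^bsub>?B\<^esub> g = \<zero>\<^bsub>?B\<^esub>"
      by (intro bexI[of _ "\<lambda>b a. - g b a"]) simp_all
  next
    fix g h assume g: "g \<in> carrier ?B" and h: "h \<in> carrier ?B"
    show "g \<oplus>\<^bsub>?B\<^esub> h \<in> carrier ?B"
      by (rule bmat_carrierI) (simp_all add: bmat_carrierD[OF g] bmat_carrierD[OF h])
  next
    show "\<zero>\<^bsub>?B\<^esub> \<in> carrier ?B" by (rule bmat_carrierI) simp_all
  qed (simp_all add: add_ac)
  then show ?thesis
  proof (rule nonunital_ring.intro, unfold_locales)
    fix f g h :: "'y \<Rightarrow> 'y \<Rightarrow> 'r laurent"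
    show "f \<otimes>\<^bsub>?B\<^esub> g \<otimes>\<^bsub>?B\<^esub> h = f \<otimes>\<^bsub>?B\<^esub> (g \<otimes>\<^bsub>?B\<^esub> h)"
      unfolding bmat_sel by (intro ext, simp only: sum_distrib_left sum_distrib_right mult.assoc) (rule sum.swap)
  qed (simp_all add: bmat_mult_closed distrib_left distrib_right sum.distrib)
qed

section \<open>The matrices of the operators\<close>

context ne_graph
begin

text \<open>The matrix of the operator with respect to the indicators of the points
  \<open>pt b\<close>; columns are indexed by a. It is extended by 0 so that matrices can be
  compared as functions.\<close>

definition ent :: "(('v, 'e) lpa_gen free_monoid \<Rightarrow>\<^sub>0 'r::comm_ring_1) \<Rightarrow> 'e list \<times> 'v \<Rightarrow> 'e list \<times> 'v \<Rightarrow> 'r laurent" where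
  "ent f b a = (if b \<in> BP \<and> a \<in> BP then app (\<rho> f) (delta (pt a)) (pt b) else 0)"

lemma \<rho>_smul: "\<rho> (smul r f) = scal r * \<rho> f"
  by (simp add: smul_def ev_const)

lemma ent_add: "ent (f + g) b a = ent f b a + ent g b a"
  by (simp add: ent_def)

lemma ent_smul: "ent (smul r f) b a = Poly_Mapping.single 0 r * ent f b a"
  by (simp add: ent_def \<rho>_smul app_scal)

lemma ent_zero [simp]: "ent 0 b a = 0"
  by (simp add: ent_def)

lemma ent_sum: "ent (sum h A) b a = (\<Sum>i\<in>A. ent (h i) b a)"
  by (induction A rule: infinite_finite_induct) (auto simp: ent_add)

lemma ent_eqv: "eqv f g \<Longrightarrow> ent f = ent g"
  using \<rho>_I[of "f - g"] by (intro ext) (simp add: eqv_def ent_def)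

lemma ent_m:
  assumes "(b, k, b') \<in> Idx"
  shows "ent (m (b, k, b')) d a = (if d = b \<and> a = b' then mono_t k else 0)"
proof (cases "d \<in> BP \<and> a \<in> BP")
  case True
  then have "pt d = pt b \<longleftrightarrow> d = b"
    using inj_on_pt assms by (auto simp: Idx_def inj_on_def)
  then show ?thesis using \<rho>_m_delta[where 'r='a, OF assms, of a] True by (auto simp: ent_def)
next
  case False
  then show ?thesis using assms by (auto simp: ent_def Idx_def)
qed

lemma F_span: "f \<in> F \<Longrightarrow> \<exists>s\<in>free_mod.span (m ` Idx). eqv f s"
  using F_subset_N by (auto simp: N_def)

lemma app_sum_scale:
  assumes "finite B"
  shows "app \<psi> (\<lambda>x. \<Sum>b\<in>B. h b * y b x) x' = (\<Sum>b\<in>B. h b * app \<psi> (y b) x')"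
  using assms
proof (induction B)
  case empty
  then show ?case by simp
next
  case (insert b B)
  have "app \<psi> (\<lambda>x. \<Sum>b\<in>insert b B. h b * y b x) x' = app \<psi> (\<lambda>x. h b * y b x + (\<Sum>b\<in>B. h b * y b x)) x'"
    using insert by simp
  also have "\<dots> = h b * app \<psi> (y b) x' + (\<Sum>b\<in>B. h b * app \<psi> (y b) x')"
    using insert by (simp only: app_add app_scale)
  finally show ?case using insert by simp
qed

text \<open>The span of the indicators of these finitely many points is stable: this holds for the
  elements \<open>m i\<close>, hence for everything they span. It makes \<open>ent\<close>
  multiplicative.\<close>

lemma \<rho>_delta_expand:
  assumes f: "f \<in> F" and a: "a \<in> BP"
  shows "app (\<rho> f) (delta (pt a)) = (\<lambda>x. \<Sum>b\<in>BP. ent f b a * (delta (pt b) x :: 'r::comm_ring_1 laurent))"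
proof -
  obtain s where s: "s \<in> free_mod.span (m ` Idx)" "eqv f s" using F_span[OF f] by blast
  from s(1) have expand: "app (\<rho> s) (delta (pt a)) x = (\<Sum>b\<in>BP. ent s b a * (delta (pt b) x :: 'r laurent))" for x
  proof (induction rule: free_mod.span_induct)
    case base
    show ?case
      by (rule free_mod.subspaceI)
         (simp_all add: ent_add ent_smul \<rho>_smul app_scal distrib_right sum.distrib sum_distrib_left mult.assoc)
  next
    case (step z)
    then obtain b k b' where z: "z = m (b, k, b')" "(b, k, b') \<in> Idx" by auto
    have bBP: "b \<in> BP" using z(2) by (simp add: Idx_def)
    have "(\<Sum>d\<in>BP. ent z d a * (delta (pt d) x :: 'r laurent)) =
        (\<Sum>d\<in>BP. if d = b then (if a = b' then mono_t k * delta (pt b) x else 0) else 0)"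
      by (rule sum.cong) (auto simp: z ent_m)
    also have "\<dots> = (if a = b' then mono_t k * delta (pt b) x else 0)"
      using finite_BP bBP by simp
    finally show ?case using \<rho>_m_delta[where 'r='r, OF z(2) a] by (simp add: z)
  qed
  have "\<rho> f = \<rho> s" using \<rho>_I[of "f - s"] s(2) by (simp add: eqv_def)
  then show ?thesis using expand by (intro ext) (simp only: ent_eqv[OF s(2)])
qed

lemma ent_mult:
  assumes "g \<in> F"
  shows "ent (f * g) b a = (\<Sum>y\<in>BP. ent f b y * ent g y a)"
proof (cases "b \<in> BP \<and> a \<in> BP")
  case True
  then have "ent (f * g) b a = app (\<rho> f) (\<lambda>x. \<Sum>y\<in>BP. ent g y a * delta (pt y) x) (pt b)"
    using \<rho>_delta_expand[OF assms, of a] by (simp add: ent_def)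
  also have "\<dots> = (\<Sum>y\<in>BP. ent g y a * app (\<rho> f) (delta (pt y)) (pt b))"
    by (rule app_sum_scale[OF finite_BP])
  also have "\<dots> = (\<Sum>y\<in>BP. ent f b y * ent g y a)"
    using True by (intro sum.cong) (simp_all add: ent_def mult.commute)
  finally show ?thesis .
next
  case False
  then show ?thesis by (auto simp: ent_def)
qed

lemma ent_carrier:
  assumes "f \<in> F"
  shows "ent f \<in> carrier (bmat BP snd W)"
proof -
  obtain s where s: "s \<in> free_mod.span (m ` Idx)" "eqv f s" using F_span[OF assms] by blast
  from s(1) have "ent s \<in> carrier (bmat BP snd W)"
  proof (induction rule: free_mod.span_induct)
    case base
    show ?case
    proof (rule free_mod.subspaceI; unfold mem_Collect_eq)
      show "ent 0 \<in> carrier (bmat BP snd W)" by (rule bmat_carrierI) simp_all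
    next
      fix x y :: "('v, 'e) lpa_gen free_monoid \<Rightarrow>\<^sub>0 'a"
      assume x: "ent x \<in> carrier (bmat BP snd W)" and y: "ent y \<in> carrier (bmat BP snd W)"
      show "ent (x + y) \<in> carrier (bmat BP snd W)"
        by (rule bmat_carrierI) (simp_all add: ent_add bmat_carrierD[OF x] bmat_carrierD[OF y])
    next
      fix r and x :: "('v, 'e) lpa_gen free_monoid \<Rightarrow>\<^sub>0 'a"
      assume x: "ent x \<in> carrier (bmat BP snd W)"
      show "ent (smul r x) \<in> carrier (bmat BP snd W)"
        by (rule bmat_carrierI) (simp_all add: ent_smul bmat_carrierD[OF x])
    qed
  next
    case (step z)
    then obtain b k b' where z: "z = m (b, k, b')" "(b, k, b') \<in> Idx" by auto
    then have "b \<in> BP" "b' \<in> BP" "snd b = snd b'" "snd b \<notin> W \<Longrightarrow> k = 0" by (auto simp: Idx_def)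
    then have "mono_t k \<in> entries W (snd b)"
      by (cases "snd b \<in> W") (simp add: entries_def, simp)
    with \<open>b \<in> BP\<close> \<open>b' \<in> BP\<close> \<open>snd b = snd b'\<close> show ?case
      unfolding z(1) by (intro bmat_carrierI) (auto simp: ent_m[OF z(2)])
  qed
  then show ?thesis using ent_eqv[OF s(2)] by simp
qed

lemma ent_surj:
  assumes g: "g \<in> carrier (bmat BP snd W)"
  shows "\<exists>f\<in>F. ent f = g"
proof -
  \<comment> \<open>\<open>T b a\<close> lifts a single entry: its coefficient at t^k becomes that
    of \<open>m (b, k, a)\<close>. Constant entries use only k = 0, so these triples are admissible
    indices.\<close>
  define T where "T b a = (\<Sum>k\<in>Poly_Mapping.keys (g b a). smul (Poly_Mapping.lookup (g b a) k) (m (b, k, a)))" for b a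
  have Idx: "(b, k, a) \<in> Idx" if "k \<in> Poly_Mapping.keys (g b a)" for b a k
  proof -
    have ne: "g b a \<noteq> 0" using that by auto
    then have ba: "b \<in> BP" "a \<in> BP" "snd b = snd a" using bmat_carrierD(2)[OF g, of b a] by blast+
    then have "g b a \<in> entries W (snd b)" using bmat_carrierD(1)[OF g] by blast
    then have "snd b \<notin> W \<longrightarrow> k = 0" using that by (auto simp: entries_def split: if_splits)
    then show ?thesis using ba by (simp add: Idx_def)
  qed
  have T: "ent (T b a) d e = (if d = b \<and> e = a then g b a else 0)" for b a d e
  proof -
    have "ent (T b a) d e = (\<Sum>k\<in>Poly_Mapping.keys (g b a). if d = b \<and> e = a then Poly_Mapping.single k (Poly_Mapping.lookup (g b a) k) else 0)"
      unfolding T_def ent_sum ent_smul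
      by (rule sum.cong) (simp_all add: ent_m[OF Idx] mono_t_def mult_single)
    then show ?thesis
    proof (cases "d = b \<and> e = a")
      case True
      then show ?thesis
        using \<open>ent (T b a) d e = _\<close> by (simp flip: poly_mapping_sum_single)
    next
      case False
      then show ?thesis
        using \<open>ent (T b a) d e = _\<close> by (simp only: if_not_P[OF False] if_False sum.neutral_const)
    qed
  qed
  have TF: "T b a \<in> F" for b a
    unfolding T_def smul_def by (intro F_sum F_simps(4) m_F Idx) simp_all
  have "ent (\<Sum>b\<in>BP. \<Sum>a\<in>BP. T b a) d e = g d e" for d e
  proof -
    have "ent (\<Sum>b\<in>BP. \<Sum>a\<in>BP. T b a) d e = (\<Sum>b\<in>BP. if b = d then (\<Sum>a\<in>BP. if a = e then g d e else 0) else 0)"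
      unfolding ent_sum T by (intro sum.cong) (auto intro: sum.cong)
    also have "\<dots> = g d e"
      using finite_BP bmat_carrierD(2)[OF g, of d e] by auto
    finally show ?thesis .
  qed
  moreover have "(\<Sum>b\<in>BP. \<Sum>a\<in>BP. T b a) \<in> F"
    using TF by (intro F_sum) auto
  ultimately show ?thesis by (intro bexI[of _ "\<Sum>b\<in>BP. \<Sum>a\<in>BP. T b a"]) (auto simp: fun_eq_iff)
qed

text \<open>Distinct basis words differ in the position of their only entry or in its exponent, so
  each coefficient of a combination can be read off from its matrix. Thus spanning and a vanishing
  matrix force all coefficients to be 0.\<close>

lemma ent_inj:
  assumes f: "f \<in> F" and zero: "ent f = (\<lambda>b a. 0)"
  shows "f \<in> I"
proof -
  obtain s where s: "s \<in> free_mod.span (m ` Idx)" "eqv f s" using F_span[OF f] by blast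
  then obtain t r where t: "finite t" "t \<subseteq> m ` Idx" "s = (\<Sum>z\<in>t. smul (r z) z)"
    unfolding free_mod.span_explicit by blast
  have "r z = 0" if "z \<in> t" for z
  proof -
    have "z \<in> m ` Idx" using t(2) that by blast
    then obtain b k b' where z: "z = m (b, k, b')" "(b, k, b') \<in> Idx" by auto
    have lookup: "Poly_Mapping.lookup (ent (smul (r z') z') b b') k = (if z' = z then r z else 0)" if z': "z' \<in> t" for z'
    proof -
      have "z' \<in> m ` Idx" using t(2) z' by blast
      then obtain d j d' where i: "z' = m (d, j, d')" "(d, j, d') \<in> Idx" by auto
      have "Poly_Mapping.lookup (ent (smul (r z') z') b b') k = (if b = d \<and> b' = d' \<and> k = j then r z' else 0)"
        by (auto simp: i(1) ent_smul ent_m[OF i(2)] lookup_single_times mono_t_def lookup_single when_def)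
      \<comment> \<open>The combination runs over a set of elements and not of indices, so equality
        of elements has to be traced back to indices through the matrix entry.\<close>
      moreover have "z' = z \<longleftrightarrow> b = d \<and> b' = d' \<and> k = j"
      proof
        assume "z' = z"
        then have "ent (m (d, j, d')) b b' = (ent (m (b, k, b')) b b' :: 'a laurent)" using z i by simp
        then have "(if b = d \<and> b' = d' then mono_t j else 0) = (mono_t k :: 'a laurent)"
          by (simp only: ent_m[OF i(2)] ent_m[OF z(2)]) simp
        then have "Poly_Mapping.lookup (if b = d \<and> b' = d' then mono_t j else (0 :: 'a laurent)) k = Poly_Mapping.lookup (mono_t k :: 'a laurent) k"
          by simp
        then show "b = d \<and> b' = d' \<and> k = j"
          by (auto simp: mono_t_def lookup_single when_def split: if_splits)
      qed (simp add: z i)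
      ultimately show ?thesis by auto
    qed
    have "0 = Poly_Mapping.lookup (ent s b b') k"
      using zero ent_eqv[OF s(2)] by simp
    also have "\<dots> = (\<Sum>z'\<in>t. Poly_Mapping.lookup (ent (smul (r z') z') b b') k)"
      by (simp add: t(3) ent_sum lookup_sum)
    also have "\<dots> = (\<Sum>z'\<in>t. if z' = z then r z else 0)" by (rule sum.cong) (simp_all add: lookup)
    finally show ?thesis using t(1) that by simp
  qed
  then have "s = 0" by (simp add: t(3))
  then show ?thesis using s(2) by (simp add: eqv_def)
qed

definition \<Psi> :: "(('v, 'e) lpa_gen free_monoid \<Rightarrow>\<^sub>0 'r::comm_ring_1) set \<Rightarrow> 'e list \<times> 'v \<Rightarrow> 'e list \<times> 'v \<Rightarrow> 'r laurent" where
  "\<Psi> x = ent (SOME f. f \<in> F \<and> proj f = x)"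

lemma \<Psi>_proj: "f \<in> F \<Longrightarrow> \<Psi> (proj f) = ent f"
  unfolding \<Psi>_def
proof (rule someI2[of _ f])
  fix g assume "f \<in> F" "g \<in> F \<and> proj g = proj f"
  then show "ent g = ent f" by (intro ent_eqv) (simp add: eqv_def flip: proj_eq_iff)
qed simp

lemma \<Psi>_bij: "bij_betw \<Psi> (carrier (L :: ('r::comm_ring_1, _) module)) (carrier (bmat BP snd W))"
proof (rule bij_betw_imageI)
  show "inj_on \<Psi> (carrier (L :: ('r, _) module))"
  proof (rule inj_onI)
    fix x y assume "x \<in> carrier (L :: ('r, _) module)" "y \<in> carrier (L :: ('r, _) module)" "\<Psi> x = \<Psi> y"
    then obtain f g where fg: "x = proj f" "y = proj g" "f \<in> F" "g \<in> F" "ent f = ent g"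
      by (auto simp: L_sel(1) \<Psi>_proj)
    have "ent (f - g) b a = 0" for b a
      using fg(5) ent_add[of "f - g" g b a] by simp
    then have "ent (f - g) = (\<lambda>b a. 0)" by (intro ext)
    then have "f - g \<in> I" by (rule ent_inj[rotated]) (simp add: fg)
    then show "x = y" using fg by (simp add: proj_eq_iff)
  qed
  show "\<Psi> ` carrier (L :: ('r, _) module) = carrier (bmat BP snd W)"
    using ent_carrier ent_surj by (force simp: L_sel(1) \<Psi>_proj)
qed

lemma \<Psi>_hom:
  assumes "x \<in> carrier (L :: ('r::comm_ring_1, _) module)" "y \<in> carrier (L :: ('r, _) module)"
  shows "\<Psi> (x \<otimes>\<^bsub>L\<^esub> y) = \<Psi> x \<otimes>\<^bsub>bmat BP snd W\<^esub> \<Psi> y"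
    "\<Psi> (x \<oplus>\<^bsub>L\<^esub> y) = \<Psi> x \<oplus>\<^bsub>bmat BP snd W\<^esub> \<Psi> y"
    "\<Psi> (r \<odot>\<^bsub>L\<^esub> x) = (\<lambda>b a. Poly_Mapping.single 0 r * \<Psi> x b a)"
proof -
  obtain f g where fg: "x = proj f" "y = proj g" "f \<in> F" "g \<in> F" using assms by (auto simp: L_sel(1))
  have r: "Poly_Mapping.single 0 r * f \<in> F" using fg by (intro F_simps(4)) auto
  show "\<Psi> (x \<otimes>\<^bsub>L\<^esub> y) = \<Psi> x \<otimes>\<^bsub>bmat BP snd W\<^esub> \<Psi> y"
    using fg by (simp add: \<Psi>_proj fun_eq_iff ent_mult)
  show "\<Psi> (x \<oplus>\<^bsub>L\<^esub> y) = \<Psi> x \<oplus>\<^bsub>bmat BP snd W\<^esub> \<Psi> y"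
    using fg by (simp add: \<Psi>_proj fun_eq_iff ent_add)
  show "\<Psi> (r \<odot>\<^bsub>L\<^esub> x) = (\<lambda>b a. Poly_Mapping.single 0 r * \<Psi> x b a)"
    using fg r by (simp add: \<Psi>_proj fun_eq_iff ent_smul flip: smul_def)
qed

end

section \<open>Chain conditions for finitely generated modules\<close>

locale scalar_module = module scale
  for scale :: "'a::comm_ring_1 \<Rightarrow> 'b::ab_group_add \<Rightarrow> 'b" (infixr \<open>*s\<close> 75)
begin

text \<open>The coefficients of g that occur in elements of N modulo the span of G. Together with
  the intersection of N and that span they control N when one more generator g is added.\<close>

definition coeff_ideal :: "'b set \<Rightarrow> 'b \<Rightarrow> 'b set \<Rightarrow> 'a set" where
  "coeff_ideal G g N = {r. \<exists>x\<in>span G. r *s g + x \<in> N}"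

lemma is_ideal_coeff_ideal:
  assumes "subspace N"
  shows "is_ideal (coeff_ideal G g N)"
  unfolding is_ideal_def
proof (intro conjI ballI allI)
  show "0 \<in> coeff_ideal G g N"
    using subspace_0[OF assms] span_zero by (auto simp: coeff_ideal_def intro!: bexI[of _ 0])
next
  fix r s assume "r \<in> coeff_ideal G g N" "s \<in> coeff_ideal G g N"
  then obtain x y where *: "x \<in> span G" "r *s g + x \<in> N" "y \<in> span G" "s *s g + y \<in> N"
    by (auto simp: coeff_ideal_def)
  have "(r + s) *s g + (x + y) = (r *s g + x) + (s *s g + y)"
    by (simp add: scale_left_distrib algebra_simps)
  then have "(r + s) *s g + (x + y) \<in> N" using subspace_add[OF assms *(2,4)] by (simp only:)
  then show "r + s \<in> coeff_ideal G g N"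
    using span_add[OF *(1,3)] by (auto simp: coeff_ideal_def)
next
  fix a r assume "r \<in> coeff_ideal G g N"
  then obtain x where *: "x \<in> span G" "r *s g + x \<in> N" by (auto simp: coeff_ideal_def)
  have "(a * r) *s g + a *s x \<in> N"
    using subspace_scale[OF assms *(2), of a] by (simp add: scale_right_distrib)
  then show "a * r \<in> coeff_ideal G g N"
    using span_scale[OF *(1)] by (auto simp: coeff_ideal_def)
qed

text \<open>An element of N' has the same coefficient of g as some element of N; their difference
  lies in the span of G, where the two agree.\<close>

lemma subspace_eqI:
  assumes N: "subspace N" "subspace N'" "N \<subseteq> N'" "N' \<subseteq> span (insert g G)"
    and eq: "coeff_ideal G g N = coeff_ideal G g N'" "N \<inter> span G = N' \<inter> span G"
  shows "N = N'"
proof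
  show "N' \<subseteq> N"
  proof
    fix y assume y: "y \<in> N'"
    then obtain r where r: "y - r *s g \<in> span G" using N(4) by (auto simp: span_insert)
    then have "r \<in> coeff_ideal G g N'" using y by (auto simp: coeff_ideal_def intro!: bexI[of _ "y - r *s g"])
    then obtain x where x: "x \<in> span G" "r *s g + x \<in> N" using eq(1) by (auto simp: coeff_ideal_def)
    have "y - (r *s g + x) = (y - r *s g) - x" by (simp add: algebra_simps)
    then have "y - (r *s g + x) \<in> span G" using span_diff[OF r x(1)] by (simp only:)
    moreover have "y - (r *s g + x) \<in> N'" using subspace_diff[OF N(2) y] x N(3) by blast
    ultimately have "y - (r *s g + x) \<in> N" using eq(2) by blast
    then show "y \<in> N" using subspace_add[OF N(1) _ x(2)] by fastforce
  qed
qed (rule N(3))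

text \<open>Induction on the number of generators: the coefficient ideals and the intersections with
  the smaller span both become stationary, and together they determine the members of the
  chain.\<close>

lemma noetherian_span:
  assumes "left_noetherian (class_ring :: 'a ring)" "finite G"
    "\<And>n :: nat. subspace (N n)" "\<And>n. N n \<subseteq> span G" "\<And>n. N n \<subseteq> N (Suc n)"
  shows "\<exists>M. \<forall>n\<ge>M. N n = N M"
  using assms(2-)
proof (induction G arbitrary: N)
  case empty
  then have "N n = {0}" for n using subspace_0 by fastforce
  then show ?case by simp
next
  case (insert g G)
  have mono: "N k \<subseteq> N n" if "k \<le> n" for k n
    using insert.prems(3) that by (simp add: lift_Suc_mono_le)
  obtain M1 where M1: "\<And>n. n \<ge> M1 \<Longrightarrow> coeff_ideal G g (N n) = coeff_ideal G g (N M1)"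
  proof (rule left_noetherianD[OF assms(1)])
    show "left_ideal (coeff_ideal G g (N n)) class_ring" for n
      unfolding left_ideal_class_ring_iff by (rule is_ideal_coeff_ideal[OF insert.prems(1)])
    show "coeff_ideal G g (N n) \<subseteq> coeff_ideal G g (N (Suc n))" for n
      using insert.prems(3)[of n] by (auto simp: coeff_ideal_def)
  qed (rule that)
  have "\<exists>M. \<forall>n\<ge>M. N n \<inter> span G = N M \<inter> span G"
  proof (rule insert.IH)
    show "subspace (N n \<inter> span G)" for n
      using insert.prems(1) by (intro subspace_inter subspace_span)
    show "N n \<inter> span G \<subseteq> N (Suc n) \<inter> span G" for n
      using insert.prems(3)[of n] by blast
  qed simp
  then obtain M2 where M2: "\<And>n. n \<ge> M2 \<Longrightarrow> N n \<inter> span G = N M2 \<inter> span G" by blast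
  have "N n = N (max M1 M2)" if "n \<ge> max M1 M2" for n
    using subspace_eqI[OF insert.prems(1)[of "max M1 M2"] insert.prems(1)[of n] mono[OF that] insert.prems(2)]
      M1[of n] M1[of "max M1 M2"] M2[of n] M2[of "max M1 M2"] that by simp
  then show ?case by blast
qed

lemma artinian_span:
  assumes "left_artinian (class_ring :: 'a ring)" "finite G"
    "\<And>n :: nat. subspace (N n)" "\<And>n. N n \<subseteq> span G" "\<And>n. N (Suc n) \<subseteq> N n"
  shows "\<exists>M. \<forall>n\<ge>M. N n = N M"
  using assms(2-)
proof (induction G arbitrary: N)
  case empty
  then have "N n = {0}" for n using subspace_0 by fastforce
  then show ?case by simp
next
  case (insert g G)
  have mono: "N n \<subseteq> N k" if "k \<le> n" for k n
    using insert.prems(3) that by (simp add: lift_Suc_antimono_le)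
  obtain M1 where M1: "\<And>n. n \<ge> M1 \<Longrightarrow> coeff_ideal G g (N n) = coeff_ideal G g (N M1)"
  proof (rule left_artinianD[OF assms(1)])
    show "left_ideal (coeff_ideal G g (N n)) class_ring" for n
      unfolding left_ideal_class_ring_iff by (rule is_ideal_coeff_ideal[OF insert.prems(1)])
    show "coeff_ideal G g (N (Suc n)) \<subseteq> coeff_ideal G g (N n)" for n
      using insert.prems(3)[of n] by (auto simp: coeff_ideal_def)
  qed (rule that)
  have "\<exists>M. \<forall>n\<ge>M. N n \<inter> span G = N M \<inter> span G"
  proof (rule insert.IH)
    show "subspace (N n \<inter> span G)" for n
      using insert.prems(1) by (intro subspace_inter subspace_span)
    show "N (Suc n) \<inter> span G \<subseteq> N n \<inter> span G" for n
      using insert.prems(3)[of n] by blast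
  qed simp
  then obtain M2 where M2: "\<And>n. n \<ge> M2 \<Longrightarrow> N n \<inter> span G = N M2 \<inter> span G" by blast
  have "N n = N (max M1 M2)" if "n \<ge> max M1 M2" for n
    using subspace_eqI[OF insert.prems(1)[of n] insert.prems(1)[of "max M1 M2"] mono[OF that] insert.prems(2)]
      M1[of n] M1[of "max M1 M2"] M2[of n] M2[of "max M1 M2"] that by simp
  then show ?case by blast
qed

end

section \<open>Hilbert's basis theorem for Laurent polynomials\<close>

text \<open>The ideal of leading coefficients from Hilbert's argument, taken over the elements of K
  that are polynomials in t of degree at most d. Multiplication by t makes it grow with d.\<close>

definition lead_ideal :: "'r::comm_ring_1 laurent set \<Rightarrow> nat \<Rightarrow> 'r set" where
  "lead_ideal K d = {Poly_Mapping.lookup s (int d) | s. s \<in> K \<and> Poly_Mapping.keys s \<subseteq> {0..int d}}"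

lemma keys_laurent_add:
  "Poly_Mapping.keys s \<subseteq> A \<Longrightarrow> Poly_Mapping.keys s' \<subseteq> A \<Longrightarrow> Poly_Mapping.keys (s + s') \<subseteq> A"
  using keys_add[of s s'] by blast

lemma is_ideal_lead_ideal:
  assumes "is_ideal K"
  shows "is_ideal (lead_ideal K d)"
  unfolding is_ideal_def
proof (intro conjI ballI allI)
  show "0 \<in> lead_ideal K d"
    using is_ideal_0[OF assms] by (auto simp: lead_ideal_def intro!: exI[of _ 0])
next
  fix x y assume "x \<in> lead_ideal K d" "y \<in> lead_ideal K d"
  then obtain s s' where *: "x = Poly_Mapping.lookup s (int d)" "s \<in> K" "Poly_Mapping.keys s \<subseteq> {0..int d}"
    "y = Poly_Mapping.lookup s' (int d)" "s' \<in> K" "Poly_Mapping.keys s' \<subseteq> {0..int d}"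
    unfolding lead_ideal_def by blast
  have "x + y = Poly_Mapping.lookup (s + s') (int d)" by (simp add: * lookup_add)
  then show "x + y \<in> lead_ideal K d"
    unfolding lead_ideal_def using is_ideal_add[OF assms *(2,5)] keys_laurent_add[OF *(3,6)] by blast
next
  fix a x assume "x \<in> lead_ideal K d"
  then obtain s where *: "x = Poly_Mapping.lookup s (int d)" "s \<in> K" "Poly_Mapping.keys s \<subseteq> {0..int d}"
    unfolding lead_ideal_def by blast
  have "a * x = Poly_Mapping.lookup (Poly_Mapping.single 0 a * s) (int d)"
    by (simp add: * lookup_single_times)
  moreover have "Poly_Mapping.keys (Poly_Mapping.single 0 a * s) \<subseteq> Poly_Mapping.keys s"
    by (auto simp: in_keys_iff lookup_single_times)
  ultimately show "a * x \<in> lead_ideal K d"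
    unfolding lead_ideal_def using is_ideal_mult[OF assms *(2)] *(3) by blast
qed

lemma lead_ideal_Suc:
  assumes "is_ideal K"
  shows "lead_ideal K d \<subseteq> lead_ideal K (Suc d)"
proof
  fix x assume "x \<in> lead_ideal K d"
  then obtain s where *: "x = Poly_Mapping.lookup s (int d)" "s \<in> K" "Poly_Mapping.keys s \<subseteq> {0..int d}"
    unfolding lead_ideal_def by blast
  have "x = Poly_Mapping.lookup (mono_t 1 * s) (int (Suc d))" by (simp add: *)
  moreover have "Poly_Mapping.keys (mono_t 1 * s) \<subseteq> {0..int (Suc d)}"
  proof
    fix k assume "k \<in> Poly_Mapping.keys (mono_t 1 * s)"
    then have "k - 1 \<in> Poly_Mapping.keys s" by (simp add: in_keys_iff)
    then show "k \<in> {0..int (Suc d)}" using *(3) by auto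
  qed
  ultimately show "x \<in> lead_ideal K (Suc d)"
    unfolding lead_ideal_def using is_ideal_mult[OF assms *(2)] by blast
qed

text \<open>A polynomial in K' loses its top coefficient when a suitable element of K is subtracted;
  induction on the degree puts it into K. A Laurent polynomial becomes a polynomial after
  multiplication by a unit t^j.\<close>

lemma ideal_eqI_lead_ideal:
  assumes K: "is_ideal K" "is_ideal K'" "K \<subseteq> K'" and lead: "\<And>d. lead_ideal K d = lead_ideal K' d"
  shows "K = (K' :: 'r::comm_ring_1 laurent set)"
proof
  have pos: "s \<in> K" if "s \<in> K'" "Poly_Mapping.keys s \<subseteq> {0..<int d}" for s d
    using that
  proof (induction d arbitrary: s)
    case 0
    then show ?case using is_ideal_0[OF K(1)] by simp
  next
    case (Suc d)
    have "Poly_Mapping.keys s \<subseteq> {0..int d}" using Suc.prems(2) by force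
    then have "Poly_Mapping.lookup s (int d) \<in> lead_ideal K d"
      unfolding lead using Suc.prems(1) by (auto simp: lead_ideal_def)
    then obtain s' where s': "Poly_Mapping.lookup s (int d) = Poly_Mapping.lookup s' (int d)" "s' \<in> K"
      "Poly_Mapping.keys s' \<subseteq> {0..int d}"
      unfolding lead_ideal_def by blast
    have "Poly_Mapping.keys (s - s') \<subseteq> {0..<int d}"
    proof
      fix k assume k: "k \<in> Poly_Mapping.keys (s - s')"
      then have "k \<noteq> int d" using s'(1) by (auto simp: in_keys_iff lookup_minus)
      moreover have "k \<in> Poly_Mapping.keys s \<or> k \<in> Poly_Mapping.keys s'"
        using k by (auto simp: in_keys_iff lookup_minus)
      ultimately show "k \<in> {0..<int d}"
        using \<open>Poly_Mapping.keys s \<subseteq> {0..int d}\<close> s'(3) by force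
    qed
    moreover have "s - s' \<in> K'" using is_ideal_diff[OF K(2) Suc.prems(1)] s'(2) K(3) by blast
    ultimately have "s - s' \<in> K" using Suc.IH by blast
    then show ?case using is_ideal_add[OF K(1) _ s'(2)] by fastforce
  qed
  show "K' \<subseteq> K"
  proof
    fix s assume s: "s \<in> K'"
    \<comment> \<open>The largest absolute value of an exponent, with 0 inserted for the case s = 0.
      After the shift by j the exponents lie between 0 and 2 j, hence the bound 2 j + 1.\<close>
    define j where "j = Max (insert 0 ((\<lambda>k. \<bar>k\<bar>) ` Poly_Mapping.keys s))"
    have j: "\<bar>k\<bar> \<le> j" if "k \<in> Poly_Mapping.keys s" for k
      unfolding j_def using that by (intro Max_ge) auto
    have "0 \<le> j" unfolding j_def by (intro Max_ge) auto
    have "Poly_Mapping.keys (mono_t j * s) \<subseteq> {0..<int (nat (2 * j + 1))}"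
    proof
      fix k assume "k \<in> Poly_Mapping.keys (mono_t j * s)"
      then have "k - j \<in> Poly_Mapping.keys s" by (simp add: in_keys_iff)
      then have "\<bar>k - j\<bar> \<le> j" by (rule j)
      then show "k \<in> {0..<int (nat (2 * j + 1))}" using \<open>0 \<le> j\<close> by auto
    qed
    then have "mono_t j * s \<in> K" using pos is_ideal_mult[OF K(2) s] by blast
    then have "mono_t (- j) * (mono_t j * s) \<in> K" by (rule is_ideal_mult[OF K(1)])
    then show "s \<in> K" by simp
  qed
qed (rule K(3))

text \<open>The ideals \<open>c n d\<close> increase in both n and d. Stability along the diagonal
  from M on settles all d \<ge> M at once; the finitely many smaller d are treated separately, and B
  bounds all these thresholds.\<close>

lemma left_noetherian_laurent:
  assumes "left_noetherian (class_ring :: 'r::comm_ring_1 ring)"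
  shows "left_noetherian (class_ring :: 'r laurent ring)"
  unfolding left_noetherian_def left_ideal_class_ring_iff
proof (intro allI impI, elim conjE)
  fix K :: "nat \<Rightarrow> 'r laurent set"
  assume K: "\<forall>n. is_ideal (K n)" "\<forall>n. K n \<subseteq> K (Suc n)"
  define c where "c n d = lead_ideal (K n) d" for n d
  have mono: "K i \<subseteq> K j" if "i \<le> j" for i j using K(2) that by (simp add: lift_Suc_mono_le)
  have c_n: "c i d \<subseteq> c j d" if "i \<le> j" for i j d
    using mono[OF that] unfolding c_def lead_ideal_def by blast
  have c_d: "c n i \<subseteq> c n j" if "i \<le> j" for i j n
    using that by (rule lift_Suc_mono_le[rotated]) (simp add: c_def lead_ideal_Suc K(1))
  have ideal: "left_ideal (c n d) class_ring" for n d
    unfolding left_ideal_class_ring_iff c_def using K(1) by (simp add: is_ideal_lead_ideal)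
  obtain M where M: "\<And>n. n \<ge> M \<Longrightarrow> c n n = c M M"
  proof (rule left_noetherianD[OF assms, of "\<lambda>n. c n n"])
    show "c n n \<subseteq> c (Suc n) (Suc n)" for n
      using c_n[of n "Suc n" n] c_d[of n "Suc n" "Suc n"] by auto
  qed ((rule ideal | rule that)+)
  have "\<exists>N. \<forall>n\<ge>N. c n d = c N d" for d
  proof -
    obtain N where "\<And>n. n \<ge> N \<Longrightarrow> c n d = c N d"
    proof (rule left_noetherianD[OF assms, of "\<lambda>n. c n d"])
      show "c n d \<subseteq> c (Suc n) d" for n by (rule c_n) simp
    qed ((rule ideal | rule that)+)
    then show ?thesis by blast
  qed
  then obtain N where N: "\<And>d n. n \<ge> N d \<Longrightarrow> c n d = c (N d) d" by metis
  define B where "B = Max (insert M (N ` {..<M}))"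
  have B: "M \<le> B" "\<And>d. d < M \<Longrightarrow> N d \<le> B" unfolding B_def by (auto intro: Max_ge)
  have cB: "c n d = c B d" if n: "n \<ge> B" for n d
  proof (cases "d < M")
    case True
    then show ?thesis using N[of d n] N[of d B] B(2)[OF True] n by simp
  next
    case False
    \<comment> \<open>Monotonicity places \<open>c k d\<close> between \<open>c M M\<close> and a
      diagonal member beyond M, which is again \<open>c M M\<close>.\<close>
    have "c k d = c M M" if k: "k \<ge> M" for k
    proof
      have "c k d \<subseteq> c (max k d) d" by (rule c_n) simp
      also have "c (max k d) d \<subseteq> c (max k d) (max k d)" by (rule c_d) simp
      also have "c (max k d) (max k d) = c M M" by (rule M) (use k in simp)
      finally show "c k d \<subseteq> c M M" .
      have "c M M \<subseteq> c k M" by (rule c_n) (rule k)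
      also have "c k M \<subseteq> c k d" by (rule c_d) (use False in simp)
      finally show "c M M \<subseteq> c k d" .
    qed
    from this[of n] this[of B] show ?thesis using n B(1) by simp
  qed
  have "K B = K n" if n: "n \<ge> B" for n
  proof (rule ideal_eqI_lead_ideal)
    show "is_ideal (K B)" "is_ideal (K n)" using K(1) by auto
    show "K B \<subseteq> K n" by (rule mono[OF n])
    show "lead_ideal (K B) d = lead_ideal (K n) d" for d
      using cB[OF n, of d] by (simp add: c_def)
  qed
  then show "\<exists>N. \<forall>n\<ge>N. K n = K N" by (intro exI[of _ B] allI impI) (rule sym)
qed

section \<open>Chain conditions and semisimplicity of block matrix rings\<close>

lemma sum_fun2_apply: "(\<Sum>i\<in>A. f i) b a = (\<Sum>i\<in>A. f i b a :: 'c::ab_group_add)"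
  by (induction A rule: infinite_finite_induct) auto

text \<open>
  The chain conditions are transferred from a ring acting on the blocks through ring
  homomorphisms onto the rings of their entries: the ring of Laurent polynomials acts through the
  identity or through evaluation at \<open>1\<close>, the ring of scalars acts if all blocks are constant.
\<close>

locale block_action =
  fixes Y :: "'y set" and en :: "'y \<Rightarrow> 'u" and W :: "'u set"
    and \<alpha> :: "'u \<Rightarrow> 'k::comm_ring_1 \<Rightarrow> 'r::comm_ring_1 laurent"
  assumes finite_Y: "finite Y"
    and \<alpha>_add: "\<alpha> u (x + y) = \<alpha> u x + \<alpha> u y" and \<alpha>_mult: "\<alpha> u (x * y) = \<alpha> u x * \<alpha> u y"
    and \<alpha>_one: "\<alpha> u 1 = 1" and \<alpha>_range: "u \<in> en ` Y \<Longrightarrow> range (\<alpha> u) = entries W u"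
begin

definition scl :: "'k \<Rightarrow> ('y \<Rightarrow> 'y \<Rightarrow> 'r laurent) \<Rightarrow> 'y \<Rightarrow> 'y \<Rightarrow> 'r laurent" where
  "scl s g = (\<lambda>b a. \<alpha> (en b) s * g b a)"

sublocale M: scalar_module scl
  by unfold_locales (auto simp: scl_def fun_eq_iff algebra_simps \<alpha>_add \<alpha>_mult \<alpha>_one)

abbreviation B where "B \<equiv> bmat Y en W :: ('y \<Rightarrow> 'y \<Rightarrow> 'r laurent) ring"

sublocale B: nonunital_ring B
  by (rule nonunital_ring_bmat)

definition unit :: "'y \<Rightarrow> 'y \<Rightarrow> 'y \<Rightarrow> 'y \<Rightarrow> 'r laurent" where
  "unit b a = (\<lambda>b' a'. if b' = b \<and> a' = a then 1 else 0)"

text \<open>Scaling the rows is left multiplication by a diagonal matrix D that is constant on each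
  block and has entries admissible there. So left ideals are submodules, and chain conditions of
  finitely generated modules apply.\<close>

lemma subspace_left_ideal:
  assumes J: "left_ideal J B"
  shows "M.subspace J"
proof (rule M.subspaceI)
  show "0 \<in> J" using left_ideal_zero[OF J] by (simp add: zero_fun_def)
  show "x + y \<in> J" if "x \<in> J" "y \<in> J" for x y
    using left_ideal_add[OF J that] by (simp add: plus_fun_def)
  fix s x assume x: "x \<in> J"
  then have xc: "x \<in> carrier B" using left_ideal_subset[OF J] by blast
  define D where "D = (\<lambda>b a. if b = a \<and> b \<in> Y then \<alpha> (en b) s else 0)"
  have "D \<in> carrier B"
  proof (rule bmat_carrierI)
    fix b a assume "b \<in> Y" "a \<in> Y" "en b = en a"
    moreover have "\<alpha> (en b) s \<in> entries W (en b)" if "b \<in> Y"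
      using \<alpha>_range[of "en b"] that rangeI[of "\<alpha> (en b)" s] by simp
    ultimately show "D b a \<in> entries W (en b)" by (simp add: D_def)
  qed (auto simp: D_def)
  then have "D \<otimes>\<^bsub>B\<^esub> x \<in> J" using left_ideal_l_closed[OF J _ x] by blast
  moreover have "D \<otimes>\<^bsub>B\<^esub> x = scl s x"
  proof (intro ext)
    fix b a
    have "(D \<otimes>\<^bsub>B\<^esub> x) b a = (\<Sum>y\<in>Y. if y = b then \<alpha> (en b) s * x b a else 0)"
      unfolding bmat_sel by (intro sum.cong) (auto simp: D_def)
    also have "\<dots> = scl s x b a"
      using finite_Y bmat_carrierD(2)[OF xc, of b a] by (auto simp: scl_def)
    finally show "(D \<otimes>\<^bsub>B\<^esub> x) b a = scl s x b a" .
  qed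
  ultimately show "scl s x \<in> J" by simp
qed

lemma carrier_span: "carrier B \<subseteq> M.span ((\<lambda>(b, a). unit b a) ` (Y \<times> Y))"
proof
  fix g assume g: "g \<in> carrier B"
  \<comment> \<open>Between different blocks the entry is 0, which is also a value of
    \<open>\<alpha> (en b)\<close>. So all matrix units can serve as generators, although those
    between blocks are not in \<open>B\<close>.\<close>
  have "\<exists>s. \<alpha> (en b) s * unit b a b a = g b a" if "b \<in> Y" "a \<in> Y" for b a
  proof -
    have "g b a \<in> entries W (en b)"
      using bmat_carrierD(1,2)[OF g, of b a] that by (cases "en b = en a") auto
    then have "g b a \<in> range (\<alpha> (en b))" using \<alpha>_range that by simp
    then show ?thesis by (auto simp: unit_def)
  qed
  then obtain s where s: "\<And>b a. b \<in> Y \<Longrightarrow> a \<in> Y \<Longrightarrow> \<alpha> (en b) (s b a) = g b a"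
    by (simp add: unit_def) metis
  have "(\<Sum>(b, a)\<in>Y \<times> Y. scl (s b a) (unit b a)) = g"
  proof (intro ext)
    fix d e
    have "(\<Sum>(b, a)\<in>Y \<times> Y. scl (s b a) (unit b a)) d e =
        (\<Sum>z\<in>Y \<times> Y. if z = (d, e) then g d e else 0)"
      unfolding sum_fun2_apply by (intro sum.cong) (auto simp: scl_def unit_def s split: prod.splits)
    also have "\<dots> = g d e"
      using finite_Y bmat_carrierD(2)[OF g, of d e] by auto
    finally show "(\<Sum>(b, a)\<in>Y \<times> Y. scl (s b a) (unit b a)) d e = g d e" .
  qed
  moreover have "(\<Sum>(b, a)\<in>Y \<times> Y. scl (s b a) (unit b a)) \<in> M.span ((\<lambda>(b, a). unit b a) ` (Y \<times> Y))"
    by (rule M.span_sum, clarsimp, rule M.span_scale, rule M.span_base, force)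
  ultimately show "g \<in> M.span ((\<lambda>(b, a). unit b a) ` (Y \<times> Y))" by simp
qed

lemma chain_conditions:
  "left_noetherian (class_ring :: 'k ring) \<Longrightarrow> left_noetherian B"
  "left_artinian (class_ring :: 'k ring) \<Longrightarrow> left_artinian B"
proof -
  have fin: "finite ((\<lambda>(b, a). unit b a) ` (Y \<times> Y))" using finite_Y by simp
  have sub: "J \<subseteq> M.span ((\<lambda>(b, a). unit b a) ` (Y \<times> Y))" if "left_ideal J B" for J
    using left_ideal_subset[OF that] carrier_span by blast
  show "left_noetherian B" if noeth: "left_noetherian (class_ring :: 'k ring)"
    unfolding left_noetherian_def
    by (intro allI impI, elim conjE, rule M.noetherian_span[OF noeth fin])
       (simp_all add: subspace_left_ideal sub)
  show "left_artinian B" if art: "left_artinian (class_ring :: 'k ring)"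
    unfolding left_artinian_def
    by (intro allI impI, elim conjE, rule M.artinian_span[OF art fin])
       (simp_all add: subspace_left_ideal sub)
qed

end

lemma left_noetherian_bmat:
  assumes "finite Y" "left_noetherian (class_ring :: 'r::comm_ring_1 ring)"
  shows "left_noetherian (bmat Y en W :: (_ \<Rightarrow> _ \<Rightarrow> 'r laurent) ring)"
proof -
  interpret block_action Y en W "\<lambda>u s :: 'r laurent. if u \<in> W then s else Poly_Mapping.single 0 (aug s)"
  proof unfold_locales
    have "range (\<lambda>s :: 'r laurent. Poly_Mapping.single (0::int) (aug s)) = range (Poly_Mapping.single 0)"
      by (auto simp: image_iff) (metis aug_single)
    then show "range (\<lambda>s :: 'r laurent. if u \<in> W then s else Poly_Mapping.single 0 (aug s)) = entries W u" for u
      by (simp add: entries_def)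
  qed (use assms(1) in \<open>simp_all add: single_add single_0_mult\<close>)
  show ?thesis using chain_conditions(1) left_noetherian_laurent[OF assms(2)] by blast
qed

lemma left_artinian_bmat:
  assumes "finite Y" "left_artinian (class_ring :: 'r::comm_ring_1 ring)"
  shows "left_artinian (bmat Y en {} :: (_ \<Rightarrow> _ \<Rightarrow> 'r laurent) ring)"
proof -
  interpret block_action Y en "{}" "\<lambda>u r :: 'r. Poly_Mapping.single (0::int) r"
    by unfold_locales (use assms(1) in \<open>simp_all add: single_add single_0_mult entries_def\<close>)
  show ?thesis using chain_conditions(2) assms(2) by blast
qed

lemma bmat_one:
  fixes x :: "'y \<Rightarrow> 'y \<Rightarrow> 'r::comm_ring_1 laurent"
  assumes Y: "finite Y" and x: "x \<in> carrier (bmat Y en W)"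
  shows "\<one>\<^bsub>bmat Y en W\<^esub> \<otimes>\<^bsub>bmat Y en W\<^esub> x = x" "x \<otimes>\<^bsub>bmat Y en W\<^esub> \<one>\<^bsub>bmat Y en W\<^esub> = x"
proof -
  have "(\<Sum>y\<in>Y. (if b = y \<and> b \<in> Y then 1 else 0) * x y a) = (\<Sum>y\<in>Y. if y = b then x b a else 0)" for b a
    by (intro sum.cong) auto
  then show "\<one>\<^bsub>bmat Y en W\<^esub> \<otimes>\<^bsub>bmat Y en W\<^esub> x = x"
    using Y bmat_carrierD(2)[OF x] by (auto simp: fun_eq_iff)
  have "(\<Sum>y\<in>Y. x b y * (if y = a \<and> y \<in> Y then 1 else 0)) = (\<Sum>y\<in>Y. if y = a then x b a else 0)" for b a
    by (intro sum.cong) auto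
  then show "x \<otimes>\<^bsub>bmat Y en W\<^esub> \<one>\<^bsub>bmat Y en W\<^esub> = x"
    using Y bmat_carrierD(2)[OF x] by (auto simp: fun_eq_iff)
qed

text \<open>The criterion is verified in B, where computations with matrices are possible, and
  carried over to A along g.\<close>

lemma semisimple_ringI_iso:
  assumes A: "nonunital_ring A" and B: "nonunital_ring B" and g: "bij_betw g (carrier B) (carrier A)"
    and g_add: "\<And>x y. x \<in> carrier B \<Longrightarrow> y \<in> carrier B \<Longrightarrow> g (x \<oplus>\<^bsub>B\<^esub> y) = g x \<oplus>\<^bsub>A\<^esub> g y"
    and g_mult: "\<And>x y. x \<in> carrier B \<Longrightarrow> y \<in> carrier B \<Longrightarrow> g (x \<otimes>\<^bsub>B\<^esub> y) = g x \<otimes>\<^bsub>A\<^esub> g y"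
    and T: "finite T" "\<And>i. i \<in> T \<Longrightarrow> e i \<in> carrier B" "\<And>i. i \<in> T \<Longrightarrow> e i \<noteq> \<zero>\<^bsub>B\<^esub>"
    and idem: "\<And>i. i \<in> T \<Longrightarrow> e i \<otimes>\<^bsub>B\<^esub> e i = e i"
    and orth: "\<And>i j. i \<in> T \<Longrightarrow> j \<in> T \<Longrightarrow> i \<noteq> j \<Longrightarrow> e i \<otimes>\<^bsub>B\<^esub> e j = \<zero>\<^bsub>B\<^esub>"
    and unit: "\<And>x. x \<in> carrier B \<Longrightarrow> finsum B e T \<otimes>\<^bsub>B\<^esub> x = x \<and> x \<otimes>\<^bsub>B\<^esub> finsum B e T = x"
    and simple: "\<And>i x. i \<in> T \<Longrightarrow> x \<in> carrier B \<Longrightarrow> x \<otimes>\<^bsub>B\<^esub> e i \<noteq> \<zero>\<^bsub>B\<^esub> \<Longrightarrow>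
      \<exists>y\<in>carrier B. y \<otimes>\<^bsub>B\<^esub> (x \<otimes>\<^bsub>B\<^esub> e i) = e i"
  shows "semisimple_ring A"
proof -
  interpret A: nonunital_ring A by (rule A)
  interpret B: nonunital_ring B by (rule B)
  have g_carrier: "g x \<in> carrier A" if "x \<in> carrier B" for x
    using g that by (rule bij_betw_apply)
  have g_zero: "g \<zero>\<^bsub>B\<^esub> = \<zero>\<^bsub>A\<^esub>"
  proof -
    have "g \<zero>\<^bsub>B\<^esub> \<oplus>\<^bsub>A\<^esub> g \<zero>\<^bsub>B\<^esub> = g \<zero>\<^bsub>B\<^esub> \<oplus>\<^bsub>A\<^esub> \<zero>\<^bsub>A\<^esub>"
      using g_add[of "\<zero>\<^bsub>B\<^esub>" "\<zero>\<^bsub>B\<^esub>"] g_carrier[of "\<zero>\<^bsub>B\<^esub>"] by simp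
    moreover have c: "g \<zero>\<^bsub>B\<^esub> \<in> carrier A" by (rule g_carrier) simp
    ultimately show ?thesis using A.r_neg1[OF c c] A.r_neg1[OF c A.zero_closed] by metis
  qed
  have finsum: "finsum A (\<lambda>i. g (e i)) T' = g (finsum B e T') \<and> finsum B e T' \<in> carrier B" if "T' \<subseteq> T" for T'
    using finite_subset[OF that T(1)] that
  proof (induction T')
    case (insert i T')
    then have e: "e i \<in> carrier B" "e \<in> T' \<rightarrow> carrier B" using T(2) by auto
    have "finsum A (\<lambda>i. g (e i)) (insert i T') = g (e i) \<oplus>\<^bsub>A\<^esub> finsum A (\<lambda>i. g (e i)) T'"
      using insert e g_carrier by (intro A.finsum_insert) auto
    moreover have "finsum B e (insert i T') = e i \<oplus>\<^bsub>B\<^esub> finsum B e T'"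
      using insert e by (intro B.finsum_insert) auto
    ultimately show ?case using insert e g_add by simp
  qed (simp add: g_zero)
  show ?thesis
  proof (rule A.semisimple_ringI[of T "\<lambda>i. g (e i)"])
    show "g (e i) \<noteq> \<zero>\<^bsub>A\<^esub>" if "i \<in> T" for i
      using T(2,3)[OF that] g_zero inj_onD[OF bij_betw_imp_inj_on[OF g], of "e i" "\<zero>\<^bsub>B\<^esub>"] by auto
    show "g (e i) \<otimes>\<^bsub>A\<^esub> g (e i) = g (e i)" if "i \<in> T" for i
      using g_mult[OF T(2)[OF that] T(2)[OF that]] idem[OF that] by simp
    show "g (e i) \<otimes>\<^bsub>A\<^esub> g (e j) = \<zero>\<^bsub>A\<^esub>" if "i \<in> T" "j \<in> T" "i \<noteq> j" for i j
      using g_mult[OF T(2)[OF that(1)] T(2)[OF that(2)]] orth[OF that] g_zero by simp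
    fix x assume "x \<in> carrier A"
    then obtain x' where x': "x' \<in> carrier B" "x = g x'" using bij_betw_imp_surj_on[OF g] by blast
    show "finsum A (\<lambda>i. g (e i)) T \<otimes>\<^bsub>A\<^esub> x = x \<and> x \<otimes>\<^bsub>A\<^esub> finsum A (\<lambda>i. g (e i)) T = x"
      using finsum[OF subset_refl] unit[OF x'(1)] g_mult[OF x'(1)] g_mult[OF _ x'(1)] by (metis x'(2))
    show "\<exists>y\<in>carrier A. y \<otimes>\<^bsub>A\<^esub> (x \<otimes>\<^bsub>A\<^esub> g (e i)) = g (e i)" if i: "i \<in> T" and ne: "x \<otimes>\<^bsub>A\<^esub> g (e i) \<noteq> \<zero>\<^bsub>A\<^esub>" for i
    proof -
      have xe: "x \<otimes>\<^bsub>A\<^esub> g (e i) = g (x' \<otimes>\<^bsub>B\<^esub> e i)" using g_mult[OF x'(1) T(2)[OF i]] x'(2) by simp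
      then have "x' \<otimes>\<^bsub>B\<^esub> e i \<noteq> \<zero>\<^bsub>B\<^esub>" using ne g_zero by auto
      then obtain y where y: "y \<in> carrier B" "y \<otimes>\<^bsub>B\<^esub> (x' \<otimes>\<^bsub>B\<^esub> e i) = e i" using simple[OF i x'(1)] by blast
      have "g y \<otimes>\<^bsub>A\<^esub> (x \<otimes>\<^bsub>A\<^esub> g (e i)) = g (e i)"
        unfolding xe using g_mult[OF y(1), of "x' \<otimes>\<^bsub>B\<^esub> e i"] y(2) x'(1) T(2)[OF i] by simp
      then show ?thesis using g_carrier[OF y(1)] by blast
    qed
  qed (use T(1,2) g_carrier in auto)
qed

text \<open>The idempotents are the diagonal matrix units at y times \<open>\<epsilon> i\<close>. If
  x times such an idempotent is nonzero, it has a nonzero entry in a row b of the same block; the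
  matrix with single entry s in row y and column b takes it back to the idempotent.\<close>

lemma semisimple_ring_bmat_iso:
  fixes \<epsilon> :: "nat \<Rightarrow> 'r::comm_ring_1"
  assumes Y: "finite Y"
    and A: "nonunital_ring A" and g: "bij_betw g (carrier (bmat Y en {} :: ('y \<Rightarrow> 'y \<Rightarrow> 'r laurent) ring)) (carrier A)"
      "\<And>x y. x \<in> carrier (bmat Y en {}) \<Longrightarrow> y \<in> carrier (bmat Y en {}) \<Longrightarrow> g (x \<oplus>\<^bsub>bmat Y en {}\<^esub> y) = g x \<oplus>\<^bsub>A\<^esub> g y"
      "\<And>x y. x \<in> carrier (bmat Y en {}) \<Longrightarrow> y \<in> carrier (bmat Y en {}) \<Longrightarrow> g (x \<otimes>\<^bsub>bmat Y en {}\<^esub> y) = g x \<otimes>\<^bsub>A\<^esub> g y"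
    and \<epsilon>: "\<And>i. i < n \<Longrightarrow> \<epsilon> i \<noteq> 0" "\<And>i j. i < n \<Longrightarrow> j < n \<Longrightarrow> \<epsilon> i * \<epsilon> j = (if i = j then \<epsilon> i else 0)"
      "(\<Sum>i<n. \<epsilon> i) = 1" "\<And>i r. i < n \<Longrightarrow> r * \<epsilon> i \<noteq> 0 \<Longrightarrow> \<exists>s. s * (r * \<epsilon> i) = \<epsilon> i"
  shows "semisimple_ring A"
proof -
  let ?B = "bmat Y en {} :: ('y \<Rightarrow> 'y \<Rightarrow> 'r laurent) ring"
  interpret B: nonunital_ring ?B by (rule nonunital_ring_bmat)
  let ?c = "Poly_Mapping.single (0::int) :: 'r \<Rightarrow> 'r laurent"
  define e :: "nat \<times> 'y \<Rightarrow> 'y \<Rightarrow> 'y \<Rightarrow> 'r laurent" where "e = (\<lambda>(i, y) b a. if b = y \<and> a = y then ?c (\<epsilon> i) else 0)"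
  have e_carrier: "e z \<in> carrier ?B" if "z \<in> {..<n} \<times> Y" for z
    using that by (intro bmat_carrierI) (auto simp: e_def)
  have mult_e: "(x \<otimes>\<^bsub>?B\<^esub> e (i, y)) b a = (if a = y then x b y * ?c (\<epsilon> i) else 0)" if "y \<in> Y" for x i y b a
  proof -
    have "(x \<otimes>\<^bsub>?B\<^esub> e (i, y)) b a = (\<Sum>z\<in>Y. if z = y then (if a = y then x b y * ?c (\<epsilon> i) else 0) else 0)"
      unfolding bmat_sel by (intro sum.cong) (auto simp: e_def)
    then show ?thesis using Y that by simp
  qed
  have finsum: "finsum ?B h A = (\<lambda>b a. \<Sum>z\<in>A. h z b a)" if "finite A" "\<And>z. z \<in> A \<Longrightarrow> h z \<in> carrier ?B"
    for h and A :: "(nat \<times> 'y) set"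
    using that
  proof (induction A)
    case (insert z A)
    then have "finsum ?B h (insert z A) = h z \<oplus>\<^bsub>?B\<^esub> finsum ?B h A"
      by (intro B.finsum_insert) auto
    then show ?case using insert by simp
  qed simp
  have "finsum ?B e ({..<n} \<times> Y) = (\<lambda>b a. if b = a \<and> b \<in> Y then 1 else 0)"
  proof -
    have "finsum ?B e ({..<n} \<times> Y) = (\<lambda>b a. \<Sum>z\<in>{..<n} \<times> Y. e z b a)"
      using Y e_carrier by (intro finsum) auto
    also have "\<dots> = (\<lambda>b a. if b = a \<and> b \<in> Y then 1 else 0)"
    proof (intro ext)
      fix b a
      have "(\<Sum>z\<in>{..<n} \<times> Y. e z b a) = (\<Sum>i<n. \<Sum>y\<in>Y. e (i, y) b a)"
        by (simp add: sum.cartesian_product)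
      also have "\<dots> = (\<Sum>i<n. if b = a \<and> b \<in> Y then ?c (\<epsilon> i) else 0)"
      proof (rule sum.cong)
        fix i
        have "(\<Sum>y\<in>Y. e (i, y) b a) = (\<Sum>y\<in>Y. if y = b then (if b = a then ?c (\<epsilon> i) else 0) else 0)"
          by (intro sum.cong) (auto simp: e_def)
        then show "(\<Sum>y\<in>Y. e (i, y) b a) = (if b = a \<and> b \<in> Y then ?c (\<epsilon> i) else 0)" using Y by simp
      qed simp
      also have "\<dots> = (if b = a \<and> b \<in> Y then (\<Sum>i<n. ?c (\<epsilon> i)) else 0)"
        by (cases "b = a \<and> b \<in> Y") (auto intro!: sum.neutral)
      also have "(\<Sum>i<n. ?c (\<epsilon> i)) = ?c (\<Sum>i<n. \<epsilon> i)"
        by (induction n) (simp_all add: single_add)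
      finally show "(\<Sum>z\<in>{..<n} \<times> Y. e z b a) = (if b = a \<and> b \<in> Y then 1 else 0)" unfolding \<epsilon>(3) single_one .
    qed
    finally show ?thesis .
  qed
  moreover note bmat_one[OF Y, where en = en and W = "{}"]
  ultimately have unit: "finsum ?B e ({..<n} \<times> Y) \<otimes>\<^bsub>?B\<^esub> x = x \<and> x \<otimes>\<^bsub>?B\<^esub> finsum ?B e ({..<n} \<times> Y) = x"
    if "x \<in> carrier ?B" for x
    using that by (simp only: bmat_sel(2)) blast
  show ?thesis
  proof (rule semisimple_ringI_iso[where A = A and B = ?B and g = g and T = "{..<n} \<times> Y" and e = e,
        OF A nonunital_ring_bmat g _ e_carrier _ _ _ unit])
    show "finite ({..<n} \<times> Y)" using Y by simp
    fix z assume "z \<in> {..<n} \<times> Y"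
    then obtain i y where z: "z = (i, y)" "i < n" "y \<in> Y" by auto
    have "?c (\<epsilon> i) \<noteq> 0" using \<epsilon>(1)[OF z(2)] by (metis lookup_single_eq lookup_zero)
    then have "e (i, y) y y \<noteq> 0" by (simp add: e_def)
    then show "e z \<noteq> \<zero>\<^bsub>?B\<^esub>" using z by auto
    have "(e (i, y) \<otimes>\<^bsub>?B\<^esub> e (i, y)) b a = e (i, y) b a" for b a
      unfolding mult_e[OF z(3)] using \<epsilon>(2)[OF z(2) z(2)] by (simp add: e_def mult_single)
    then show "e z \<otimes>\<^bsub>?B\<^esub> e z = e z" unfolding z by (intro ext)
    show "e z \<otimes>\<^bsub>?B\<^esub> e z' = \<zero>\<^bsub>?B\<^esub>" if z': "z' \<in> {..<n} \<times> Y" "z \<noteq> z'" for z'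
    proof -
      obtain j y' where j: "z' = (j, y')" "j < n" "y' \<in> Y" using z' by auto
      have "(e (i, y) \<otimes>\<^bsub>?B\<^esub> e (j, y')) b a = 0" for b a
        unfolding mult_e[OF j(3)] using \<epsilon>(2)[OF z(2) j(2)] z'(2) z j by (auto simp: e_def mult_single)
      then show ?thesis unfolding z j by (simp add: fun_eq_iff del: bmat_sel(1))
    qed
    fix x assume x: "x \<in> carrier ?B" and ne: "x \<otimes>\<^bsub>?B\<^esub> e z \<noteq> \<zero>\<^bsub>?B\<^esub>"
    have "\<exists>b. x b y * ?c (\<epsilon> i) \<noteq> 0"
    proof (rule ccontr)
      assume "\<not> ?thesis"
      then have "(x \<otimes>\<^bsub>?B\<^esub> e (i, y)) b a = 0" for b a unfolding mult_e[OF z(3)] by simp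
      then show False using ne unfolding z by (simp add: fun_eq_iff del: bmat_sel(1))
    qed
    then obtain b where b: "x b y * ?c (\<epsilon> i) \<noteq> 0" by blast
    then have "x b y \<noteq> 0" by auto
    then have bY: "b \<in> Y" "en b = en y" using bmat_carrierD(2)[OF x, of b y] by blast+
    then have "x b y \<in> entries {} (en b)" using bmat_carrierD(1)[OF x] z by blast
    then obtain r where r: "x b y = ?c r" by (auto simp: entries_def)
    then have "r * \<epsilon> i \<noteq> 0" using b by (auto simp: mult_single)
    then obtain s where s: "s * (r * \<epsilon> i) = \<epsilon> i" using \<epsilon>(4)[OF z(2)] by blast
    define w where "w = (\<lambda>d f. if d = y \<and> f = b then ?c s else 0)"
    have "w \<in> carrier ?B" using bY z by (intro bmat_carrierI) (auto simp: w_def)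
    moreover have "w \<otimes>\<^bsub>?B\<^esub> (x \<otimes>\<^bsub>?B\<^esub> e (i, y)) = e (i, y)"
    proof (intro ext)
      fix d a
      have "(w \<otimes>\<^bsub>?B\<^esub> (x \<otimes>\<^bsub>?B\<^esub> e (i, y))) d a = (\<Sum>f\<in>Y. w d f * (x \<otimes>\<^bsub>?B\<^esub> e (i, y)) f a)"
        by (simp only: bmat_sel)
      also have "\<dots> = (\<Sum>f\<in>Y. if f = b then (if d = y \<and> a = y then ?c s * (x b y * ?c (\<epsilon> i)) else 0) else 0)"
        unfolding mult_e[OF z(3)] by (intro sum.cong) (auto simp: w_def)
      also have "\<dots> = (if d = y \<and> a = y then ?c (s * (r * \<epsilon> i)) else 0)"
        using Y bY by (simp add: r mult_single)
      finally show "(w \<otimes>\<^bsub>?B\<^esub> (x \<otimes>\<^bsub>?B\<^esub> e (i, y))) d a = e (i, y) d a" by (simp add: s e_def)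
    qed
    ultimately show "\<exists>y\<in>carrier ?B. y \<otimes>\<^bsub>?B\<^esub> (x \<otimes>\<^bsub>?B\<^esub> e z) = e z" unfolding z(1) by blast
  qed
qed

section \<open>Products of matrix algebras\<close>

lemma algebra_prod_list_sel:
  "carrier (algebra_prod_list As) = carrier (RDirProd_list As)"
  "mult (algebra_prod_list As) = mult (RDirProd_list As)"
  "add (algebra_prod_list As) = add (RDirProd_list As)"
  "one (algebra_prod_list As) = one (RDirProd_list As)"
  "smult (algebra_prod_list As) = (\<lambda>c xs. map2 (\<lambda>A x. c \<odot>\<^bsub>A\<^esub> x) As xs)"
  by (simp_all add: algebra_prod_list_def ring.defs)

lemma algebra_prod_sel:
  "carrier (algebra_prod A B) = carrier A \<times> carrier B"
  "mult (algebra_prod A B) = (\<lambda>(x, y) (x', y'). (x \<otimes>\<^bsub>A\<^esub> x', y \<otimes>\<^bsub>B\<^esub> y'))"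
  "add (algebra_prod A B) = (\<lambda>(x, y) (x', y'). (x \<oplus>\<^bsub>A\<^esub> x', y \<oplus>\<^bsub>B\<^esub> y'))"
  "one (algebra_prod A B) = (\<one>\<^bsub>A\<^esub>, \<one>\<^bsub>B\<^esub>)"
  "smult (algebra_prod A B) = (\<lambda>c (x, y). (c \<odot>\<^bsub>A\<^esub> x, c \<odot>\<^bsub>B\<^esub> y))"
  by (simp_all add: algebra_prod_def ring.defs RDirProd_def DirProd_def monoid.defs)

lemma laurent_module_mat_sel [simp]:
  "carrier (laurent_module_mat n :: ('r::comm_ring_1, _) module) = carrier_mat n n"
  "mult (laurent_module_mat n :: ('r, _) module) = (*)" "add (laurent_module_mat n :: ('r, _) module) = (+)"
  "one (laurent_module_mat n :: ('r, _) module) = 1\<^sub>m n"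
  "smult (laurent_module_mat n) = (\<lambda>(c :: 'r) M. Poly_Mapping.single 0 c \<cdot>\<^sub>m M)"
  by (simp_all add: laurent_module_mat_def ring.defs ring_mat_def)

lemma algebra_prod_list_family:
  assumes carrier: "\<And>u x. u \<in> set us \<Longrightarrow> x \<in> C \<Longrightarrow> h u x \<in> carrier (A u)"
    and xy: "x \<in> C" "y \<in> C"
  shows "map (\<lambda>u. h u x) us \<in> carrier (algebra_prod_list (map A us))"
    and "(\<And>u. u \<in> set us \<Longrightarrow> h u z = h u x \<otimes>\<^bsub>A u\<^esub> h u y) \<Longrightarrow>
      map (\<lambda>u. h u z) us = map (\<lambda>u. h u x) us \<otimes>\<^bsub>algebra_prod_list (map A us)\<^esub> map (\<lambda>u. h u y) us"
    and "(\<And>u. u \<in> set us \<Longrightarrow> h u z = h u x \<oplus>\<^bsub>A u\<^esub> h u y) \<Longrightarrow>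
      map (\<lambda>u. h u z) us = map (\<lambda>u. h u x) us \<oplus>\<^bsub>algebra_prod_list (map A us)\<^esub> map (\<lambda>u. h u y) us"
    and "(\<And>u. u \<in> set us \<Longrightarrow> h u z = c \<odot>\<^bsub>A u\<^esub> h u x) \<Longrightarrow>
      map (\<lambda>u. h u z) us = c \<odot>\<^bsub>algebra_prod_list (map A us)\<^esub> map (\<lambda>u. h u x) us"
    and "(\<And>u. u \<in> set us \<Longrightarrow> h u z = \<one>\<^bsub>A u\<^esub>) \<Longrightarrow>
      map (\<lambda>u. h u z) us = \<one>\<^bsub>algebra_prod_list (map A us)\<^esub>"
proof -
  have c: "map (\<lambda>u. h u x) us \<in> carrier (RDirProd_list (map A us))" if "x \<in> C" for x
    unfolding RDirProd_list_carrier_iff using carrier that by simp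
  show "map (\<lambda>u. h u x) us \<in> carrier (algebra_prod_list (map A us))"
    unfolding algebra_prod_list_sel by (rule c[OF xy(1)])
  show "map (\<lambda>u. h u z) us = map (\<lambda>u. h u x) us \<otimes>\<^bsub>algebra_prod_list (map A us)\<^esub> map (\<lambda>u. h u y) us"
    if "\<And>u. u \<in> set us \<Longrightarrow> h u z = h u x \<otimes>\<^bsub>A u\<^esub> h u y"
    unfolding algebra_prod_list_sel RDirProd_list_ops(1)[OF c[OF xy(1)] c[OF xy(2)]]
    using that by (intro nth_equalityI) auto
  show "map (\<lambda>u. h u z) us = map (\<lambda>u. h u x) us \<oplus>\<^bsub>algebra_prod_list (map A us)\<^esub> map (\<lambda>u. h u y) us"
    if "\<And>u. u \<in> set us \<Longrightarrow> h u z = h u x \<oplus>\<^bsub>A u\<^esub> h u y"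
    unfolding algebra_prod_list_sel RDirProd_list_ops(2)[OF c[OF xy(1)] c[OF xy(2)]]
    using that by (intro nth_equalityI) auto
  show "map (\<lambda>u. h u z) us = c \<odot>\<^bsub>algebra_prod_list (map A us)\<^esub> map (\<lambda>u. h u x) us"
    if "\<And>u. u \<in> set us \<Longrightarrow> h u z = c \<odot>\<^bsub>A u\<^esub> h u x"
    unfolding algebra_prod_list_sel using that by (intro nth_equalityI) auto
  show "map (\<lambda>u. h u z) us = \<one>\<^bsub>algebra_prod_list (map A us)\<^esub>"
    if "\<And>u. u \<in> set us \<Longrightarrow> h u z = \<one>\<^bsub>A u\<^esub>"
    unfolding algebra_prod_list_sel RDirProd_list_one_map using that by (intro nth_equalityI) auto
qed

locale block_enumeration =
  fixes Y :: "'y set" and en :: "'y \<Rightarrow> 'u" and W :: "'u set" and us ws :: "'u list"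
    and ps :: "'u \<Rightarrow> 'y list"
  assumes finite_Y: "finite Y" and us_ws: "set us \<union> set ws = en ` Y" "distinct us" "distinct ws"
    and us_W: "set us \<inter> W = {}" and ws_W: "set ws \<subseteq> W"
    and ps: "distinct (ps u)" "set (ps u) = {y \<in> Y. en y = u}"
begin

definition block :: "('r::comm_ring_1 laurent \<Rightarrow> 's) \<Rightarrow> 'u \<Rightarrow> ('y \<Rightarrow> 'y \<Rightarrow> 'r laurent) \<Rightarrow> 's mat" where
  "block f u g = mat (length (ps u)) (length (ps u)) (\<lambda>(i, j). f (g (ps u ! i) (ps u ! j)))"

definition blocks :: "('y \<Rightarrow> 'y \<Rightarrow> 'r::comm_ring_1 laurent) \<Rightarrow> 'r mat list \<times> 'r laurent mat list" where
  "blocks g = (map (\<lambda>u. block (\<lambda>s. Poly_Mapping.lookup s 0) u g) us, map (\<lambda>u. block (\<lambda>s. s) u g) ws)"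

abbreviation "ms \<equiv> map (\<lambda>u. length (ps u)) us"
abbreviation "ns \<equiv> map (\<lambda>u. length (ps u)) ws"

lemma ps_nth: "i < length (ps u) \<Longrightarrow> ps u ! i \<in> Y \<and> en (ps u ! i) = u"
  using ps(2)[of u] nth_mem by blast

lemma block_carrier [simp]: "block f u g \<in> carrier_mat (length (ps u)) (length (ps u))"
  by (simp add: block_def)

text \<open>Multiplicativity of f is asked only on the entries of the block: the coefficient at t^0
  is not multiplicative on all Laurent polynomials, but it is on constants. Entries outside the
  block vanish, which shortens the sum over Y.\<close>

lemma block_mult:
  assumes g: "g \<in> carrier (bmat Y en W)" and h: "h \<in> carrier (bmat Y en W)"
    and f: "\<And>(A :: nat set) k. f (\<Sum>i\<in>A. k i) = (\<Sum>i\<in>A. f (k i) :: 's::comm_ring_1)"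
      "\<And>x y. x \<in> entries W u \<Longrightarrow> y \<in> entries W u \<Longrightarrow> f (x * y) = f x * f y"
  shows "block f u (g \<otimes>\<^bsub>bmat Y en W\<^esub> h) = block f u g * block f u h"
proof (rule eq_matI)
  fix i j assume "i < dim_row (block f u g * block f u h)" "j < dim_col (block f u g * block f u h)"
  then have ij: "i < length (ps u)" "j < length (ps u)" by (simp_all add: block_def)
  let ?b = "ps u ! i" and ?a = "ps u ! j"
  have "g ?b y = 0" if "y \<in> Y" "en y \<noteq> u" for y
    using bmat_carrierD(2)[OF g, of ?b y] ps_nth[OF ij(1)] that by auto
  then have "(\<Sum>y\<in>Y. g ?b y * h y ?a) = (\<Sum>y\<in>set (ps u). g ?b y * h y ?a)"
    unfolding ps(2) using finite_Y by (intro sum.mono_neutral_right) simp_all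
  also have "\<dots> = (\<Sum>k<length (ps u). g ?b (ps u ! k) * h (ps u ! k) ?a)"
    using sum.reindex_bij_betw[OF bij_betw_nth[OF ps(1) refl refl], of "\<lambda>y. g ?b y * h y ?a"] by simp
  finally have "f (\<Sum>y\<in>Y. g ?b y * h y ?a) = (\<Sum>k<length (ps u). f (g ?b (ps u ! k)) * f (h (ps u ! k) ?a))"
  proof (simp only: f(1), intro sum.cong refl)
    fix k assume "k \<in> {..<length (ps u)}"
    then have "ps u ! k \<in> Y \<and> en (ps u ! k) = u" by (simp add: ps_nth)
    then show "f (g ?b (ps u ! k) * h (ps u ! k) ?a) = f (g ?b (ps u ! k)) * f (h (ps u ! k) ?a)"
      using bmat_carrierD(1)[OF g, of ?b "ps u ! k"] bmat_carrierD(1)[OF h, of "ps u ! k" ?a]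
        ps_nth[OF ij(1)] ps_nth[OF ij(2)] by (intro f(2)) auto
  qed
  then show "block f u (g \<otimes>\<^bsub>bmat Y en W\<^esub> h) $$ (i, j) = (block f u g * block f u h) $$ (i, j)"
    using ij by (simp add: block_def scalar_prod_def lessThan_atLeast0)
qed (simp_all add: block_def)

lemma lookup_entries_mult:
  assumes "u \<notin> W" "x \<in> entries W u" "y \<in> entries W u"
  shows "Poly_Mapping.lookup (x * y) 0 = Poly_Mapping.lookup x 0 * (Poly_Mapping.lookup y 0 :: 'r::comm_ring_1)"
  using assms by (auto simp: entries_def mult_single)

lemma blocks_hom:
  assumes g: "g \<in> carrier (bmat Y en W)" and h: "h \<in> carrier (bmat Y en W)"
  defines "P \<equiv> algebra_prod (matrix_product ms) (laurent_matrix_product ns) :: ('r::comm_ring_1, _) module"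
  shows "blocks g \<in> carrier P"
    "blocks (g \<otimes>\<^bsub>bmat Y en W\<^esub> h) = blocks g \<otimes>\<^bsub>P\<^esub> blocks h"
    "blocks (g \<oplus>\<^bsub>bmat Y en W\<^esub> h) = blocks g \<oplus>\<^bsub>P\<^esub> blocks h"
    "blocks (\<lambda>b a. Poly_Mapping.single 0 r * g b a) = r \<odot>\<^bsub>P\<^esub> blocks g"
    "blocks \<one>\<^bsub>bmat Y en W\<^esub> = \<one>\<^bsub>P\<^esub>"
proof -
  let ?A = "\<lambda>u. module_mat TYPE('r) (length (ps u)) (length (ps u))"
  let ?A' = "\<lambda>u. laurent_module_mat (length (ps u)) :: ('r, _) module"
  have P: "P = algebra_prod (algebra_prod_list (map ?A us)) (algebra_prod_list (map ?A' ws))"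
    by (simp add: P_def matrix_product_def laurent_matrix_product_def comp_def)
  let ?C = "carrier (bmat Y en W) :: ('y \<Rightarrow> 'y \<Rightarrow> 'r laurent) set"
  let ?h = "block (\<lambda>s. Poly_Mapping.lookup s 0)" and ?h' = "block (\<lambda>s. s)"
  note F = algebra_prod_list_family[of us ?C ?h ?A, OF _ g h] algebra_prod_list_family[of ws ?C ?h' ?A', OF _ g h]
  have c: "?h u x \<in> carrier (?A u)" "?h' u x \<in> carrier (?A' u)" for u x
    by (simp_all add: module_mat_simps)
  show "blocks g \<in> carrier P"
    unfolding P algebra_prod_sel blocks_def using F(1,6) c by blast
  have "?h u (g \<otimes>\<^bsub>bmat Y en W\<^esub> h) = ?h u g \<otimes>\<^bsub>?A u\<^esub> ?h u h" if "u \<in> set us" for u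
    using that us_W unfolding module_mat_simps
    by (intro block_mult g h lookup_entries_mult) (auto simp: lookup_sum)
  moreover have "?h' u (g \<otimes>\<^bsub>bmat Y en W\<^esub> h) = ?h' u g \<otimes>\<^bsub>?A' u\<^esub> ?h' u h" for u
    unfolding laurent_module_mat_sel by (intro block_mult g h) auto
  ultimately show "blocks (g \<otimes>\<^bsub>bmat Y en W\<^esub> h) = blocks g \<otimes>\<^bsub>P\<^esub> blocks h"
    unfolding P algebra_prod_sel blocks_def prod.case
    by (intro arg_cong2[of _ _ _ _ Pair] F(2,7)) (use c in blast)+
  have "?h u (g \<oplus>\<^bsub>bmat Y en W\<^esub> h) = ?h u g \<oplus>\<^bsub>?A u\<^esub> ?h u h" for u
    unfolding module_mat_simps by (rule eq_matI) (simp_all add: block_def lookup_add)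
  moreover have "?h' u (g \<oplus>\<^bsub>bmat Y en W\<^esub> h) = ?h' u g \<oplus>\<^bsub>?A' u\<^esub> ?h' u h" for u
    unfolding laurent_module_mat_sel by (rule eq_matI) (simp_all add: block_def)
  ultimately show "blocks (g \<oplus>\<^bsub>bmat Y en W\<^esub> h) = blocks g \<oplus>\<^bsub>P\<^esub> blocks h"
    unfolding P algebra_prod_sel blocks_def prod.case
    by (intro arg_cong2[of _ _ _ _ Pair] F(3,8)) (use c in blast)+
  have "?h u (\<lambda>b a. Poly_Mapping.single 0 r * g b a) = r \<odot>\<^bsub>?A u\<^esub> ?h u g" for u
    unfolding module_mat_simps by (rule eq_matI) (simp_all add: block_def lookup_single_times)
  moreover have "?h' u (\<lambda>b a. Poly_Mapping.single 0 r * g b a) = r \<odot>\<^bsub>?A' u\<^esub> ?h' u g" for u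
    unfolding laurent_module_mat_sel by (rule eq_matI) (simp_all add: block_def)
  ultimately show "blocks (\<lambda>b a. Poly_Mapping.single 0 r * g b a) = r \<odot>\<^bsub>P\<^esub> blocks g"
    unfolding P algebra_prod_sel blocks_def prod.case
    by (intro arg_cong2[of _ _ _ _ Pair] F(4,9)) (use c in blast)+
  have "?h u \<one>\<^bsub>bmat Y en W\<^esub> = \<one>\<^bsub>?A u\<^esub>" for u
    unfolding module_mat_simps
    by (rule eq_matI) (auto simp: block_def ps_nth nth_eq_iff_index_eq[OF ps(1)])
  moreover have "?h' u \<one>\<^bsub>bmat Y en W\<^esub> = \<one>\<^bsub>?A' u\<^esub>" for u
    unfolding laurent_module_mat_sel
    by (rule eq_matI) (auto simp: block_def ps_nth nth_eq_iff_index_eq[OF ps(1)])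
  ultimately show "blocks \<one>\<^bsub>bmat Y en W\<^esub> = \<one>\<^bsub>P\<^esub>"
    unfolding P algebra_prod_sel blocks_def
    by (intro arg_cong2[of _ _ _ _ Pair] F(5,10)) (use c in blast)+
qed

lemma ps_index:
  assumes "b \<in> Y"
  obtains i where "i < length (ps (en b))" "ps (en b) ! i = b"
  using assms ps(2)[of "en b"] by (metis (mono_tags, lifting) in_set_conv_nth mem_Collect_eq)

lemma blocks_inj:
  assumes g: "g \<in> carrier (bmat Y en W)" and h: "h \<in> carrier (bmat Y en W)" and eq: "blocks g = blocks h"
  shows "g = (h :: 'y \<Rightarrow> 'y \<Rightarrow> 'r::comm_ring_1 laurent)"
proof (intro ext)
  fix b a
  show "g b a = h b a"
  proof (cases "b \<in> Y \<and> a \<in> Y \<and> en b = en a")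
    case False
    then show ?thesis using bmat_carrierD(2)[OF g, of b a] bmat_carrierD(2)[OF h, of b a] by auto
  next
    case True
    let ?u = "en b"
    obtain i where i: "i < length (ps ?u)" "ps ?u ! i = b" using True ps_index[of b] by metis
    obtain j where j: "j < length (ps ?u)" "ps ?u ! j = a" using True ps_index[of a] by metis
    have "?u \<in> set us \<or> ?u \<in> set ws" using us_ws(1) True by blast
    then show ?thesis
    proof
      assume u: "?u \<in> set us"
      then have block: "block (\<lambda>s. Poly_Mapping.lookup s 0) ?u g = block (\<lambda>s. Poly_Mapping.lookup s 0) ?u h"
        using eq by (simp add: blocks_def)
      have "Poly_Mapping.lookup (g b a) 0 = Poly_Mapping.lookup (h b a) 0"
        using arg_cong[OF block, of "\<lambda>M. M $$ (i, j)"] i j by (simp add: block_def)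
      moreover have "g b a \<in> entries W ?u" "h b a \<in> entries W ?u" "?u \<notin> W"
        using bmat_carrierD(1)[OF g, of b a] bmat_carrierD(1)[OF h, of b a] True u us_W by auto
      ultimately show ?thesis by (auto simp: entries_def)
    next
      assume u: "?u \<in> set ws"
      then have block: "block (\<lambda>s. s) ?u g = block (\<lambda>s. s) ?u h" using eq by (simp add: blocks_def)
      show ?thesis using arg_cong[OF block, of "\<lambda>M. M $$ (i, j)"] i j by (simp add: block_def)
    qed
  qed
qed

lemma blocks_surj:
  assumes "z \<in> carrier (algebra_prod (matrix_product ms) (laurent_matrix_product ns) :: ('r::comm_ring_1, _) module)"
  shows "\<exists>g\<in>carrier (bmat Y en W). blocks g = z"
proof -
  obtain Ms Ns where z: "z = (Ms, Ns)" by (cases z)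
  have Ms: "length Ms = length us" "\<And>k. k < length us \<Longrightarrow> Ms ! k \<in> carrier_mat (length (ps (us ! k))) (length (ps (us ! k)))"
    and Ns: "length Ns = length ws" "\<And>k. k < length ws \<Longrightarrow> Ns ! k \<in> carrier_mat (length (ps (ws ! k))) (length (ps (ws ! k)))"
    using assms
    by (auto simp: z algebra_prod_sel matrix_product_def laurent_matrix_product_def algebra_prod_list_sel
        RDirProd_list_carrier_iff module_mat_simps)
  \<comment> \<open>These maps invert the enumerations: they return the position of a block among
    the factors and of an index within its block.\<close>
  define iu where "iu u = (SOME k. k < length us \<and> us ! k = u)" for u
  define iw where "iw u = (SOME k. k < length ws \<and> ws ! k = u)" for u
  define iy where "iy b = (SOME i. i < length (ps (en b)) \<and> ps (en b) ! i = b)" for b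
  have iu: "iu (us ! k) = k" if "k < length us" for k
    unfolding iu_def by (rule some_equality) (use that nth_eq_iff_index_eq[OF us_ws(2)] in auto)
  have iw: "iw (ws ! k) = k" if "k < length ws" for k
    unfolding iw_def by (rule some_equality) (use that nth_eq_iff_index_eq[OF us_ws(3)] in auto)
  have iy: "iy (ps u ! i) = i" if "i < length (ps u)" for u i
    unfolding iy_def using ps_nth[OF that]
    by (intro some_equality) (use that nth_eq_iff_index_eq[OF ps(1)] in auto)
  define g where "g b a = (if b \<in> Y \<and> a \<in> Y \<and> en b = en a then
      (if en b \<in> W then Ns ! iw (en b) $$ (iy b, iy a) else Poly_Mapping.single 0 (Ms ! iu (en b) $$ (iy b, iy a)))
      else 0)" for b a
  have gc: "g \<in> carrier (bmat Y en W)"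
    by (rule bmat_carrierI) (auto simp: g_def entries_def)
  have "map (\<lambda>u. block (\<lambda>s. Poly_Mapping.lookup s 0) u g) us = Ms"
  proof (rule nth_equalityI)
    fix k assume "k < length (map (\<lambda>u. block (\<lambda>s. Poly_Mapping.lookup s 0) u g) us)"
    then have k: "k < length us" by simp
    then have "us ! k \<notin> W" using us_W nth_mem by blast
    then have "block (\<lambda>s. Poly_Mapping.lookup s 0) (us ! k) g = Ms ! k"
      using Ms(2)[OF k] by (intro eq_matI) (auto simp: block_def g_def ps_nth iy iu[OF k])
    then show "map (\<lambda>u. block (\<lambda>s. Poly_Mapping.lookup s 0) u g) us ! k = Ms ! k" using k by simp
  qed (simp add: Ms(1))
  moreover have "map (\<lambda>u. block (\<lambda>s. s) u g) ws = Ns"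
  proof (rule nth_equalityI)
    fix k assume "k < length (map (\<lambda>u. block (\<lambda>s. s) u g) ws)"
    then have k: "k < length ws" by simp
    then have "ws ! k \<in> W" using ws_W nth_mem by blast
    then have "block (\<lambda>s. s) (ws ! k) g = Ns ! k"
      using Ns(2)[OF k] by (intro eq_matI) (auto simp: block_def g_def ps_nth iy iw[OF k])
    then show "map (\<lambda>u. block (\<lambda>s. s) u g) ws ! k = Ns ! k" using k by simp
  qed (simp add: Ns(1))
  ultimately show ?thesis using gc by (intro bexI[of _ g]) (simp_all add: blocks_def z)
qed

lemma ms_ns_pos: "0 \<notin> set ms" "0 \<notin> set ns"
proof -
  have "ps u \<noteq> []" if "u \<in> set us \<union> set ws" for u
    using that ps(2)[of u] unfolding us_ws(1) by auto
  then show "0 \<notin> set ms" "0 \<notin> set ns" by auto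
qed

end

lemma inv_into_hom:
  assumes h: "bij_betw h A B" and hom: "\<And>x y. x \<in> A \<Longrightarrow> y \<in> A \<Longrightarrow> f x y \<in> A \<and> h (f x y) = f' (h x) (h y)"
    and xy: "x \<in> B" "y \<in> B"
  shows "inv_into A h (f' x y) = f (inv_into A h x) (inv_into A h y)"
proof -
  have "inv_into A h z \<in> A \<and> h (inv_into A h z) = z" if "z \<in> B" for z
    using that bij_betw_imp_surj_on[OF h] by (auto intro: inv_into_into f_inv_into_f)
  then show ?thesis
    using hom xy inv_into_f_f[OF bij_betw_imp_inj_on[OF h]] by metis
qed

lemma algebra_isomorphic_fst:
  fixes A :: "('r::comm_ring_1, 'a) module"
  assumes "algebra_isomorphic A (algebra_prod X (laurent_matrix_product []))"
  shows "algebra_isomorphic A X"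
proof -
  let ?P = "algebra_prod X (laurent_matrix_product [])"
  obtain h where h: "h \<in> ring_iso A ?P" "\<And>c x. x \<in> carrier A \<Longrightarrow> h (c \<odot>\<^bsub>A\<^esub> x) = c \<odot>\<^bsub>?P\<^esub> h x"
    using assms by (auto simp: algebra_isomorphic_def)
  have "x \<in> carrier (laurent_matrix_product []) \<longleftrightarrow> x = []" for x :: "'r laurent mat list"
    by (simp add: laurent_matrix_product_def algebra_prod_list_sel RDirProd_list_carrier_iff)
  then have carrier: "carrier ?P = carrier X \<times> {[]}" by (auto simp: algebra_prod_sel)
  then have "bij_betw fst (carrier ?P) (carrier X)" by (simp add: bij_betw_def inj_on_def)
  then have bij: "bij_betw (\<lambda>x. fst (h x)) (carrier A) (carrier X)"
    using bij_betw_trans[OF ring_iso_memE(5)[OF h(1)]] by (simp add: comp_def)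
  have "(\<lambda>x. fst (h x)) \<in> ring_iso A X"
  proof (rule ring_iso_memI)
    show "fst (h x) \<in> carrier X" if "x \<in> carrier A" for x
      using ring_iso_memE(1)[OF h(1) that] by (auto simp: carrier)
    show "fst (h (x \<otimes>\<^bsub>A\<^esub> y)) = fst (h x) \<otimes>\<^bsub>X\<^esub> fst (h y)" if "x \<in> carrier A" "y \<in> carrier A" for x y
      by (simp add: ring_iso_memE(2)[OF h(1) that] algebra_prod_sel split_beta)
    show "fst (h (x \<oplus>\<^bsub>A\<^esub> y)) = fst (h x) \<oplus>\<^bsub>X\<^esub> fst (h y)" if "x \<in> carrier A" "y \<in> carrier A" for x y
      by (simp add: ring_iso_memE(3)[OF h(1) that] algebra_prod_sel split_beta)
    show "fst (h \<one>\<^bsub>A\<^esub>) = \<one>\<^bsub>X\<^esub>"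
      by (simp add: ring_iso_memE(4)[OF h(1)] algebra_prod_sel)
  qed (rule bij)
  moreover have "fst (h (c \<odot>\<^bsub>A\<^esub> x)) = c \<odot>\<^bsub>X\<^esub> fst (h x)" if "x \<in> carrier A" for c x
    by (simp add: h(2)[OF that] algebra_prod_sel split_beta)
  ultimately show ?thesis
    unfolding algebra_isomorphic_def by (intro bexI[of _ "\<lambda>x. fst (h x)"] allI ballI)
qed

section \<open>Isomorphism with the product of matrix algebras\<close>

context ne_graph
begin

lemma \<Psi>_carrier: "x \<in> carrier (L :: ('r::comm_ring_1, _) module) \<Longrightarrow> \<Psi> x \<in> carrier (bmat BP snd W)"
  using \<Psi>_bij by (rule bij_betw_apply)

text \<open>The field \<open>one\<close> is a definite description. The preimage of the identity
  matrix is a two-sided identity of the algebra, and such an element is unique.\<close>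

lemma \<Psi>_one: "\<Psi> \<one>\<^bsub>L :: ('r::comm_ring_1, _) module\<^esub> = \<one>\<^bsub>bmat BP snd W\<^esub>"
proof -
  let ?L = "L :: ('r, _) module" and ?B = "bmat BP snd W :: (_ \<Rightarrow> _ \<Rightarrow> 'r laurent) ring"
  have "\<one>\<^bsub>?B\<^esub> \<in> carrier ?B"
    by (rule bmat_carrierI) auto
  then have "\<one>\<^bsub>?B\<^esub> \<in> \<Psi> ` carrier ?L" unfolding bij_betw_imp_surj_on[OF \<Psi>_bij] .
  then obtain u where u: "u \<in> carrier ?L" "\<Psi> u = \<one>\<^bsub>?B\<^esub>" by (metis imageE)
  have unit: "u \<otimes>\<^bsub>?L\<^esub> x = x \<and> x \<otimes>\<^bsub>?L\<^esub> u = x" if x: "x \<in> carrier ?L" for x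
  proof -
    interpret L: nonunital_ring ?L by (rule nonunital_ring_L)
    have "\<Psi> (u \<otimes>\<^bsub>?L\<^esub> x) = \<Psi> x" "\<Psi> (x \<otimes>\<^bsub>?L\<^esub> u) = \<Psi> x"
      unfolding \<Psi>_hom(1)[OF u(1) x] \<Psi>_hom(1)[OF x u(1)] u(2)
      by (rule bmat_one[OF finite_BP \<Psi>_carrier[OF x]])+
    then show ?thesis
      using inj_onD[OF bij_betw_imp_inj_on[OF \<Psi>_bij], of "u \<otimes>\<^bsub>?L\<^esub> x" x]
        inj_onD[OF bij_betw_imp_inj_on[OF \<Psi>_bij], of "x \<otimes>\<^bsub>?L\<^esub> u" x] u(1) x by simp
  qed
  have "\<one>\<^bsub>?L\<^esub> = u"
    unfolding L_one
  proof (rule the_equality)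
    fix v assume v: "v \<in> carrier ?L \<and> (\<forall>x\<in>carrier ?L. v \<otimes>\<^bsub>?L\<^esub> x = x \<and> x \<otimes>\<^bsub>?L\<^esub> v = x)"
    then have "v \<otimes>\<^bsub>?L\<^esub> u = u" using u(1) by blast
    moreover have "v \<otimes>\<^bsub>?L\<^esub> u = v" using unit v by blast
    ultimately show "v = u" by (rule trans[OF sym, rotated])
  qed (use u(1) unit in blast)
  then show ?thesis using u(2) by (rule ssubst)
qed

definition \<Psi>' :: "('e list \<times> 'v \<Rightarrow> 'e list \<times> 'v \<Rightarrow> 'r::comm_ring_1 laurent) \<Rightarrow> (('v, 'e) lpa_gen free_monoid \<Rightarrow>\<^sub>0 'r) set" where
  "\<Psi>' = inv_into (carrier L) \<Psi>"

lemma \<Psi>'_iso: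
  fixes g h :: "'e list \<times> 'v \<Rightarrow> 'e list \<times> 'v \<Rightarrow> 'r::comm_ring_1 laurent"
  shows "bij_betw \<Psi>' (carrier (bmat BP snd W)) (carrier (L :: ('r, _) module))"
    and "g \<in> carrier (bmat BP snd W) \<Longrightarrow> h \<in> carrier (bmat BP snd W) \<Longrightarrow>
      \<Psi>' (g \<oplus>\<^bsub>bmat BP snd W\<^esub> h) = \<Psi>' g \<oplus>\<^bsub>L\<^esub> \<Psi>' h"
    and "g \<in> carrier (bmat BP snd W) \<Longrightarrow> h \<in> carrier (bmat BP snd W) \<Longrightarrow>
      \<Psi>' (g \<otimes>\<^bsub>bmat BP snd W\<^esub> h) = \<Psi>' g \<otimes>\<^bsub>L\<^esub> \<Psi>' h"
proof -
  interpret L: nonunital_ring "L :: ('r, _) module" by (rule nonunital_ring_L)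
  show "bij_betw \<Psi>' (carrier (bmat BP snd W)) (carrier (L :: ('r, _) module))"
    unfolding \<Psi>'_def by (rule bij_betw_inv_into[OF \<Psi>_bij])
  show "\<Psi>' (g \<oplus>\<^bsub>bmat BP snd W\<^esub> h) = \<Psi>' g \<oplus>\<^bsub>L\<^esub> \<Psi>' h"
    if "g \<in> carrier (bmat BP snd W)" "h \<in> carrier (bmat BP snd W)"
    unfolding \<Psi>'_def
    by (rule inv_into_hom[where f' = "add (bmat BP snd W)", OF \<Psi>_bij _ that]) (intro conjI L.a_closed \<Psi>_hom(2))
  show "\<Psi>' (g \<otimes>\<^bsub>bmat BP snd W\<^esub> h) = \<Psi>' g \<otimes>\<^bsub>L\<^esub> \<Psi>' h"
    if "g \<in> carrier (bmat BP snd W)" "h \<in> carrier (bmat BP snd W)"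
    unfolding \<Psi>'_def
    by (rule inv_into_hom[where f' = "mult (bmat BP snd W)", OF \<Psi>_bij _ that]) (intro conjI L.m_closed \<Psi>_hom(1))
qed

lemma left_noetherian_L:
  assumes "left_noetherian (class_ring :: 'r::comm_ring_1 ring)"
  shows "left_noetherian (L :: ('r, _) module)"
  by (rule chain_conditions_image(1)[where h = \<Psi>', OF nonunital_ring_bmat nonunital_ring_L
        bij_betw_imp_surj_on[OF \<Psi>'_iso(1)] \<Psi>'_iso(2) \<Psi>'_iso(3) left_noetherian_bmat[OF finite_BP assms]])

lemma left_artinian_L:
  assumes "W = {}" "left_artinian (class_ring :: 'r::comm_ring_1 ring)"
  shows "left_artinian (L :: ('r, _) module)"
proof -
  have "left_artinian (bmat BP snd V :: (_ \<Rightarrow> _ \<Rightarrow> 'r laurent) ring)" if "V = {}" for V :: "'v set"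
    unfolding that by (rule left_artinian_bmat[OF finite_BP assms(2)])
  note artinian = this[OF assms(1)]
  show ?thesis
    by (rule chain_conditions_image(2)[where h = \<Psi>', OF nonunital_ring_bmat nonunital_ring_L
        bij_betw_imp_surj_on[OF \<Psi>'_iso(1)] \<Psi>'_iso(2) \<Psi>'_iso(3) artinian])
qed

lemma semisimple_ring_L:
  assumes "W = {}" "finite_product_of_fields (class_ring :: 'r::comm_ring_1 ring)"
  shows "semisimple_ring (L :: ('r, _) module)"
proof -
  obtain n and e :: "nat \<Rightarrow> 'r" where e: "\<And>i. i < n \<Longrightarrow> e i \<noteq> 0"
    "\<And>i j. i < n \<Longrightarrow> j < n \<Longrightarrow> e i * e j = (if i = j then e i else 0)"
    "(\<Sum>i<n. e i) = 1" "\<And>i r. i < n \<Longrightarrow> r * e i \<noteq> 0 \<Longrightarrow> \<exists>s. s * (r * e i) = e i"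
    using finite_product_of_fields_class_ringD[OF assms(2)] by metis
  have "semisimple_ring (L :: ('r, _) module)"
    if "V = {}" and g: "bij_betw \<Psi>' (carrier (bmat BP snd V)) (carrier (L :: ('r, _) module))"
      "\<And>x y. x \<in> carrier (bmat BP snd V) \<Longrightarrow> y \<in> carrier (bmat BP snd V) \<Longrightarrow>
        \<Psi>' (x \<oplus>\<^bsub>bmat BP snd V\<^esub> y) = \<Psi>' x \<oplus>\<^bsub>L :: ('r, _) module\<^esub> \<Psi>' y"
      "\<And>x y. x \<in> carrier (bmat BP snd V) \<Longrightarrow> y \<in> carrier (bmat BP snd V) \<Longrightarrow>
        \<Psi>' (x \<otimes>\<^bsub>bmat BP snd V\<^esub> y) = \<Psi>' x \<otimes>\<^bsub>L :: ('r, _) module\<^esub> \<Psi>' y"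
    for V :: "'v set"
    by (rule semisimple_ring_bmat_iso[where g = \<Psi>' and Y = BP and en = snd and n = n and \<epsilon> = e,
          OF finite_BP nonunital_ring_L g[unfolded \<open>V = {}\<close>] e])
  then show ?thesis using assms(1) \<Psi>'_iso by blast
qed

lemma algebra_isomorphic_product:
  obtains ms ns where "0 \<notin> set ms" "0 \<notin> set ns" "W = {} \<longrightarrow> ns = []"
    "algebra_isomorphic (L :: ('r::comm_ring_1, _) module) (algebra_prod (matrix_product ms) (laurent_matrix_product ns))"
proof -
  let ?L = "L :: ('r, _) module"
  have fin: "finite (snd ` BP)" "finite {y \<in> BP. snd y = u}" for u using finite_BP by auto
  \<comment> \<open>Endpoints outside W are sinks and give blocks over R; those in W give blocks
    over Laurent polynomials. Only endpoints of basis paths are listed, so no block is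
    empty.\<close>
  obtain us where us: "set us = snd ` BP - W" "distinct us" using finite_distinct_list[of "snd ` BP - W"] fin by auto
  obtain ws where ws: "set ws = snd ` BP \<inter> W" "distinct ws" using finite_distinct_list[of "snd ` BP \<inter> W"] fin by auto
  obtain ps where ps: "\<And>u. set (ps u) = {y \<in> BP. snd y = u} \<and> distinct (ps u)"
    using finite_distinct_list[OF fin(2)] by metis
  interpret B: block_enumeration BP snd W us ws ps
    by unfold_locales (use finite_BP us ws ps in auto)
  let ?P = "algebra_prod (matrix_product B.ms) (laurent_matrix_product B.ns) :: ('r, _) module"
  have inj: "inj_on (B.blocks :: _ \<Rightarrow> 'r mat list \<times> _) (carrier (bmat BP snd W))"
    by (rule inj_onI) (rule B.blocks_inj)
  have "B.blocks ` carrier (bmat BP snd W) = carrier ?P"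
    using B.blocks_hom(1)[where 'r = 'r] B.blocks_surj[where 'r = 'r] by blast
  with inj have "bij_betw B.blocks (carrier (bmat BP snd W)) (carrier ?P)"
    by (rule bij_betw_imageI)
  from bij_betw_trans[OF \<Psi>_bij this]
  have bij: "bij_betw (\<lambda>x. B.blocks (\<Psi> x)) (carrier ?L) (carrier ?P)" by (simp only: comp_def)
  have "(\<lambda>x. B.blocks (\<Psi> x)) \<in> ring_iso ?L ?P"
  proof (rule ring_iso_memI)
    fix x y assume x: "x \<in> carrier ?L"
    show "B.blocks (\<Psi> x) \<in> carrier ?P" by (rule B.blocks_hom(1)) (rule \<Psi>_carrier[OF x])+
    assume y: "y \<in> carrier ?L"
    show "B.blocks (\<Psi> (x \<otimes>\<^bsub>?L\<^esub> y)) = B.blocks (\<Psi> x) \<otimes>\<^bsub>?P\<^esub> B.blocks (\<Psi> y)"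
      unfolding \<Psi>_hom(1)[OF x y] by (rule B.blocks_hom(2)[OF \<Psi>_carrier[OF x] \<Psi>_carrier[OF y]])
    show "B.blocks (\<Psi> (x \<oplus>\<^bsub>?L\<^esub> y)) = B.blocks (\<Psi> x) \<oplus>\<^bsub>?P\<^esub> B.blocks (\<Psi> y)"
      unfolding \<Psi>_hom(2)[OF x y] by (rule B.blocks_hom(3)[OF \<Psi>_carrier[OF x] \<Psi>_carrier[OF y]])
  next
    have "(\<lambda>b a. 0) \<in> carrier (bmat BP snd W :: (_ \<Rightarrow> _ \<Rightarrow> 'r laurent) ring)"
      by (rule bmat_carrierI) auto
    then show "B.blocks (\<Psi> \<one>\<^bsub>?L\<^esub>) = \<one>\<^bsub>?P\<^esub>"
      unfolding \<Psi>_one by (intro B.blocks_hom(5))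
  qed (rule bij)
  moreover have "B.blocks (\<Psi> (c \<odot>\<^bsub>?L\<^esub> x)) = c \<odot>\<^bsub>?P\<^esub> B.blocks (\<Psi> x)" if x: "x \<in> carrier ?L" for c x
    unfolding \<Psi>_hom(3)[OF x x] by (rule B.blocks_hom(4)[OF \<Psi>_carrier[OF x] \<Psi>_carrier[OF x]])
  ultimately have "algebra_isomorphic ?L ?P"
    unfolding algebra_isomorphic_def by (intro bexI[of _ "\<lambda>x. B.blocks (\<Psi> x)"] allI ballI)
  moreover have "W = {} \<longrightarrow> B.ns = []"
  proof
    assume "W = {}"
    have "set ws \<subseteq> {}" by (rule subset_trans[OF B.ws_W equalityD1[OF \<open>W = {}\<close>]])
    then show "B.ns = []" by simp
  qed
  ultimately show ?thesis by (intro that[OF B.ms_ns_pos])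
qed

end

section \<open>Necessity and sufficiency of the conditions\<close>

context lpa_graph
begin

lemma conditions_necessary:
  assumes "verts E \<noteq> {}"
  shows "left_noetherian (L :: ('r::comm_ring_1, _) module) \<Longrightarrow>
      left_noetherian (class_ring :: 'r ring) \<and> fin_digraph E \<and> condition_NE E"
    and "left_artinian (L :: ('r, _) module) \<Longrightarrow>
      left_artinian (class_ring :: 'r ring) \<and> fin_digraph E \<and> acyclic_digraph E"
    and "semisimple_ring (L :: ('r, _) module) \<Longrightarrow>
      finite_product_of_fields (class_ring :: 'r ring) \<and> fin_digraph E \<and> acyclic_digraph E"
proof -
  \<comment> \<open>With \<open>W = {}\<close> all weights are 0. Acyclicity comes from
    \<open>cycle_imp_not_artinian_semisimple\<close>, which chooses its own weights for the given
    cycle.\<close>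
  interpret bpath_rep E "{}" ..
  show noetherian: "left_noetherian (class_ring :: 'r ring) \<and> fin_digraph E \<and> condition_NE E"
    if "left_noetherian (L :: ('r, _) module)"
    using scalars_chain_conditions(1)[OF assms that] chain_condition_imp_fin_digraph[OF disjI1[OF that]]
      chain_condition_imp_NE[OF disjI1[OF that]] by blast
  show "left_artinian (class_ring :: 'r ring) \<and> fin_digraph E \<and> acyclic_digraph E"
    if A: "left_artinian (L :: ('r, _) module)"
  proof -
    have "acyclic_digraph E"
      unfolding acyclic_digraph_def
    proof
      assume "\<exists>p. cycle p"
      then obtain p where "cycle p" ..
      from cycle_imp_not_artinian_semisimple(1)[OF this] A show False by (rule notE)
    qed
    then show ?thesis
      using scalars_chain_conditions(2)[OF assms A] chain_condition_imp_fin_digraph[OF disjI2[OF A]] by blast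
  qed
  show "finite_product_of_fields (class_ring :: 'r ring) \<and> fin_digraph E \<and> acyclic_digraph E"
    if S: "semisimple_ring (L :: ('r, _) module)"
  proof -
    have "acyclic_digraph E"
      unfolding acyclic_digraph_def
    proof
      assume "\<exists>p. cycle p"
      then obtain p where "cycle p" ..
      from cycle_imp_not_artinian_semisimple(2)[OF this] S show False by (rule notE)
    qed
    \<comment> \<open>R inherits the chain condition and regularity from the algebra, and these two
      together split R into fields.\<close>
    moreover have N: "left_noetherian (L :: ('r, _) module)"
      by (rule nonunital_ring.semisimple_imp_left_noetherian[OF nonunital_ring_L S])
    moreover have "finite_product_of_fields (class_ring :: 'r ring)"
      using noetherian[OF N] semisimple_imp_regular_scalars[OF assms S]
      by (intro finite_product_of_fields_class_ringI) auto
    ultimately show ?thesis using noetherian by blast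
  qed
qed

lemma conditions_sufficient:
  assumes "fin_digraph E" "condition_NE E"
  shows "left_noetherian (class_ring :: 'r::comm_ring_1 ring) \<Longrightarrow> left_noetherian (L :: ('r, _) module)"
    and "\<exists>ms ns. 0 \<notin> set ms \<and> 0 \<notin> set ns \<and>
      algebra_isomorphic (L :: ('r, _) module) (algebra_prod (matrix_product ms) (laurent_matrix_product ns))"
    and "acyclic_digraph E \<Longrightarrow> left_artinian (class_ring :: 'r ring) \<Longrightarrow> left_artinian (L :: ('r, _) module)"
    and "acyclic_digraph E \<Longrightarrow>
      \<exists>ms. 0 \<notin> set ms \<and> algebra_isomorphic (L :: ('r, _) module) (matrix_product ms)"
    and "acyclic_digraph E \<Longrightarrow> finite_product_of_fields (class_ring :: 'r ring) \<Longrightarrow>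
      semisimple_ring (L :: ('r, _) module)"
proof -
  obtain W c where "ne_graph E W c" and W: "acyclic_digraph E \<Longrightarrow> W = {}"
    using ne_graph_exists[OF assms] by blast
  then interpret N: ne_graph E W c by blast
  show "left_noetherian (class_ring :: 'r ring) \<Longrightarrow> left_noetherian (L :: ('r, _) module)"
    by (rule N.left_noetherian_L)
  show "acyclic_digraph E \<Longrightarrow> left_artinian (class_ring :: 'r ring) \<Longrightarrow> left_artinian (L :: ('r, _) module)"
    by (rule N.left_artinian_L[OF W])
  show "acyclic_digraph E \<Longrightarrow> finite_product_of_fields (class_ring :: 'r ring) \<Longrightarrow>
      semisimple_ring (L :: ('r, _) module)"
    by (rule N.semisimple_ring_L[OF W])
  obtain ms ns where ms: "0 \<notin> set ms" "0 \<notin> set ns" "W = {} \<longrightarrow> ns = []"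
    "algebra_isomorphic (L :: ('r, _) module) (algebra_prod (matrix_product ms) (laurent_matrix_product ns))"
    by (rule N.algebra_isomorphic_product)
  then show "\<exists>ms ns. 0 \<notin> set ms \<and> 0 \<notin> set ns \<and>
      algebra_isomorphic (L :: ('r, _) module) (algebra_prod (matrix_product ms) (laurent_matrix_product ns))"
    by blast
  show "\<exists>ms. 0 \<notin> set ms \<and> algebra_isomorphic (L :: ('r, _) module) (matrix_product ms)"
    if "acyclic_digraph E"
    using ms(1) algebra_isomorphic_fst[OF ms(4)[unfolded ms(3)[THEN mp, OF W[OF that]]]] by blast
qed

end

lemma acyclic_digraph_imp_NE: "acyclic_digraph E \<Longrightarrow> condition_NE E"
  by (simp add: acyclic_digraph_def condition_NE_def)

theorem theorem7:
  fixes E :: "('v, 'e) pre_digraph"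
    and R :: "'r::comm_ring_1 ring"
    and L :: "('r, (('v, 'e) lpa_gen free_monoid \<Rightarrow>\<^sub>0 'r) set) module"
  assumes "wf_digraph E" and "verts E \<noteq> {}"
  defines "R \<equiv> class_ring" and "L \<equiv> leavitt_path_algebra E"
  shows
    "((left_noetherian L \<longleftrightarrow> left_noetherian R \<and> fin_digraph E \<and> condition_NE E) \<and>
      (left_noetherian L \<longrightarrow>
        (\<exists>ms ns. 0 \<notin> set ms \<and> 0 \<notin> set ns \<and>
           algebra_isomorphic L
             (algebra_prod (matrix_product ms) (laurent_matrix_product ns))))) \<and>
     ((left_artinian L \<longleftrightarrow> left_artinian R \<and> fin_digraph E \<and> acyclic_digraph E) \<and>
      (left_artinian L \<longrightarrow>
        (\<exists>ms. 0 \<notin> set ms \<and> algebra_isomorphic L (matrix_product ms)))) \<and>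
     (semisimple_ring L \<longleftrightarrow>
        finite_product_of_fields R \<and> fin_digraph E \<and> acyclic_digraph E)"
proof -
  interpret G: lpa_graph E by (rule lpa_graph.intro) fact
  note necessary = G.conditions_necessary[OF assms(2), where 'r = 'r, folded R_def L_def]
  note sufficient = G.conditions_sufficient[where 'r = 'r, folded R_def L_def]
  note acyclic = acyclic_digraph_imp_NE[of E]
  show ?thesis
  proof (intro conjI)
    show "left_noetherian L \<longleftrightarrow> left_noetherian R \<and> fin_digraph E \<and> condition_NE E"
      using necessary(1) sufficient(1) by blast
    show "left_artinian L \<longleftrightarrow> left_artinian R \<and> fin_digraph E \<and> acyclic_digraph E"
      using necessary(2) sufficient(3) acyclic by blast
    show "semisimple_ring L \<longleftrightarrow> finite_product_of_fields R \<and> fin_digraph E \<and> acyclic_digraph E"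
      using necessary(3) sufficient(5) acyclic by blast
    show "left_noetherian L \<longrightarrow> (\<exists>ms ns. 0 \<notin> set ms \<and> 0 \<notin> set ns \<and>
        algebra_isomorphic L (algebra_prod (matrix_product ms) (laurent_matrix_product ns)))"
      by (intro impI sufficient(2)) (use necessary(1) in blast)+
    show "left_artinian L \<longrightarrow> (\<exists>ms. 0 \<notin> set ms \<and> algebra_isomorphic L (matrix_product ms))"
      by (intro impI sufficient(4)) (use necessary(2) acyclic in blast)+
  qed
qed

end
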